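(* The objects in the essential image of the representation $$\ddot r:\mathrm{Gph}_{2fi}(\mathbf{M})^{\mathcal{S}}\longrightarrow\mathrm{End}(\mathrm{DFib})$$ (over $\mathrm{Cat}$) of the fibration of Eilenberg–Moore algebras for the symmetrization monad $\mathcal{S}$ are the analytic endofunctors (on presheaf categories) in the sense of Fiore–Gambino–Hyland–Winskel.
   Context: $\mathrm{Cat}$ is the category of small categories. For a small category $O$, $\widehat O$ is the category of presheaves $O^{op}\to\mathrm{Set}$, identified with the category $\mathrm{DFib}(O)$ of small discrete fibrations over $O$. $\mathbf{M}(O)$ is the free strict monoidal category on $O$: objects are finite sequences $\vec o=\langle o_1,\dots,o_n\rangle$ of objects of $O$, morphisms are sequences (of the same length) of morphisms. $\mathbf{sM}(O)$ is the free symmetric strict monoidal category: same objects, and a morphism $\vec q\to\vec o$ (both of length $n$) is a pair $(\sigma,\vec v)$ with $\sigma$ a permutation of $\{1,\dots,n\}$ and $v_i:q_i\to o_{\sigma(i)}$ in $O$. Write $\mathbf u:\mathbf M(O)\to\mathbf{sM}(O)$ for the inclusion, $\iota(\vec o)=Y(o_1)+\dots+Y(o_n)\in\widehat O$ ($Y$ the Yoneda embedding); $\mathbf{sM}(O)(\vec q,\vec o)\subseteq\widehat O(\iota(\vec q),\iota(\vec o))$. For $X\in\widehat O$ put $X^{\vec p}=\prod_{i}X(p_i)$. $\mathrm{Gph}_{2fi}(\mathbf M)\to\mathrm{Cat}$ is the fibration whose fiber over $O$ consists of two-sided discrete fibrations from $O$ to $\mathbf M(O)$, equivalently functors $A(-;-):O^{op}\times\mathbf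 M(O)\to\mathrm{Set}$. A morphism $A\to B$ over $u:O\to Q$ is a natural family $A(o;\vec o)\to B(u(o);u(\vec o))$. $\mathrm{End}(\mathrm{DFib})\to\mathrm{Cat}$ is the fibration whose fiber over $O$ is the category of endofunctors of $\widehat O$ and natural transformations; a morphism over $u:O\to Q$ from $P$ to $P'$ is a natural transformation $Pu^*\to u^*P'$, where $u^*:\widehat Q\to\widehat O$ is reindexing. For $A$ over $O$ and $X\in\widehat O$, $(A\star X)(o)=\int^{\vec p\in\mathbf M(O)}A(o;\vec p)\times X^{\vec p}$, and $r(A)=A\star(-)$. The symmetrization monad $\mathcal{S}$ on $\mathrm{Gph}_{2fi}(\mathbf M)$ (a monad over $\mathrm{Cat}$) is $\mathcal{S}(A)(o;\vec o)=\int^{\vec q\in\mathbf M(O)}A(o;\vec q)\times\mathbf{sM}(O)(\vec q,\vec o)$, with unit $a\mapsto[a,1]$ and multiplication given by composition in $\mathbf{sM}(O)$. $\mathrm{Gph}_{2fi}(\mathbf M)^{\mathcal{S}}$ is the fibration over $\mathrm{Cat}$ of $\mathcal{S}$-algebras. For an $\mathcal{S}$-algebra $(A,\phi:\mathcal{S}(A)\to A)$ over $O$, $\ddot r(A,\phi)$ is the endofunctor of $\widehat O$ sending $X$ to the coequalizer in $\widehat O$ of the two maps $\mathcal{S}(A)\star X\rightrightarrows A\star X$ given by $\phi\star1_X$ and by $[a,(\sigma,\vec v),\langle x_i\rangle_i]\mapsto[a,\langle X(v_i)(x_{\sigma(i)})\rangle_i]$; equivalently, $\ddot r$ is the left adjoint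 of the comparison functor $\mathrm{End}(\mathrm{DFib})\to\mathrm{Gph}_{2fi}(\mathbf M)^{\mathcal S}$ associated with the right adjoint $H\mapsto[(o;\vec o)\mapsto H(\iota(\vec o))(o)]$ restricted along $\mathcal{S}$. An endofunctor $P:\widehat O\to\widehat O$ is analytic (in the sense of Fiore–Gambino–Hyland–Winskel) if there is a functor $F:\mathbf{sM}(O)\to\widehat O$ such that $P$ is isomorphic to the left Kan extension of $F$ along $\mathbf{sM}(O)\to\widehat O$, i.e. $P(X)\cong\int^{\vec p\in\mathbf{sM}(O)}F(\vec p)\times X^{\vec p}$ naturally in $X$. *)

theory Defs
  imports Main "HOL-Library.FuncSet" "HOL-Combinatorics.Permutations"
begin

text \<open>
  The category \<open>Set\<close> consists of the \<open>small\<close> sets of elements of a fixed but arbitrary type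
  of class \<open>set_universe\<close>. If the cardinality of that type is inaccessible, the sets of smaller
  cardinality satisfy the axioms; so do the sets of cardinality below any uncountable
  regular cardinal, and the collection of all subsets of an infinite type.
\<close>

class set_universe =
  fixes small :: "'a set \<Rightarrow> bool"
  assumes small_infinite: "\<exists>A. small A \<and> infinite A"
    and small_subset: "small A \<Longrightarrow> B \<subseteq> A \<Longrightarrow> small B"
    and small_image: "small A \<Longrightarrow> small (f ` A)"
    and small_UN: "small A \<Longrightarrow> (\<And>a. a \<in> A \<Longrightarrow> small (F a)) \<Longrightarrow> small (\<Union>a\<in>A. F a)"


section \<open>Categories, functors, natural transformations\<close>

record ('o, 'a) cat =
  Ob :: "'o set"
  Ar :: "'a set"
  Dom :: "'a \<Rightarrow> 'o"
  Cod :: "'a \<Rightarrow> 'o"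
  Ide :: "'o \<Rightarrow> 'a"
  Comp :: "'a \<Rightarrow> 'a \<Rightarrow> 'a"  \<comment> \<open>\<open>Comp C g f\<close> is \<open>g\<close> after \<open>f\<close>\<close>

definition Hom :: "('o, 'a) cat \<Rightarrow> 'o \<Rightarrow> 'o \<Rightarrow> 'a set" where
  "Hom C x y = {f \<in> Ar C. Dom C f = x \<and> Cod C f = y}"

locale category =
  fixes C :: "('o, 'a) cat"
  assumes Dom_Ob: "f \<in> Ar C \<Longrightarrow> Dom C f \<in> Ob C"
    and Cod_Ob: "f \<in> Ar C \<Longrightarrow> Cod C f \<in> Ob C"
    and Ide_Hom: "x \<in> Ob C \<Longrightarrow> Ide C x \<in> Hom C x x"
    and Comp_Hom: "f \<in> Hom C x y \<Longrightarrow> g \<in> Hom C y z \<Longrightarrow> Comp C g f \<in> Hom C x z"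
    and Comp_Ide_right: "f \<in> Hom C x y \<Longrightarrow> Comp C f (Ide C x) = f"
    and Comp_Ide_left: "f \<in> Hom C x y \<Longrightarrow> Comp C (Ide C y) f = f"
    and Comp_assoc: "f \<in> Hom C x y \<Longrightarrow> g \<in> Hom C y z \<Longrightarrow> h \<in> Hom C z w \<Longrightarrow>
      Comp C h (Comp C g f) = Comp C (Comp C h g) f"

definition isomorphic :: "('o, 'a) cat \<Rightarrow> 'o \<Rightarrow> 'o \<Rightarrow> bool" where
  "isomorphic C x y \<longleftrightarrow>
    (\<exists>f \<in> Hom C x y. \<exists>g \<in> Hom C y x. Comp C g f = Ide C x \<and> Comp C f g = Ide C y)"

definition op_cat :: "('o, 'a) cat \<Rightarrow> ('o, 'a) cat" where
  "op_cat C = \<lparr>Ob = Ob C, Ar = Ar C, Dom = Cod C, Cod = Dom C, Ide = Ide C,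
     Comp = (\<lambda>g f. Comp C f g)\<rparr>"

definition prod_cat :: "('o, 'a) cat \<Rightarrow> ('p, 'b) cat \<Rightarrow> ('o \<times> 'p, 'a \<times> 'b) cat" where
  "prod_cat C D = \<lparr>Ob = Ob C \<times> Ob D, Ar = Ar C \<times> Ar D,
     Dom = map_prod (Dom C) (Dom D), Cod = map_prod (Cod C) (Cod D),
     Ide = map_prod (Ide C) (Ide D),
     Comp = (\<lambda>(g, g') (f, f'). (Comp C g f, Comp D g' f'))\<rparr>"

record ('o, 'a, 'p, 'b) ftr =
  FOb :: "'o \<Rightarrow> 'p"
  FAr :: "'a \<Rightarrow> 'b"

text \<open>
  Functors and families of arrows are extensional (\<open>undefined\<close> outside the carrier of the
  source), so that equality of functors and of natural transformations is HOL equality.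
\<close>

definition is_functor :: "('o, 'a) cat \<Rightarrow> ('p, 'b) cat \<Rightarrow> ('o, 'a, 'p, 'b) ftr \<Rightarrow> bool" where
  "is_functor C D F \<longleftrightarrow>
     FOb F \<in> Ob C \<rightarrow>\<^sub>E Ob D \<and> FAr F \<in> Ar C \<rightarrow>\<^sub>E Ar D \<and>
     (\<forall>f \<in> Ar C. Dom D (FAr F f) = FOb F (Dom C f) \<and> Cod D (FAr F f) = FOb F (Cod C f)) \<and>
     (\<forall>x \<in> Ob C. FAr F (Ide C x) = Ide D (FOb F x)) \<and>
     (\<forall>f \<in> Ar C. \<forall>g \<in> Ar C. Cod C f = Dom C g \<longrightarrow>
        FAr F (Comp C g f) = Comp D (FAr F g) (FAr F f))"

definition id_ftr :: "('o, 'a) cat \<Rightarrow> ('o, 'a, 'o, 'a) ftr" where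
  "id_ftr C = \<lparr>FOb = (\<lambda>x\<in>Ob C. x), FAr = (\<lambda>f\<in>Ar C. f)\<rparr>"

definition comp_ftr :: "('o, 'a) cat \<Rightarrow> ('p, 'b, 'q, 'c) ftr \<Rightarrow> ('o, 'a, 'p, 'b) ftr
    \<Rightarrow> ('o, 'a, 'q, 'c) ftr" where  \<comment> \<open>\<open>C\<close> is the source of \<open>F\<close>\<close>
  "comp_ftr C G F =
     \<lparr>FOb = compose (Ob C) (FOb G) (FOb F), FAr = compose (Ar C) (FAr G) (FAr F)\<rparr>"

record ('o, 'a, 'p, 'b) ntr =
  NDom :: "('o, 'a, 'p, 'b) ftr"
  NCod :: "('o, 'a, 'p, 'b) ftr"
  At :: "'o \<Rightarrow> 'b"

definition is_ntr :: "('o, 'a) cat \<Rightarrow> ('p, 'b) cat \<Rightarrow> ('o, 'a, 'p, 'b) ntr \<Rightarrow> bool" where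
  "is_ntr C D n \<longleftrightarrow>
     is_functor C D (NDom n) \<and> is_functor C D (NCod n) \<and> At n \<in> extensional (Ob C) \<and>
     (\<forall>x \<in> Ob C. At n x \<in> Hom D (FOb (NDom n) x) (FOb (NCod n) x)) \<and>
     (\<forall>f \<in> Ar C. Comp D (At n (Cod C f)) (FAr (NDom n) f)
                 = Comp D (FAr (NCod n) f) (At n (Dom C f)))"

definition fun_cat :: "('o, 'a) cat \<Rightarrow> ('p, 'b) cat
    \<Rightarrow> (('o, 'a, 'p, 'b) ftr, ('o, 'a, 'p, 'b) ntr) cat" where
  "fun_cat C D = \<lparr>Ob = {F. is_functor C D F}, Ar = {n. is_ntr C D n},
     Dom = NDom, Cod = NCod,
     Ide = (\<lambda>F. \<lparr>NDom = F, NCod = F, At = (\<lambda>x\<in>Ob C. Ide D (FOb F x))\<rparr>),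
     Comp = (\<lambda>m n. \<lparr>NDom = NDom n, NCod = NCod m, At = (\<lambda>x\<in>Ob C. Comp D (At m x) (At n x))\<rparr>)\<rparr>"

definition ess_image :: "('o, 'a) cat \<Rightarrow> ('p, 'b) cat \<Rightarrow> ('o, 'a, 'p, 'b) ftr \<Rightarrow> 'p set" where
  "ess_image C D F = {y \<in> Ob D. \<exists>x \<in> Ob C. isomorphic D (FOb F x) y}"

text \<open>
  An arrow of Eilenberg-Moore algebras of \<open>(T, eta, mu)\<close> is given as a triple of its source
  algebra, its target algebra and the underlying arrow of \<open>C\<close>.
\<close>

definition em_cat :: "('o, 'a) cat \<Rightarrow> ('o, 'a, 'o, 'a) ftr \<Rightarrow> ('o \<Rightarrow> 'a) \<Rightarrow> ('o \<Rightarrow> 'a)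
    \<Rightarrow> ('o \<times> 'a, ('o \<times> 'a) \<times> ('o \<times> 'a) \<times> 'a) cat" where
  "em_cat C T eta mu =
     (let Alg = {(x, h). x \<in> Ob C \<and> h \<in> Hom C (FOb T x) x \<and>
                   Comp C h (eta x) = Ide C x \<and> Comp C h (mu x) = Comp C h (FAr T h)}
      in \<lparr>Ob = Alg,
          Ar = {((x, h), (y, k), f) | x h y k f. (x, h) \<in> Alg \<and> (y, k) \<in> Alg \<and>
                  f \<in> Hom C x y \<and> Comp C f h = Comp C k (FAr T f)},
          Dom = (\<lambda>(s, t, f). s), Cod = (\<lambda>(s, t, f). t),
          Ide = (\<lambda>(x, h). ((x, h), (x, h), Ide C x)),
          Comp = (\<lambda>(s', t', g) (s, t, f). (s, t', Comp C g f))\<rparr>)"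


section \<open>Sets, and sets given by generators and relations\<close>

record 'u sarr =
  SDom :: "'u set"
  SCod :: "'u set"
  app :: "'u \<Rightarrow> 'u"

definition Set_cat :: "('u::set_universe set, 'u sarr) cat" where
  "Set_cat = \<lparr>Ob = {A. small A},
     Ar = {f. small (SDom f) \<and> small (SCod f) \<and> app f \<in> SDom f \<rightarrow>\<^sub>E SCod f},
     Dom = SDom, Cod = SCod,
     Ide = (\<lambda>A. \<lparr>SDom = A, SCod = A, app = (\<lambda>a\<in>A. a)\<rparr>),
     Comp = (\<lambda>g f. \<lparr>SDom = SDom f, SCod = SCod g, app = compose (SDom f) (app g) (app f)\<rparr>)\<rparr>"

record 'b pres =
  Gen :: "'b set"
  Rel :: "'b rel"

definition eqv :: "'b pres \<Rightarrow> 'b rel" where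
  "eqv P = (Rel P \<union> (Rel P)\<inverse>)\<^sup>* \<inter> Gen P \<times> Gen P"

text \<open>
  \<open>cls P b\<close> is the class of the generator \<open>b\<close>. Equivalence classes are sets of generators;
  to obtain a set of elements of the universe, they are coded by a chosen injection
  (which exists whenever the set of generators is no larger than a small set).
\<close>

definition cls :: "'b pres \<Rightarrow> 'b \<Rightarrow> 'u" where
  "cls P b = (SOME e :: 'b set \<Rightarrow> 'u. inj_on e (Gen P // eqv P)) (eqv P `` {b})"

definition quot :: "'b pres \<Rightarrow> 'u set" where
  "quot P = cls P ` Gen P"

definition rep :: "'b pres \<Rightarrow> 'u \<Rightarrow> 'b" where
  "rep P z = (SOME b. b \<in> Gen P \<and> cls P b = z)"

definition qmap :: "'b pres \<Rightarrow> 'c pres \<Rightarrow> ('b \<Rightarrow> 'c) \<Rightarrow> 'u sarr" where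
  "qmap P Q h = \<lparr>SDom = quot P, SCod = quot Q, app = (\<lambda>z\<in>quot P. cls Q (h (rep P z)))\<rparr>"

text \<open>
  A bifunctor \<open>T\<close> on \<open>C\<^sup>o\<^sup>p \<times> C\<close>: \<open>BSet T c d\<close> is its value, \<open>BL T f\<close> its contravariant
  action (on the first argument), \<open>BR T f\<close> its covariant action (on the second argument).
  The coend of \<open>T\<close> is \<open>quot (coend C T)\<close>.
\<close>

record ('o, 'a, 'x) bif =
  BSet :: "'o \<Rightarrow> 'o \<Rightarrow> 'x set"
  BL :: "'a \<Rightarrow> 'x \<Rightarrow> 'x"
  BR :: "'a \<Rightarrow> 'x \<Rightarrow> 'x"

definition coend :: "('o, 'a) cat \<Rightarrow> ('o, 'a, 'x) bif \<Rightarrow> ('o \<times> 'x) pres" where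
  "coend C T = \<lparr>Gen = (SIGMA c:Ob C. BSet T c c),
     Rel = {((Dom C f, BL T f t), (Cod C f, BR T f t)) | f t.
              f \<in> Ar C \<and> t \<in> BSet T (Cod C f) (Dom C f)}\<rparr>"


section \<open>Presheaves and free (symmetric) strict monoidal categories\<close>

type_synonym 'u scat = "('u, 'u) cat"
type_synonym 'u sftr = "('u, 'u, 'u, 'u) ftr"
type_synonym 'u psh = "('u, 'u, 'u set, 'u sarr) ftr"
type_synonym 'u pmap = "('u, 'u, 'u set, 'u sarr) ntr"
type_synonym 'u pend = "('u psh, 'u pmap, 'u psh, 'u pmap) ftr"
type_synonym 'u pendmap = "('u psh, 'u pmap, 'u psh, 'u pmap) ntr"

definition small_cats :: "'u::set_universe scat set" where
  "small_cats = {C. category C \<and> small (Ob C) \<and> small (Ar C)}"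

definition PSh :: "'u::set_universe scat \<Rightarrow> ('u psh, 'u pmap) cat" where
  "PSh C = fun_cat (op_cat C) Set_cat"

definition reindex_map :: "'u scat \<Rightarrow> 'u sftr \<Rightarrow> 'u pmap \<Rightarrow> 'u pmap" where
  "reindex_map C u \<alpha> = \<lparr>NDom = comp_ftr (op_cat C) (NDom \<alpha>) u,
     NCod = comp_ftr (op_cat C) (NCod \<alpha>) u, At = (\<lambda>x\<in>Ob C. At \<alpha> (FOb u x))\<rparr>"

definition reindex :: "'u::set_universe scat \<Rightarrow> 'u scat \<Rightarrow> 'u sftr \<Rightarrow> 'u pend" where
  "reindex C D u = \<lparr>FOb = (\<lambda>X\<in>Ob (PSh D). comp_ftr (op_cat C) X u),
     FAr = (\<lambda>\<alpha>\<in>Ar (PSh D). reindex_map C u \<alpha>)\<rparr>"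

definition M :: "'u scat \<Rightarrow> ('u list, 'u list) cat" where
  "M C = \<lparr>Ob = lists (Ob C), Ar = lists (Ar C), Dom = map (Dom C), Cod = map (Cod C),
     Ide = map (Ide C), Comp = map2 (Comp C)\<rparr>"

text \<open>
  Positions in sequences are numbered from \<open>0\<close>. The arrow \<open>(\<sigma>, v)\<close> has components
  \<open>v ! i : q ! i \<rightarrow> p ! \<sigma> i\<close>, where \<open>q\<close> is its domain and \<open>p\<close> its codomain; hence
  \<open>p ! j\<close> is the codomain of \<open>v ! inv \<sigma> j\<close>.
\<close>

type_synonym 'u smarr = "(nat \<Rightarrow> nat) \<times> 'u list"

definition sM :: "'u scat \<Rightarrow> ('u list, 'u smarr) cat" where
  "sM C = \<lparr>Ob = lists (Ob C),
     Ar = {(\<sigma>, v). v \<in> lists (Ar C) \<and> \<sigma> permutes {..<length v}},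
     Dom = (\<lambda>(\<sigma>, v). map (Dom C) v),
     Cod = (\<lambda>(\<sigma>, v). permute_list (inv \<sigma>) (map (Cod C) v)),
     Ide = (\<lambda>p. (id, map (Ide C) p)),
     Comp = (\<lambda>(\<tau>, w) (\<sigma>, v). (\<tau> \<circ> \<sigma>, map2 (Comp C) (permute_list \<sigma> w) v))\<rparr>"

definition incl :: "'u list \<Rightarrow> 'u smarr" where
  "incl v = (id, v)"

definition pow :: "'u psh \<Rightarrow> 'u list \<Rightarrow> 'u list set" where
  "pow X p = {xs. list_all2 (\<lambda>a x. a \<in> FOb X x) xs p}"

definition pow_act :: "'u psh \<Rightarrow> 'u smarr \<Rightarrow> 'u list \<Rightarrow> 'u list" where
  "pow_act X = (\<lambda>(\<sigma>, v) xs. map2 (\<lambda>f a. app (FAr X f) a) v (permute_list \<sigma> xs))"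

definition pow_map :: "'u pmap \<Rightarrow> 'u list \<Rightarrow> 'u list \<Rightarrow> 'u list" where
  "pow_map \<alpha> p xs = map2 (\<lambda>x a. app (At \<alpha> x) a) p xs"


section \<open>The category of endofunctors of presheaf categories\<close>

text \<open>Arrows of a category fibred over \<open>Cat\<close>, lying over the functor \<open>Base\<close>.\<close>

record ('x, 'u, 'n) farr =
  Src :: 'x
  Tgt :: 'x
  Base :: "'u sftr"
  Over :: 'n

type_synonym 'u edob = "'u scat \<times> 'u pend"
type_synonym 'u edarr = "('u edob, 'u, 'u pendmap) farr"

definition EndDFib :: "('u::set_universe edob, 'u edarr) cat" where
  "EndDFib =
     (let Obs = {(C, P). C \<in> small_cats \<and> is_functor (PSh C) (PSh C) P}
      in \<lparr>Ob = Obs,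
          Ar = {\<lparr>Src = (C, P), Tgt = (D, P'), Base = u, Over = \<alpha>\<rparr> | C P D P' u \<alpha>.
                  (C, P) \<in> Obs \<and> (D, P') \<in> Obs \<and> is_functor C D u \<and>
                  \<alpha> \<in> Hom (fun_cat (PSh D) (PSh C))
                        (comp_ftr (PSh D) P (reindex C D u))
                        (comp_ftr (PSh D) (reindex C D u) P')},
          Dom = Src, Cod = Tgt,
          Ide = (\<lambda>(C, P). \<lparr>Src = (C, P), Tgt = (C, P), Base = id_ftr C,
                           Over = Ide (fun_cat (PSh C) (PSh C)) P\<rparr>),
          Comp = (\<lambda>b a.
            let (C, P) = Src a; (D, P') = Tgt a; (E, P'') = Tgt b;
                u = Base a; v = Base b; vu = comp_ftr C v u
            in \<lparr>Src = (C, P), Tgt = (E, P''), Base = vu,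
                Over = \<lparr>NDom = comp_ftr (PSh E) P (reindex C E vu),
                        NCod = comp_ftr (PSh E) (reindex C E vu) P'',
                        At = (\<lambda>X\<in>Ob (PSh E).
                          Comp (PSh C) (FAr (reindex C D u) (At (Over b) X))
                                       (At (Over a) (FOb (reindex D E v) X)))\<rparr>\<rparr>)\<rparr>)"


section \<open>The category of graphs and the symmetrization monad\<close>

type_synonym 'u gph = "('u \<times> 'u list, 'u \<times> 'u list, 'u set, 'u sarr) ftr"
type_synonym 'u gmap = "('u \<times> 'u list, 'u \<times> 'u list, 'u set, 'u sarr) ntr"
type_synonym 'u gob = "'u scat \<times> 'u gph"
type_synonym 'u garr = "('u gob, 'u, 'u gmap) farr"

definition gcat :: "'u scat \<Rightarrow> ('u \<times> 'u list, 'u \<times> 'u list) cat" where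
  "gcat C = prod_cat (op_cat C) (M C)"

definition gbase :: "'u scat \<Rightarrow> 'u sftr
    \<Rightarrow> ('u \<times> 'u list, 'u \<times> 'u list, 'u \<times> 'u list, 'u \<times> 'u list) ftr" where
  "gbase C u = \<lparr>FOb = (\<lambda>(x, p)\<in>Ob (gcat C). (FOb u x, map (FOb u) p)),
                FAr = (\<lambda>(f, v)\<in>Ar (gcat C). (FAr u f, map (FAr u) v))\<rparr>"

definition Gph :: "('u::set_universe gob, 'u garr) cat" where
  "Gph =
     (let Obs = {(C, A). C \<in> small_cats \<and> is_functor (gcat C) Set_cat A}
      in \<lparr>Ob = Obs,
          Ar = {\<lparr>Src = (C, A), Tgt = (D, B), Base = u, Over = n\<rparr> | C A D B u n.
                  (C, A) \<in> Obs \<and> (D, B) \<in> Obs \<and> is_functor C D u \<and>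
                  n \<in> Hom (fun_cat (gcat C) Set_cat) A (comp_ftr (gcat C) B (gbase C u))},
          Dom = Src, Cod = Tgt,
          Ide = (\<lambda>(C, A). \<lparr>Src = (C, A), Tgt = (C, A), Base = id_ftr C,
                           Over = Ide (fun_cat (gcat C) Set_cat) A\<rparr>),
          Comp = (\<lambda>b a.
            let (C, A) = Src a; (E, B) = Tgt b;
                u = Base a; v = Base b; vu = comp_ftr C v u
            in \<lparr>Src = (C, A), Tgt = (E, B), Base = vu,
                Over = \<lparr>NDom = A, NCod = comp_ftr (gcat C) B (gbase C vu),
                        At = (\<lambda>z\<in>Ob (gcat C).
                          Comp Set_cat (At (Over b) (FOb (gbase C u) z)) (At (Over a) z))\<rparr>\<rparr>)\<rparr>)"

text \<open>Generators of the coend \<open>FOb (Sym C A) (x, p)\<close> are triples \<open>(q, a, m)\<close> with \<open>m : q \<rightarrow> p\<close> in \<open>sM C\<close>.\<close>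

definition symP :: "'u scat \<Rightarrow> 'u gph \<Rightarrow> 'u \<Rightarrow> 'u list \<Rightarrow> ('u list \<times> 'u \<times> 'u smarr) pres" where
  "symP C A x p = coend (M C)
     \<lparr>BSet = (\<lambda>q q'. FOb A (x, q') \<times> Hom (sM C) q p),
      BL = (\<lambda>v (a, m). (a, Comp (sM C) m (incl v))),
      BR = (\<lambda>v (a, m). (app (FAr A (Ide C x, v)) a, m))\<rparr>"

definition Sym :: "'u scat \<Rightarrow> 'u gph \<Rightarrow> 'u gph" where
  "Sym C A =
     \<lparr>FOb = (\<lambda>(x, p)\<in>Ob (gcat C). quot (symP C A x p)),
      FAr = (\<lambda>(f, v)\<in>Ar (gcat C).
        qmap (symP C A (Cod C f) (Dom (M C) v)) (symP C A (Dom C f) (Cod (M C) v))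
          (\<lambda>(q, a, m). (q, app (FAr A (f, Ide (M C) q)) a, Comp (sM C) (incl v) m)))\<rparr>"

definition Sym_arr :: "'u garr \<Rightarrow> 'u garr" where
  "Sym_arr k =
     (let (C, A) = Src k; (D, B) = Tgt k; u = Base k
      in \<lparr>Src = (C, Sym C A), Tgt = (D, Sym D B), Base = u,
          Over = \<lparr>NDom = Sym C A, NCod = comp_ftr (gcat C) (Sym D B) (gbase C u),
                  At = (\<lambda>(x, p)\<in>Ob (gcat C).
                    qmap (symP C A x p) (symP D B (FOb u x) (map (FOb u) p))
                      (\<lambda>(q, a, (\<sigma>, v)).
                        (map (FOb u) q, app (At (Over k) (x, q)) a, (\<sigma>, map (FAr u) v))))\<rparr>\<rparr>)"

definition Sym_ftr :: "('u::set_universe gob, 'u garr, 'u gob, 'u garr) ftr" where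
  "Sym_ftr = \<lparr>FOb = (\<lambda>(C, A)\<in>Ob Gph. (C, Sym C A)), FAr = (\<lambda>k\<in>Ar Gph. Sym_arr k)\<rparr>"

definition Sym_unit :: "'u gob \<Rightarrow> 'u garr" where
  "Sym_unit = (\<lambda>(C, A).
     \<lparr>Src = (C, A), Tgt = (C, Sym C A), Base = id_ftr C,
      Over = \<lparr>NDom = A, NCod = Sym C A,
              At = (\<lambda>(x, p)\<in>Ob (gcat C).
                \<lparr>SDom = FOb A (x, p), SCod = quot (symP C A x p),
                 app = (\<lambda>a\<in>FOb A (x, p). cls (symP C A x p) (p, a, Ide (sM C) p))\<rparr>)\<rparr>\<rparr>)"

definition Sym_mult :: "'u gob \<Rightarrow> 'u garr" where
  "Sym_mult = (\<lambda>(C, A).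
     \<lparr>Src = (C, Sym C (Sym C A)), Tgt = (C, Sym C A), Base = id_ftr C,
      Over = \<lparr>NDom = Sym C (Sym C A), NCod = Sym C A,
              At = (\<lambda>(x, p)\<in>Ob (gcat C).
                qmap (symP C (Sym C A) x p) (symP C A x p)
                  (\<lambda>(q', s, m'). let (q, a, m) = rep (symP C A x q') s
                                in (q, a, Comp (sM C) m' m)))\<rparr>\<rparr>)"

type_synonym 'u alg = "'u gob \<times> 'u garr"
type_synonym 'u algarr = "'u alg \<times> 'u alg \<times> 'u garr"

definition GphS :: "('u::set_universe alg, 'u algarr) cat" where
  "GphS = em_cat Gph Sym_ftr Sym_unit Sym_mult"


section \<open>The representation of algebras by endofunctors\<close>

text \<open>Generators of the coend \<open>FOb (star C A X) x\<close> are triples \<open>(p, a, xs)\<close> with \<open>xs \<in> X\<^sup>p\<close>.\<close>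

definition starP :: "'u scat \<Rightarrow> 'u gph \<Rightarrow> 'u psh \<Rightarrow> 'u \<Rightarrow> ('u list \<times> 'u \<times> 'u list) pres" where
  "starP C A X x = coend (M C)
     \<lparr>BSet = (\<lambda>p p'. FOb A (x, p') \<times> pow X p),
      BL = (\<lambda>v (a, xs). (a, pow_act X (incl v) xs)),
      BR = (\<lambda>v (a, xs). (app (FAr A (Ide C x, v)) a, xs))\<rparr>"

definition star :: "'u scat \<Rightarrow> 'u gph \<Rightarrow> 'u psh \<Rightarrow> 'u psh" where
  "star C A X =
     \<lparr>FOb = (\<lambda>x\<in>Ob C. quot (starP C A X x)),
      FAr = (\<lambda>f\<in>Ar C. qmap (starP C A X (Cod C f)) (starP C A X (Dom C f))
               (\<lambda>(p, a, xs). (p, app (FAr A (f, Ide (M C) p)) a, xs)))\<rparr>"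

definition star_map :: "'u scat \<Rightarrow> 'u gph \<Rightarrow> 'u pmap \<Rightarrow> 'u pmap" where
  "star_map C A \<alpha> =
     \<lparr>NDom = star C A (NDom \<alpha>), NCod = star C A (NCod \<alpha>),
      At = (\<lambda>x\<in>Ob C. qmap (starP C A (NDom \<alpha>) x) (starP C A (NCod \<alpha>) x)
              (\<lambda>(p, a, xs). (p, a, pow_map \<alpha> p xs)))\<rparr>"

definition star_alg :: "'u scat \<Rightarrow> 'u gph \<Rightarrow> 'u gmap \<Rightarrow> 'u psh \<Rightarrow> 'u pmap" where
  "star_alg C A \<phi> X =
     \<lparr>NDom = star C (Sym C A) X, NCod = star C A X,
      At = (\<lambda>x\<in>Ob C. qmap (starP C (Sym C A) X x) (starP C A X x)
              (\<lambda>(p, s, xs). (p, app (At \<phi> (x, p)) s, xs)))\<rparr>"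

definition star_perm :: "'u scat \<Rightarrow> 'u gph \<Rightarrow> 'u psh \<Rightarrow> 'u pmap" where
  "star_perm C A X =
     \<lparr>NDom = star C (Sym C A) X, NCod = star C A X,
      At = (\<lambda>x\<in>Ob C. qmap (starP C (Sym C A) X x) (starP C A X x)
              (\<lambda>(p, s, xs). let (q, a, m) = rep (symP C A x p) s
                            in (q, a, pow_act X m xs)))\<rparr>"

text \<open>Coequalizers of presheaves are computed pointwise.\<close>

definition coeqP :: "'u pmap \<Rightarrow> 'u pmap \<Rightarrow> 'u \<Rightarrow> 'u pres" where
  "coeqP \<alpha> \<beta> x = \<lparr>Gen = FOb (NCod \<alpha>) x,
     Rel = {(app (At \<alpha> x) z, app (At \<beta> x) z) | z. z \<in> FOb (NDom \<alpha>) x}\<rparr>"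

definition psh_coeq :: "'u scat \<Rightarrow> 'u pmap \<Rightarrow> 'u pmap \<Rightarrow> 'u psh" where
  "psh_coeq C \<alpha> \<beta> =
     \<lparr>FOb = (\<lambda>x\<in>Ob C. quot (coeqP \<alpha> \<beta> x)),
      FAr = (\<lambda>f\<in>Ar C. qmap (coeqP \<alpha> \<beta> (Cod C f)) (coeqP \<alpha> \<beta> (Dom C f)) (app (FAr (NCod \<alpha>) f)))\<rparr>"

definition rddP :: "'u scat \<Rightarrow> 'u gph \<Rightarrow> 'u gmap \<Rightarrow> 'u psh \<Rightarrow> 'u \<Rightarrow> 'u pres" where
  "rddP C A \<phi> X = coeqP (star_alg C A \<phi> X) (star_perm C A X)"

definition rdd_ob :: "'u scat \<Rightarrow> 'u gph \<Rightarrow> 'u gmap \<Rightarrow> 'u psh \<Rightarrow> 'u psh" where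
  "rdd_ob C A \<phi> X = psh_coeq C (star_alg C A \<phi> X) (star_perm C A X)"

definition rdd :: "'u::set_universe scat \<Rightarrow> 'u gph \<Rightarrow> 'u gmap \<Rightarrow> 'u pend" where
  "rdd C A \<phi> =
     \<lparr>FOb = (\<lambda>X\<in>Ob (PSh C). rdd_ob C A \<phi> X),
      FAr = (\<lambda>\<alpha>\<in>Ar (PSh C).
        \<lparr>NDom = rdd_ob C A \<phi> (NDom \<alpha>), NCod = rdd_ob C A \<phi> (NCod \<alpha>),
         At = (\<lambda>x\<in>Ob C. qmap (rddP C A \<phi> (NDom \<alpha>) x) (rddP C A \<phi> (NCod \<alpha>) x)
                 (app (At (star_map C A \<alpha>) x)))\<rparr>)\<rparr>"

definition rdd_arr :: "'u::set_universe algarr \<Rightarrow> 'u edarr" where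
  "rdd_arr = (\<lambda>(((C, A), h), ((D, B), k), f).
     let \<phi> = Over h; \<psi> = Over k; u = Base f
     in \<lparr>Src = (C, rdd C A \<phi>), Tgt = (D, rdd D B \<psi>), Base = u,
         Over = \<lparr>NDom = comp_ftr (PSh D) (rdd C A \<phi>) (reindex C D u),
                 NCod = comp_ftr (PSh D) (reindex C D u) (rdd D B \<psi>),
                 At = (\<lambda>X\<in>Ob (PSh D).
                   let uX = FOb (reindex C D u) X
                   in \<lparr>NDom = rdd_ob C A \<phi> uX,
                       NCod = FOb (reindex C D u) (rdd_ob D B \<psi> X),
                       At = (\<lambda>x\<in>Ob C. qmap (rddP C A \<phi> uX x) (rddP D B \<psi> X (FOb u x))
                         (app (qmap (starP C A uX x) (starP D B X (FOb u x))
                           (\<lambda>(p, a, xs).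
                             (map (FOb u) p, app (At (Over f) (x, p)) a, xs)))))\<rparr>)\<rparr>\<rparr>)"

definition rddot :: "('u::set_universe alg, 'u algarr, 'u edob, 'u edarr) ftr" where
  "rddot = \<lparr>FOb = (\<lambda>((C, A), h)\<in>Ob GphS. (C, rdd C A (Over h))),
            FAr = (\<lambda>k\<in>Ar GphS. rdd_arr k)\<rparr>"


section \<open>Analytic endofunctors\<close>

type_synonym 'u smftr = "('u list, 'u smarr, 'u psh, 'u pmap) ftr"

text \<open>
  \<open>lanP C F X x\<close> presents the value at \<open>x\<close> of the coend of \<open>F(p) \<times> X\<^sup>p\<close> over \<open>p\<close> in \<open>sM C\<close>,
  that is, of the left Kan extension of \<open>F\<close> along \<open>sM C \<rightarrow> PSh C\<close> at \<open>X\<close>.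
\<close>

definition lanP :: "'u scat \<Rightarrow> 'u smftr \<Rightarrow> 'u psh \<Rightarrow> 'u \<Rightarrow> ('u list \<times> 'u \<times> 'u list) pres" where
  "lanP C F X x = coend (sM C)
     \<lparr>BSet = (\<lambda>p p'. FOb (FOb F p') x \<times> pow X p),
      BL = (\<lambda>m (c, xs). (c, pow_act X m xs)),
      BR = (\<lambda>m (c, xs). (app (At (FAr F m) x) c, xs))\<rparr>"

definition lan_ob :: "'u scat \<Rightarrow> 'u smftr \<Rightarrow> 'u psh \<Rightarrow> 'u psh" where
  "lan_ob C F X =
     \<lparr>FOb = (\<lambda>x\<in>Ob C. quot (lanP C F X x)),
      FAr = (\<lambda>f\<in>Ar C. qmap (lanP C F X (Cod C f)) (lanP C F X (Dom C f))
               (\<lambda>(p, c, xs). (p, app (FAr (FOb F p) f) c, xs)))\<rparr>"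

definition lan :: "'u::set_universe scat \<Rightarrow> 'u smftr \<Rightarrow> 'u pend" where
  "lan C F =
     \<lparr>FOb = (\<lambda>X\<in>Ob (PSh C). lan_ob C F X),
      FAr = (\<lambda>\<alpha>\<in>Ar (PSh C).
        \<lparr>NDom = lan_ob C F (NDom \<alpha>), NCod = lan_ob C F (NCod \<alpha>),
         At = (\<lambda>x\<in>Ob C. qmap (lanP C F (NDom \<alpha>) x) (lanP C F (NCod \<alpha>) x)
                 (\<lambda>(p, c, xs). (p, c, pow_map \<alpha> p xs)))\<rparr>)\<rparr>"

definition analytic :: "'u::set_universe scat \<Rightarrow> 'u pend \<Rightarrow> bool" where
  "analytic C P \<longleftrightarrow>
     (\<exists>F. is_functor (sM C) (PSh C) F \<and> isomorphic (fun_cat (PSh C) (PSh C)) P (lan C F))"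

end

theory Submission
  imports Defs
begin

text \<open>
  An algebra for the symmetrization monad is a graph \<open>A\<close> whose covariant action of the arrows of
  \<open>M C\<close> has been extended to the arrows of \<open>sM C\<close>: the structure map \<open>[a, m] \<mapsto> m \<cdot> a\<close> is the action of
  \<open>m\<close> on \<open>a\<close>, the unit law and the multiplication law say that identities and composites act as
  they should, being well defined on classes keeps the action of the arrows of \<open>M C\<close> as before, and
  naturality makes everything commute with the action of \<open>C\<close>. So an algebra over \<open>C\<close> is the same
  thing as a functor \<open>F\<close> from \<open>sM C\<close> to presheaves, with \<open>F(p)(x) = A(x, p)\<close>. Both sides of this correspondence lead to the locale \<open>sym_action\<close>:
  \<open>algebra_sym_action\<close> for an algebra, and \<open>gph_of\<close>, \<open>alg_of\<close> for a functor.

  Under this correspondence the two endofunctors agree. The coend defining \<open>A \<star> X\<close> identifies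
  \<open>(a, v\<^sup>*xs)\<close> with \<open>(v \<cdot> a, xs)\<close> for the arrows \<open>v\<close> of \<open>M C\<close>, and the coequalizer then identifies
  \<open>(m \<cdot> a, xs)\<close> with \<open>(a, m\<^sup>*xs)\<close> for the arrows \<open>m\<close> of \<open>sM C\<close>. The second kind of relation includes
  the first, and is exactly the relation of the coend over \<open>sM C\<close> that computes the left Kan
  extension of \<open>F\<close> (\<open>rdd_rel\<close>, \<open>rdd_lift\<close>, \<open>cls_lan_iff\<close>). The resulting bijections are compatible
  with the presheaf structure and with maps of presheaves.

  Isomorphisms in the total category of endofunctors lie over isomorphisms \<open>u : C \<rightarrow> D\<close> of the base
  categories. An endofunctor \<open>P\<close> over \<open>D\<close> that is isomorphic over \<open>u\<close> to the one of an algebra over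
  \<open>C\<close> is analytic because the algebra can be read as a functor on \<open>sM D\<close>, through the inverse \<open>v\<close> of
  \<open>u\<close> (\<open>species_of\<close>); the bijections above are therefore established relative to such a pair \<open>u\<close>, \<open>v\<close>.

  The quotients are sets of codes of equivalence classes, with chosen representatives. Two
  general devices keep these choices out of sight: the lemmas \<open>cls_eq_iff\<close>, \<open>cls_lift\<close> and
  \<open>app_qmap\<close>, valid because all sets of generators have small cardinality, and transport of
  structure along bijections (\<open>transport_endofunctor\<close>), by which functoriality of a quotient
  construction is inherited from an endofunctor with the same values.
\<close>

section \<open>Essentially small sets\<close>

text \<open>
  The generators of the coends are tuples of sequences, not elements of the universe. What matters
  about them is that they are covered by a small set, for then their classes can be coded in the
  universe, and the set of codes is small.
\<close>

definition ess_small :: "'u::set_universe itself \<Rightarrow> 'b set \<Rightarrow> bool" where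
  "ess_small _ S \<longleftrightarrow> (\<exists>(J::'u set) g. small J \<and> S \<subseteq> g ` J)"

lemma ess_smallI: "small (J::'u::set_universe set) \<Longrightarrow> S \<subseteq> g ` J \<Longrightarrow> ess_small TYPE('u) S"
  unfolding ess_small_def by blast

lemma small_ess_small: "small (J::'u::set_universe set) \<Longrightarrow> ess_small TYPE('u) J"
  by (rule ess_smallI[where g = id]) auto

lemma ess_small_subset: "ess_small TYPE('u::set_universe) T \<Longrightarrow> S \<subseteq> T \<Longrightarrow> ess_small TYPE('u) S"
  unfolding ess_small_def by (meson order_trans)

lemma ess_small_image: "ess_small TYPE('u::set_universe) S \<Longrightarrow> ess_small TYPE('u) (f ` S)"
  unfolding ess_small_def by (metis image_comp image_mono)

lemma small_ess_small_image:
  assumes "ess_small TYPE('u::set_universe) S"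
  shows "small ((f :: 'b \<Rightarrow> 'u) ` S)"
proof -
  obtain J :: "'u set" and g where J: "small J" "S \<subseteq> g ` J"
    using assms unfolding ess_small_def by blast
  have "f ` S \<subseteq> (f \<circ> g) ` J" using J(2) by auto
  then show ?thesis using small_subset[OF small_image[OF J(1)]] by blast
qed

text \<open>
  An infinite small set has two distinct elements, so it can index a family with two given values.
\<close>

lemma small_Un:
  assumes "small (A :: 'u::set_universe set)" "small B"
  shows "small (A \<union> B)"
proof -
  obtain I :: "'u set" where I: "small I" "infinite I" using small_infinite by blast
  obtain i where i: "i \<in> I" using I(2) infinite_imp_nonempty by blast
  have "infinite (I - {i})" using I(2) by simp
  then obtain j where j: "j \<in> I" "j \<noteq> i" using infinite_imp_nonempty by blast
  have "(\<Union>k\<in>I. if k = i then A else B) = A \<union> B"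
    using i j by (auto split: if_splits)
  moreover have "small (\<Union>k\<in>I. if k = i then A else B)"
    by (rule small_UN[OF I(1)]) (use assms in auto)
  ultimately show ?thesis by simp
qed

lemma infinite_square_cover:
  assumes "infinite J" obtains s :: "'u \<Rightarrow> 'u \<times> 'u" where "J \<times> J = s ` J"
proof -
  obtain s where "bij_betw s J (J \<times> J)"
    using ordIso_symmetric[OF card_of_Times_same_infinite[OF assms]] card_of_ordIso by blast
  then show thesis using that[of s] by (simp add: bij_betw_def)
qed

lemma common_small_cover:
  assumes "ess_small TYPE('u::set_universe) S" "ess_small TYPE('u) T"
  obtains J :: "'u::set_universe set" and g h where "small J" "infinite J" "S \<subseteq> g ` J" "T \<subseteq> h ` J"
proof -
  obtain J :: "'u set" and g where J: "small J" "S \<subseteq> g ` J"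
    using assms(1) unfolding ess_small_def by blast
  obtain K :: "'u set" and h where K: "small K" "T \<subseteq> h ` K"
    using assms(2) unfolding ess_small_def by blast
  obtain I :: "'u set" where I: "small I" "infinite I" using small_infinite by blast
  have "small (J \<union> K \<union> I)" "infinite (J \<union> K \<union> I)" "S \<subseteq> g ` (J \<union> K \<union> I)" "T \<subseteq> h ` (J \<union> K \<union> I)"
    using J K I by (auto intro!: small_Un)
  then show thesis by (rule that)
qed

text \<open>
  One infinite small set \<open>J\<close> covers both factors, and \<open>J\<close> covers \<open>J \<times> J\<close> because an infinite set is
  equinumerous with its square.
\<close>

lemma ess_small_Times:
  assumes "ess_small TYPE('u::set_universe) S" "ess_small TYPE('u) T"
  shows "ess_small TYPE('u) (S \<times> T)"
proof -
  obtain J :: "'u set" and g h where J: "small J" "infinite J" "S \<subseteq> g ` J" "T \<subseteq> h ` J"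
    using common_small_cover[OF assms] .
  obtain s where s: "J \<times> J = s ` J" using infinite_square_cover[OF J(2)] .
  have "S \<times> T \<subseteq> map_prod g h ` (J \<times> J)" using J(3,4) by blast
  also have "\<dots> = (map_prod g h \<circ> s) ` J" by (simp add: s image_comp)
  finally show ?thesis by (rule ess_smallI[OF J(1)])
qed

lemma ess_small_nat: "ess_small TYPE('u::set_universe) (UNIV :: nat set)"
proof -
  obtain I :: "'u set" where I: "small I" "infinite I" using small_infinite by blast
  obtain e :: "nat \<Rightarrow> 'u" where e: "inj e" "range e \<subseteq> I"
    using infinite_countable_subset[OF I(2)] by auto
  have "(n::nat) \<in> inv e ` I" for n
  proof
    show "n = inv e (e n)" using e(1) by simp
    show "e n \<in> I" using e(2) by auto
  qed
  then show ?thesis by (intro ess_smallI[OF I(1), where g = "inv e"] subsetI)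
qed

text \<open>
  A list over \<open>J\<close> is decoded from its length and one element of \<open>J\<close>, by iterating the covering of
  \<open>J \<times> J\<close>.
\<close>

lemma ess_small_lists:
  assumes "ess_small TYPE('u::set_universe) S"
  shows "ess_small TYPE('u) (lists S)"
proof -
  obtain J :: "'u set" and g h where J: "small J" "infinite J" "S \<subseteq> g ` J" "S \<subseteq> h ` J"
    using common_small_cover[OF assms assms] .
  obtain s where s: "J \<times> J = s ` J" using infinite_square_cover[OF J(2)] .
  define dec where "dec = rec_nat (\<lambda>_. []) (\<lambda>_ d j. g (fst (s j)) # d (snd (s j)))"
  have dec: "dec 0 j = []" "dec (Suc n) j = g (fst (s j)) # dec n (snd (s j))" for n j
    by (simp_all add: dec_def)
  have "\<exists>j\<in>J. dec (length xs) j = xs" if "xs \<in> lists S" for xs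
    using that
  proof (induction xs)
    case Nil
    then show ?case using J(2) by (auto simp: dec dest: infinite_imp_nonempty)
  next
    case (Cons x xs)
    then obtain j where j: "j \<in> J" "dec (length xs) j = xs" by auto
    obtain i where i: "i \<in> J" "x = g i" using Cons J(3) by auto
    obtain k where "k \<in> J" "s k = (i, j)" using s i j by (metis SigmaI imageE)
    then show ?case using i j by (auto simp: dec intro!: bexI[of _ k])
  qed
  then have "lists S \<subseteq> case_prod dec ` (UNIV \<times> J)"
    by (intro subsetI) (metis SigmaI UNIV_I case_prod_conv imageI)
  moreover have "ess_small TYPE('u) ((UNIV :: nat set) \<times> J)"
    by (rule ess_small_Times[OF ess_small_nat small_ess_small[OF J(1)]])
  ultimately show ?thesis using ess_small_image ess_small_subset by metis
qed

lemma small_UN_ess: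
  assumes "ess_small TYPE('u::set_universe) S" "\<And>b. b \<in> S \<Longrightarrow> small (F b :: 'u set)"
  shows "small (\<Union>b\<in>S. F b)"
proof -
  obtain J :: "'u set" and g where J: "small J" "S \<subseteq> g ` J"
    using assms(1) unfolding ess_small_def by blast
  have "small (\<Union>j\<in>{j\<in>J. g j \<in> S}. F (g j))"
    by (rule small_UN) (use J assms(2) small_subset[of J] in auto)
  moreover have "(\<Union>j\<in>{j\<in>J. g j \<in> S}. F (g j)) = (\<Union>b\<in>S. F b)" using J(2) by fastforce
  ultimately show ?thesis by simp
qed

lemma ess_small_inj:
  assumes "ess_small TYPE('u::set_universe) S"
  shows "\<exists>e :: 'b \<Rightarrow> 'u::set_universe. inj_on e (S :: 'b set)"
proof -
  obtain J :: "'u set" and g where J: "small J" "S \<subseteq> g ` J"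
    using assms unfolding ess_small_def by blast
  show ?thesis using inj_on_inv_into[OF J(2)] by blast
qed

section \<open>Quotients by generators and relations\<close>

abbreviation small_pres :: "'u::set_universe itself \<Rightarrow> 'b pres \<Rightarrow> bool" where
  "small_pres U P \<equiv> ess_small U (Gen P)"

lemma equiv_eqv: "equiv (Gen P) (eqv P)"
proof (rule equivI)
  let ?R = "(Rel P \<union> (Rel P)\<inverse>)\<^sup>*"
  have s: "sym ?R" by (intro sym_rtrancl sym_Un_converse)
  show "sym (eqv P)" using symD[OF s] by (auto simp: eqv_def sym_def)
  show "trans (eqv P)" by (auto simp: eqv_def trans_def intro: rtrancl_trans)
qed (auto simp: eqv_def refl_on_def)

text \<open>
  There are no more classes than generators; hence an injective coding of the classes exists, and
  codes are equal only for equivalent generators.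
\<close>

lemma cls_eq_iff:
  assumes "small_pres TYPE('u::set_universe) P" "b \<in> Gen P" "c \<in> Gen P"
  shows "(cls P b :: 'u) = cls P c \<longleftrightarrow> (b, c) \<in> eqv P"
proof -
  let ?e = "SOME e :: _ set \<Rightarrow> 'u. inj_on e (Gen P // eqv P)"
  have "ess_small TYPE('u) (Gen P // eqv P)"
    using ess_small_image[OF assms(1)] by (simp add: quotient_def image_UN[symmetric]
      UNION_singleton_eq_range)
  then have "inj_on ?e (Gen P // eqv P)" using someI_ex[OF ess_small_inj] by blast
  then have "?e (eqv P `` {b}) = ?e (eqv P `` {c}) \<longleftrightarrow> eqv P `` {b} = eqv P `` {c}"
    using assms by (intro inj_on_eq_iff) (auto intro: quotientI)
  then show ?thesis unfolding cls_def using eq_equiv_class_iff[OF equiv_eqv] assms(2,3) by metis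
qed

lemma small_quot: "small_pres TYPE('u::set_universe) P \<Longrightarrow> small (quot P :: 'u set)"
  unfolding quot_def by (rule small_ess_small_image)

lemma cls_in_quot: "b \<in> Gen P \<Longrightarrow> cls P b \<in> quot P"
  by (simp add: quot_def)

lemma quotE: "z \<in> quot P \<Longrightarrow> (\<And>b. b \<in> Gen P \<Longrightarrow> z = cls P b \<Longrightarrow> thesis) \<Longrightarrow> thesis"
  by (auto simp: quot_def)

lemma rep_quot:
  assumes "z \<in> quot P" shows "rep P z \<in> Gen P" "cls P (rep P z) = z"
  using someI_ex[of "\<lambda>b. b \<in> Gen P \<and> cls P b = z"] assms unfolding rep_def quot_def by blast+

lemma cls_rel:
  assumes "small_pres TYPE('u::set_universe) P" "(b, c) \<in> Rel P" "b \<in> Gen P" "c \<in> Gen P"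
  shows "(cls P b :: 'u) = cls P c"
  using cls_eq_iff[OF assms(1,3,4)] assms(2-) by (auto simp: eqv_def)

text \<open>
  A zigzag of relations does not change the value of \<open>k\<close>. This universal property of a quotient is
  the source of all maps out of it.
\<close>

lemma cls_lift:
  assumes "small_pres TYPE('u::set_universe) P"
    and "\<And>b c. (b, c) \<in> Rel P \<Longrightarrow> k b = k c"
    and "(cls P b :: 'u) = cls P c" "b \<in> Gen P" "c \<in> Gen P"
  shows "k b = k c"
proof -
  have "(b, c) \<in> (Rel P \<union> (Rel P)\<inverse>)\<^sup>*"
    using assms cls_eq_iff[OF assms(1), of b c] by (auto simp: eqv_def)
  then show ?thesis
    by (induction rule: rtrancl_induct) (use assms(2) in fastforce)+
qed

text \<open>
  The representative chosen by \<open>qmap\<close> is related to \<open>b\<close>, hence has an equivalent image.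
\<close>

lemma app_qmap:
  assumes "small_pres TYPE('u::set_universe) P"
    and "\<And>b c. (b, c) \<in> Rel P \<Longrightarrow> (cls Q (h b) :: 'u) = cls Q (h c)"
    and "b \<in> Gen P"
  shows "app (qmap P Q h) (cls P b :: 'u) = cls Q (h b)"
proof -
  have "(cls P b :: 'u) \<in> quot P" using assms(3) by (rule cls_in_quot)
  note r = rep_quot[OF this]
  have "(cls Q (h (rep P (cls P b :: 'u))) :: 'u) = cls Q (h b)"
    by (rule cls_lift[OF assms(1), where k = "\<lambda>b. cls Q (h b)"]) (use assms r in auto)
  then show ?thesis using assms(3) by (simp add: qmap_def cls_in_quot)
qed

lemma qmap_simps [simp]: "SDom (qmap P Q h) = quot P" "SCod (qmap P Q h) = quot Q"
  by (simp_all add: qmap_def)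

lemma app_qmap_ext: "app (qmap P Q h) \<in> extensional (quot P)"
  by (simp add: qmap_def)

section \<open>Functor categories and transport of structure\<close>

lemma HomD: "f \<in> Hom C x y \<Longrightarrow> f \<in> Ar C" "f \<in> Hom C x y \<Longrightarrow> Dom C f = x" "f \<in> Hom C x y \<Longrightarrow> Cod C f = y"
  by (simp_all add: Hom_def)

lemma Ar_Hom: "f \<in> Ar C \<Longrightarrow> f \<in> Hom C (Dom C f) (Cod C f)"
  by (simp add: Hom_def)

lemma (in category) Hom_Ob: "f \<in> Hom C x y \<Longrightarrow> x \<in> Ob C" "f \<in> Hom C x y \<Longrightarrow> y \<in> Ob C"
  using Dom_Ob Cod_Ob by (auto simp: Hom_def)

lemma (in category) cancel_iso_right:
  assumes "h \<in> Hom C y z" "k \<in> Hom C y z" "b \<in> Hom C x y" "b' \<in> Hom C y x"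
    and "Comp C b b' = Ide C y" "Comp C h b = Comp C k b"
  shows "h = k"
proof -
  have "h = Comp C (Comp C h b) b'"
    using assms Comp_assoc[OF assms(4,3,1)] Comp_Ide_right[OF assms(1)] by simp
  also have "\<dots> = k"
    using assms Comp_assoc[OF assms(4,3,2)] Comp_Ide_right[OF assms(2)] by simp
  finally show ?thesis .
qed

lemma is_functorD:
  assumes "is_functor C D F"
  shows "FOb F \<in> extensional (Ob C)" "FAr F \<in> extensional (Ar C)"
    and "\<And>x. x \<in> Ob C \<Longrightarrow> FOb F x \<in> Ob D"
    and "\<And>f x y. f \<in> Hom C x y \<Longrightarrow> FAr F f \<in> Hom D (FOb F x) (FOb F y)"
    and "\<And>x. x \<in> Ob C \<Longrightarrow> FAr F (Ide C x) = Ide D (FOb F x)"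
    and "\<And>f g x y z. f \<in> Hom C x y \<Longrightarrow> g \<in> Hom C y z \<Longrightarrow>
      FAr F (Comp C g f) = Comp D (FAr F g) (FAr F f)"
  using assms unfolding is_functor_def by (auto simp: Hom_def PiE_iff)

lemma is_functorI:
  assumes "FOb F \<in> extensional (Ob C)" "FAr F \<in> extensional (Ar C)"
    and "\<And>x. x \<in> Ob C \<Longrightarrow> FOb F x \<in> Ob D"
    and "\<And>f x y. f \<in> Hom C x y \<Longrightarrow> FAr F f \<in> Hom D (FOb F x) (FOb F y)"
    and "\<And>x. x \<in> Ob C \<Longrightarrow> FAr F (Ide C x) = Ide D (FOb F x)"
    and "\<And>f g x y z. f \<in> Hom C x y \<Longrightarrow> g \<in> Hom C y z \<Longrightarrow>
      FAr F (Comp C g f) = Comp D (FAr F g) (FAr F f)"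
  shows "is_functor C D F"
  unfolding is_functor_def
  using assms(1-3,5) assms(4,6)[OF Ar_Hom] HomD[OF assms(4)[OF Ar_Hom]]
  by (auto simp: PiE_iff Hom_def)

lemma functor_eqI:
  fixes F G :: "('o, 'a, 'p, 'b) ftr"
  assumes "FOb F \<in> extensional (Ob C)" "FAr F \<in> extensional (Ar C)"
    "FOb G \<in> extensional (Ob C)" "FAr G \<in> extensional (Ar C)"
    and "\<And>x. x \<in> Ob C \<Longrightarrow> FOb F x = FOb G x" "\<And>f. f \<in> Ar C \<Longrightarrow> FAr F f = FAr G f"
  shows "F = G"
  using extensionalityI[of "FOb F" "Ob C" "FOb G"] extensionalityI[of "FAr F" "Ar C" "FAr G"] assms
  by (intro ftr.equality) auto

lemma fun_cat_simps [simp]: "Ob (fun_cat C D) = {F. is_functor C D F}" "Ar (fun_cat C D) = {n. is_ntr C D n}"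
  "Dom (fun_cat C D) = NDom" "Cod (fun_cat C D) = NCod"
  "Ide (fun_cat C D) F = \<lparr>NDom = F, NCod = F, At = (\<lambda>x\<in>Ob C. Ide D (FOb F x))\<rparr>"
  "Comp (fun_cat C D) m n =
    \<lparr>NDom = NDom n, NCod = NCod m, At = (\<lambda>x\<in>Ob C. Comp D (At m x) (At n x))\<rparr>"
  by (simp_all add: fun_cat_def)

lemma ntr_Hom_iff:
  "n \<in> Hom (fun_cat C D) F G \<longleftrightarrow>
     is_functor C D F \<and> is_functor C D G \<and> NDom n = F \<and> NCod n = G \<and> At n \<in> extensional (Ob C) \<and>
     (\<forall>x\<in>Ob C. At n x \<in> Hom D (FOb F x) (FOb G x)) \<and>
     (\<forall>f x y. f \<in> Hom C x y \<longrightarrow> Comp D (At n y) (FAr F f) = Comp D (FAr G f) (At n x))"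
  by (auto simp: Hom_def is_ntr_def)

lemma ntr_eqI:
  assumes "m \<in> Hom (fun_cat C D) F G" "n \<in> Hom (fun_cat C D) F G"
    and "\<And>x. x \<in> Ob C \<Longrightarrow> At m x = At n x"
  shows "m = n"
  using assms extensionalityI[of "At m" "Ob C" "At n"] by (intro ntr.equality) (auto simp: ntr_Hom_iff)

lemma category_fun_cat:
  assumes "category C" "category D" shows "category (fun_cat C D)"
proof -
  interpret C: category C by fact
  interpret D: category D by fact
  have comp: "Comp (fun_cat C D) m n \<in> Hom (fun_cat C D) F H"
    if n: "n \<in> Hom (fun_cat C D) F G" and m: "m \<in> Hom (fun_cat C D) G H" for m n F G H
  proof -
    have "Comp D (Comp D (At m y) (At n y)) (FAr F f) = Comp D (FAr H f) (Comp D (At m x) (At n x))"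
      if f: "f \<in> Hom C x y" for f x y
    proof -
      note [simp] = C.Hom_Ob[OF f]
      have h: "At n x \<in> Hom D (FOb F x) (FOb G x)" "At n y \<in> Hom D (FOb F y) (FOb G y)"
         "At m x \<in> Hom D (FOb G x) (FOb H x)" "At m y \<in> Hom D (FOb G y) (FOb H y)"
         "FAr F f \<in> Hom D (FOb F x) (FOb F y)" "FAr G f \<in> Hom D (FOb G x) (FOb G y)"
         "FAr H f \<in> Hom D (FOb H x) (FOb H y)"
        using m n f by (auto simp: ntr_Hom_iff intro: is_functorD(4))
      have n': "Comp D (At n y) (FAr F f) = Comp D (FAr G f) (At n x)"
        and m': "Comp D (At m y) (FAr G f) = Comp D (FAr H f) (At m x)"
        using m n f by (auto simp: ntr_Hom_iff)
      show ?thesis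
        using D.Comp_assoc[OF h(5,2,4)] D.Comp_assoc[OF h(1,6,4)] D.Comp_assoc[OF h(1,3,7)] n' m'
        by simp
    qed
    then show ?thesis using m n C.Hom_Ob by (auto simp: ntr_Hom_iff intro: D.Comp_Hom)
  qed
  have ide: "Ide (fun_cat C D) F \<in> Hom (fun_cat C D) F F" if F: "is_functor C D F" for F
  proof -
    have "Comp D (Ide D (FOb F y)) (FAr F f) = Comp D (FAr F f) (Ide D (FOb F x))" if "f \<in> Hom C x y"
      for f x y
      using D.Comp_Ide_left[OF is_functorD(4)[OF F that]] D.Comp_Ide_right[OF is_functorD(4)[OF F that]]
      by simp
    then show ?thesis using F C.Hom_Ob by (auto simp: ntr_Hom_iff intro: D.Ide_Hom is_functorD(3))
  qed
  show ?thesis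
  proof
    fix f x y assume f: "f \<in> Hom (fun_cat C D) x y"
    then have "is_functor C D x" "is_functor C D y" by (auto simp: ntr_Hom_iff)
    note i = ide[OF this(1)] ide[OF this(2)]
    show "Comp (fun_cat C D) f (Ide (fun_cat C D) x) = f"
      by (rule ntr_eqI[OF comp[OF i(1) f] f]) (use f in \<open>auto simp: ntr_Hom_iff intro: D.Comp_Ide_right\<close>)
    show "Comp (fun_cat C D) (Ide (fun_cat C D) y) f = f"
      by (rule ntr_eqI[OF comp[OF f i(2)] f]) (use f in \<open>auto simp: ntr_Hom_iff intro: D.Comp_Ide_left\<close>)
  next
    fix f g h x y z w
    assume f: "f \<in> Hom (fun_cat C D) x y" and g: "g \<in> Hom (fun_cat C D) y z"
      and h: "h \<in> Hom (fun_cat C D) z w"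
    show "Comp (fun_cat C D) h (Comp (fun_cat C D) g f) = Comp (fun_cat C D) (Comp (fun_cat C D) h g) f"
    proof (rule ntr_eqI[OF comp[OF comp[OF f g] h] comp[OF f comp[OF g h]]])
      fix c assume "c \<in> Ob C"
      then show "At (Comp (fun_cat C D) h (Comp (fun_cat C D) g f)) c
        = At (Comp (fun_cat C D) (Comp (fun_cat C D) h g) f) c"
        using f g h by (auto simp: ntr_Hom_iff intro: D.Comp_assoc)
    qed
  qed (use ide comp in \<open>auto simp: is_ntr_def\<close>)
qed

text \<open>
  Transport of structure. The value of \<open>Q\<close> at an arrow is conjugate to that of \<open>P\<close>, so that each law
  for \<open>Q\<close> can be checked after composing with the invertible \<open>b x\<close>, where it becomes a law for \<open>P\<close>.
\<close>

lemma transport_functor: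
  assumes "category C" "category D" and P: "is_functor C D P"
    and Qe: "FOb Q \<in> extensional (Ob C)" "FAr Q \<in> extensional (Ar C)"
    and b: "\<And>x. x \<in> Ob C \<Longrightarrow> b x \<in> Hom D (FOb P x) (FOb Q x)"
    and b': "\<And>x. x \<in> Ob C \<Longrightarrow> b' x \<in> Hom D (FOb Q x) (FOb P x)"
    and b'b: "\<And>x. x \<in> Ob C \<Longrightarrow> Comp D (b' x) (b x) = Ide D (FOb P x)"
    and bb': "\<And>x. x \<in> Ob C \<Longrightarrow> Comp D (b x) (b' x) = Ide D (FOb Q x)"
    and Q: "\<And>f x y. f \<in> Hom C x y \<Longrightarrow> FAr Q f \<in> Hom D (FOb Q x) (FOb Q y)"
    and nat: "\<And>f x y. f \<in> Hom C x y \<Longrightarrow> Comp D (FAr Q f) (b x) = Comp D (b y) (FAr P f)"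
  shows "is_functor C D Q"
    and "\<lparr>NDom = P, NCod = Q, At = restrict b (Ob C)\<rparr> \<in> Hom (fun_cat C D) P Q" 
    and "\<lparr>NDom = Q, NCod = P, At = restrict b' (Ob C)\<rparr> \<in> Hom (fun_cat C D) Q P" 
    and "Comp (fun_cat C D) \<lparr>NDom = Q, NCod = P, At = restrict b' (Ob C)\<rparr> \<lparr>NDom = P, NCod = Q, At
      = restrict b (Ob C)\<rparr> = Ide (fun_cat C D) P"
    and "Comp (fun_cat C D) \<lparr>NDom = P, NCod = Q, At = restrict b (Ob C)\<rparr> \<lparr>NDom = Q, NCod = P, At
      = restrict b' (Ob C)\<rparr> = Ide (fun_cat C D) Q"
    and "isomorphic (fun_cat C D) P Q"
proof -
  interpret C: category C by fact
  interpret D: category D by fact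
  show QF: "is_functor C D Q"
  proof (rule is_functorI[OF Qe])
    show "FOb Q x \<in> Ob D" if "x \<in> Ob C" for x
      using b[OF that] D.Hom_Ob by blast
  next
    fix x assume x: "x \<in> Ob C"
    have "Comp D (FAr Q (Ide C x)) (b x) = Comp D (b x) (Ide D (FOb P x))"
      using nat[OF C.Ide_Hom[OF x]] is_functorD(5)[OF P x] by simp
    also have "\<dots> = Comp D (Ide D (FOb Q x)) (b x)"
      using D.Comp_Ide_left[OF b[OF x]] D.Comp_Ide_right[OF b[OF x]] by simp
    finally show "FAr Q (Ide C x) = Ide D (FOb Q x)"
      using D.cancel_iso_right[OF Q[OF C.Ide_Hom[OF x]] _ b[OF x] b'[OF x] bb'[OF x]]
        D.Ide_Hom D.Hom_Ob(2)[OF b[OF x]] by blast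
  next
    fix f g x y z assume f: "f \<in> Hom C x y" and g: "g \<in> Hom C y z"
    note o = C.Hom_Ob(1)[OF f] C.Hom_Ob(2)[OF f] C.Hom_Ob(2)[OF g]
    note P' = is_functorD(4)[OF P f] is_functorD(4)[OF P g]
    have "Comp D (FAr Q (Comp C g f)) (b x) = Comp D (b z) (Comp D (FAr P g) (FAr P f))"
      using nat[OF C.Comp_Hom[OF f g]] is_functorD(6)[OF P f g] by simp
    also have "\<dots> = Comp D (Comp D (FAr Q g) (FAr Q f)) (b x)"
      using D.Comp_assoc[OF P' b[OF o(3)]] D.Comp_assoc[OF P'(1) b[OF o(2)] Q[OF g]]
        D.Comp_assoc[OF b[OF o(1)] Q[OF f] Q[OF g]] nat[OF f] nat[OF g] by simp
    finally show "FAr Q (Comp C g f) = Comp D (FAr Q g) (FAr Q f)"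
      by (rule D.cancel_iso_right[OF Q[OF C.Comp_Hom[OF f g]] D.Comp_Hom[OF Q[OF f] Q[OF g]]
            b[OF o(1)] b'[OF o(1)] bb'[OF o(1)]])
  qed (use Q in auto)
  have nat': "Comp D (b' y) (FAr Q f) = Comp D (FAr P f) (b' x)" if f: "f \<in> Hom C x y" for f x y
  proof (rule D.cancel_iso_right)
    note o = C.Hom_Ob[OF f] and P' = is_functorD(4)[OF P f]
    show "Comp D (b' y) (FAr Q f) \<in> Hom D (FOb Q x) (FOb P y)"
      "Comp D (FAr P f) (b' x) \<in> Hom D (FOb Q x) (FOb P y)"
      using o P' D.Comp_Hom[OF Q[OF f] b'] D.Comp_Hom[OF b' P'] by auto
    show "b x \<in> Hom D (FOb P x) (FOb Q x)" "b' x \<in> Hom D (FOb Q x) (FOb P x)"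
      "Comp D (b x) (b' x) = Ide D (FOb Q x)" using o b b' bb' by auto
    show "Comp D (Comp D (b' y) (FAr Q f)) (b x) = Comp D (Comp D (FAr P f) (b' x)) (b x)"
      using D.Comp_assoc[OF b Q[OF f] b'] D.Comp_assoc[OF b b' P'] D.Comp_assoc[OF P' b b']
        D.Comp_Ide_left[OF P'] D.Comp_Ide_right[OF P'] nat[OF f] b'b o by simp
  qed
  let ?n = "\<lparr>NDom = P, NCod = Q, At = restrict b (Ob C)\<rparr>" and ?n' = "\<lparr>NDom = Q, NCod = P, At
    = restrict b' (Ob C)\<rparr>"
  show n: "?n \<in> Hom (fun_cat C D) P Q" using P QF b nat C.Hom_Ob by (auto simp: ntr_Hom_iff)
  show n': "?n' \<in> Hom (fun_cat C D) Q P" using P QF b' nat' C.Hom_Ob by (auto simp: ntr_Hom_iff)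
  show c: "Comp (fun_cat C D) ?n' ?n = Ide (fun_cat C D) P" "Comp (fun_cat C D) ?n ?n' = Ide (fun_cat C D) Q"
    using bb' b'b by (auto intro!: restrict_ext)
  show "isomorphic (fun_cat C D) P Q" unfolding isomorphic_def using n n' c by blast
qed

lemma op_cat_simps [simp]: "Ob (op_cat C) = Ob C" "Ar (op_cat C) = Ar C" "Dom (op_cat C) = Cod C"
  "Cod (op_cat C) = Dom C" "Ide (op_cat C) = Ide C" "Comp (op_cat C) g f = Comp C f g"
  "Hom (op_cat C) x y = Hom C y x"
  by (auto simp: op_cat_def Hom_def)

lemma category_op_cat: "category C \<Longrightarrow> category (op_cat C)"
  unfolding category_def by (simp add: op_cat_def Hom_def)

subsection \<open>Set-valued functors in terms of elements\<close>

lemma Set_cat_simps [simp]: "Ob Set_cat = {A. small A}" "Dom Set_cat = SDom" "Cod Set_cat = SCod"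
  "Ide Set_cat A = \<lparr>SDom = A, SCod = A, app = (\<lambda>a\<in>A. a)\<rparr>"
  by (simp_all add: Set_cat_def)

lemma Set_Comp:
  "Comp Set_cat g f = \<lparr>SDom = SDom f, SCod = SCod g, app = compose (SDom f) (app g) (app f)\<rparr>"
  by (simp add: Set_cat_def)

lemma Set_Hom_iff:
  "f \<in> Hom Set_cat A B \<longleftrightarrow> small A \<and> small B \<and> SDom f = A \<and> SCod f = B \<and>
     app f \<in> extensional A \<and> (\<forall>a\<in>A. app f a \<in> B)"
  by (auto simp: Set_cat_def Hom_def PiE_iff)

lemma Set_eqI:
  assumes "f \<in> Hom Set_cat A B" "g \<in> Hom Set_cat A B" "\<And>a. a \<in> A \<Longrightarrow> app f a = app g a"
  shows "f = g"
  using assms extensionalityI[of "app f" A "app g"] by (intro sarr.equality) (auto simp: Set_Hom_iff)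

lemma Set_Comp_Hom: "f \<in> Hom Set_cat A B \<Longrightarrow> g \<in> Hom Set_cat B D \<Longrightarrow> Comp Set_cat g f \<in> Hom Set_cat A D"
  by (auto simp: Set_Hom_iff Set_Comp compose_def)

lemma Set_Ide_Hom: "small A \<Longrightarrow> Ide Set_cat A \<in> Hom Set_cat A A"
  by (auto simp: Set_Hom_iff)

lemma app_Comp: "f \<in> Hom Set_cat A B \<Longrightarrow> a \<in> A \<Longrightarrow> app (Comp Set_cat g f) a = app g (app f a)"
  by (auto simp: Set_Hom_iff Set_Comp compose_def)

lemma category_Set: "category (Set_cat :: ('u::set_universe set, 'u sarr) cat)"
proof
  fix f :: "'u sarr" and x y assume f: "f \<in> Hom Set_cat x y"
  show "Comp Set_cat f (Ide Set_cat x) = f"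
    by (rule Set_eqI[OF Set_Comp_Hom[OF Set_Ide_Hom f]
      f]) (use f in \<open>auto simp: Set_Hom_iff Set_Comp compose_def\<close>)
  show "Comp Set_cat (Ide Set_cat y) f = f"
    by (rule Set_eqI[OF Set_Comp_Hom[OF f Set_Ide_Hom]
      f]) (use f in \<open>auto simp: Set_Hom_iff Set_Comp compose_def\<close>)
next
  fix f g h :: "'u sarr" and x y z w
  assume f: "f \<in> Hom Set_cat x y" and g: "g \<in> Hom Set_cat y z" and h: "h \<in> Hom Set_cat z w"
  show "Comp Set_cat h (Comp Set_cat g f) = Comp Set_cat (Comp Set_cat h g) f"
    by (rule Set_eqI[OF Set_Comp_Hom[OF Set_Comp_Hom[OF f g] h] Set_Comp_Hom[OF f Set_Comp_Hom[OF g h]]])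
      (use f g h in \<open>auto simp: Set_Hom_iff Set_Comp compose_def\<close>)
next
  fix x assume "x \<in> Ob (Set_cat :: ('u set, 'u sarr) cat)"
  then show "Ide Set_cat x \<in> Hom Set_cat x x" using Set_Ide_Hom[of x] by simp
next
  fix f assume "f \<in> Ar (Set_cat :: ('u set, 'u sarr) cat)"
  then show "Dom Set_cat f \<in> Ob Set_cat" "Cod Set_cat f \<in> Ob Set_cat" by (simp_all add: Set_cat_def)
qed (rule Set_Comp_Hom)

lemma set_functorD:
  assumes "is_functor C Set_cat F"
  shows "x \<in> Ob C \<Longrightarrow> small (FOb F x)"
    and "f \<in> Hom C x y \<Longrightarrow> a \<in> FOb F x \<Longrightarrow> app (FAr F f) a \<in> FOb F y"
    and "x \<in> Ob C \<Longrightarrow> a \<in> FOb F x \<Longrightarrow> app (FAr F (Ide C x)) a = a"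
    and "f \<in> Hom C x y \<Longrightarrow> g \<in> Hom C y z \<Longrightarrow> a \<in> FOb F x \<Longrightarrow>
      app (FAr F (Comp C g f)) a = app (FAr F g) (app (FAr F f) a)"
proof -
  show "x \<in> Ob C \<Longrightarrow> small (FOb F x)" using is_functorD(3)[OF assms] by simp
  show "f \<in> Hom C x y \<Longrightarrow> a \<in> FOb F x \<Longrightarrow> app (FAr F f) a \<in> FOb F y"
    using is_functorD(4)[OF assms, of f x y] by (simp add: Set_Hom_iff)
  show "x \<in> Ob C \<Longrightarrow> a \<in> FOb F x \<Longrightarrow> app (FAr F (Ide C x)) a = a"
    using is_functorD(5)[OF assms, of x] by simp
  show "f \<in> Hom C x y \<Longrightarrow> g \<in> Hom C y z \<Longrightarrow> a \<in> FOb F x \<Longrightarrow>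
      app (FAr F (Comp C g f)) a = app (FAr F g) (app (FAr F f) a)"
    using is_functorD(6)[OF assms, of f x y g z] is_functorD(4)[OF assms, of f x y] app_Comp by metis
qed

lemma set_functorI:
  assumes "FOb F \<in> extensional (Ob C)" "FAr F \<in> extensional (Ar C)"
    and "\<And>x. x \<in> Ob C \<Longrightarrow> small (FOb F x)"
    and Hom: "\<And>f x y. f \<in> Hom C x y \<Longrightarrow> FAr F f \<in> Hom Set_cat (FOb F x) (FOb F y)"
    and "\<And>x a. x \<in> Ob C \<Longrightarrow> a \<in> FOb F x \<Longrightarrow> app (FAr F (Ide C x)) a = a"
    and "\<And>f g x y z a. f \<in> Hom C x y \<Longrightarrow> g \<in> Hom C y z \<Longrightarrow> a \<in> FOb F x \<Longrightarrow>
      app (FAr F (Comp C g f)) a = app (FAr F g) (app (FAr F f) a)"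
    and C: "category C"
  shows "is_functor C Set_cat F"
proof (rule is_functorI[OF assms(1,2)])
  interpret category C by fact
  show "FAr F (Ide C x) = Ide Set_cat (FOb F x)" if "x \<in> Ob C" for x
    by (rule Set_eqI[OF Hom[OF Ide_Hom[OF that]] Set_Ide_Hom]) (use that assms(3,5) in auto)
  show "FAr F (Comp C g f) = Comp Set_cat (FAr F g) (FAr F f)"
    if "f \<in> Hom C x y" "g \<in> Hom C y z" for f g x y z
    by (rule Set_eqI[OF Hom[OF Comp_Hom[OF that]] Set_Comp_Hom[OF Hom[OF that(1)] Hom[OF that(2)]]])
      (simp only: assms(6)[OF that] app_Comp[OF Hom[OF that(1)]])
qed (use assms(3) Hom in auto)

lemma set_ntrD:
  assumes "n \<in> Hom (fun_cat C Set_cat) F G"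
  shows "x \<in> Ob C \<Longrightarrow> a \<in> FOb F x \<Longrightarrow> app (At n x) a \<in> FOb G x"
    and "f \<in> Hom C x y \<Longrightarrow> x \<in> Ob C \<Longrightarrow> a \<in> FOb F x \<Longrightarrow>
      app (At n y) (app (FAr F f) a) = app (FAr G f) (app (At n x) a)"
proof -
  show "x \<in> Ob C \<Longrightarrow> a \<in> FOb F x \<Longrightarrow> app (At n x) a \<in> FOb G x"
    using assms by (auto simp: ntr_Hom_iff Set_Hom_iff)
  assume f: "f \<in> Hom C x y" and x: "x \<in> Ob C" and a: "a \<in> FOb F x"
  have "Comp Set_cat (At n y) (FAr F f) = Comp Set_cat (FAr G f) (At n x)"
    "FAr F f \<in> Hom Set_cat (FOb F x) (FOb F y)" "At n x \<in> Hom Set_cat (FOb F x) (FOb G x)"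
    using assms f x is_functorD(4)[of C Set_cat F f x y] unfolding ntr_Hom_iff by blast+
  then show "app (At n y) (app (FAr F f) a) = app (FAr G f) (app (At n x) a)"
    using app_Comp a by metis
qed

lemma set_ntrI:
  assumes "is_functor C Set_cat F" "is_functor C Set_cat G"
    and "NDom n = F" "NCod n = G" "At n \<in> extensional (Ob C)"
    and Hom: "\<And>x. x \<in> Ob C \<Longrightarrow> At n x \<in> Hom Set_cat (FOb F x) (FOb G x)"
    and "\<And>f x y a. f \<in> Hom C x y \<Longrightarrow> a \<in> FOb F x \<Longrightarrow>
      app (At n y) (app (FAr F f) a) = app (FAr G f) (app (At n x) a)"
    and "category C"
  shows "n \<in> Hom (fun_cat C Set_cat) F G"
proof -
  interpret category C by fact
  have "Comp Set_cat (At n y) (FAr F f) = Comp Set_cat (FAr G f) (At n x)" if f: "f \<in> Hom C x y" for f x y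
  proof -
    note h = is_functorD(4)[OF assms(1) f] Hom[OF Hom_Ob(2)[OF f]]
      Hom[OF Hom_Ob(1)[OF f]] is_functorD(4)[OF assms(2) f]
    show ?thesis
      by (rule Set_eqI[OF Set_Comp_Hom[OF h(1,2)] Set_Comp_Hom[OF h(3,4)]])
        (simp only: app_Comp[OF h(1)] app_Comp[OF h(3)] assms(7)[OF f])
  qed
  then show ?thesis using assms by (simp add: ntr_Hom_iff)
qed

definition sarr_of :: "'u set \<Rightarrow> 'u set \<Rightarrow> ('u \<Rightarrow> 'u) \<Rightarrow> 'u sarr" where
  "sarr_of A B k = \<lparr>SDom = A, SCod = B, app = restrict k A\<rparr>"

lemma sarr_of_bij:
  assumes "bij_betw k A B" "small A" "small B"
  shows "sarr_of A B k \<in> Hom Set_cat A B" "sarr_of B A (inv_into A k) \<in> Hom Set_cat B A"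
    "Comp Set_cat (sarr_of B A (inv_into A k)) (sarr_of A B k) = Ide Set_cat A"
    "Comp Set_cat (sarr_of A B k) (sarr_of B A (inv_into A k)) = Ide Set_cat B"
  using assms bij_betwE[OF assms(1)] bij_betwE[OF bij_betw_inv_into[OF assms(1)]]
    bij_betw_inv_into_left[OF assms(1)] bij_betw_inv_into_right[OF assms(1)]
  by (auto simp: Set_Hom_iff sarr_of_def Set_Comp compose_def intro!: restrict_ext)

lemma app_sarr_of [simp]: "a \<in> A \<Longrightarrow> app (sarr_of A B k) a = k a"
  by (simp add: sarr_of_def)

lemma PSh_simps [simp]: "Ob (PSh C) = {X. is_functor (op_cat C) Set_cat X}"
  "Dom (PSh C) = NDom" "Cod (PSh C) = NCod"
  by (simp_all add: PSh_def)

lemma category_PSh: "category C \<Longrightarrow> category (PSh C)"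
  unfolding PSh_def by (rule category_fun_cat[OF category_op_cat category_Set])

lemma PSh_Hom: "Hom (PSh C) = Hom (fun_cat (op_cat C) Set_cat)"
  by (simp add: PSh_def)

lemma PSh_Comp_At: "\<lbrakk>\<alpha> \<in> Hom (PSh C) X Y; x \<in> Ob C; a \<in> FOb X x\<rbrakk> \<Longrightarrow>
  app (At (Comp (PSh C) \<beta> \<alpha>) x) a = app (At \<beta> x) (app (At \<alpha> x) a)"
  using app_Comp[of "At \<alpha> x" "FOb X x" "FOb Y x" a "At \<beta> x"] by (simp add: PSh_def ntr_Hom_iff)

lemma PSh_Ide_At: "\<lbrakk>x \<in> Ob C; a \<in> FOb X x\<rbrakk> \<Longrightarrow> app (At (Ide (PSh C) X) x) a = a"
  by (simp add: PSh_def)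

lemmas pshD = set_functorD[where C = "op_cat C" for C, simplified]

lemma psh_ntrD:
  assumes "\<alpha> \<in> Hom (PSh C) X Y"
  shows "x \<in> Ob C \<Longrightarrow> a \<in> FOb X x \<Longrightarrow> app (At \<alpha> x) a \<in> FOb Y x"
    and "f \<in> Hom C y x \<Longrightarrow> x \<in> Ob C \<Longrightarrow> a \<in> FOb X x \<Longrightarrow>
      app (At \<alpha> y) (app (FAr X f) a) = app (FAr Y f) (app (At \<alpha> x) a)"
  using set_ntrD(1)[of \<alpha> "op_cat C" X Y x a] set_ntrD(2)[of \<alpha> "op_cat C" X Y f x y a] assms
  by (simp_all add: PSh_def)

lemma psh_map_eqI:
  assumes "\<alpha> \<in> Hom (PSh C) X Y" "\<beta> \<in> Hom (PSh C) X Y"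
    and "\<And>x a. x \<in> Ob C \<Longrightarrow> a \<in> FOb X x \<Longrightarrow> app (At \<alpha> x) a = app (At \<beta> x) a"
  shows "\<alpha> = \<beta>"
proof (rule ntr_eqI[OF assms(1,2)[unfolded PSh_def]])
  fix x assume x: "x \<in> Ob (op_cat C)"
  then have "At \<alpha> x \<in> Hom Set_cat (FOb X x) (FOb Y x)" "At \<beta> x \<in> Hom Set_cat (FOb X x) (FOb Y x)"
    using assms(1,2) by (auto simp: PSh_def ntr_Hom_iff)
  then show "At \<alpha> x = At \<beta> x" by (rule Set_eqI) (use assms(3) x in simp)
qed

subsection \<open>Endofunctors of presheaf categories in terms of elements\<close>

text \<open>
  The data of an endofunctor of presheaves, without functoriality and naturality. The formulas that
  define endofunctors as quotients give such data; the remaining laws are then transported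
  along bijections from an endofunctor that is already known.
\<close>

definition endo_data :: "'u::set_universe scat \<Rightarrow> 'u pend \<Rightarrow> bool" where
  "endo_data C Q \<longleftrightarrow>
     FOb Q \<in> extensional (Ob (PSh C)) \<and> FAr Q \<in> extensional (Ar (PSh C)) \<and>
     (\<forall>X\<in>Ob (PSh C). FOb (FOb Q X) \<in> extensional (Ob C) \<and> FAr (FOb Q X) \<in> extensional (Ar C) \<and>
        (\<forall>f\<in>Ar C. SDom (FAr (FOb Q X) f) = FOb (FOb Q X) (Cod C f) \<and>
                  SCod (FAr (FOb Q X) f) = FOb (FOb Q X) (Dom C f) \<and>
                  app (FAr (FOb Q X) f) \<in> extensional (FOb (FOb Q X) (Cod C f)))) \<and>
     (\<forall>\<alpha>\<in>Ar (PSh C). NDom (FAr Q \<alpha>) = FOb Q (NDom \<alpha>) \<and> NCod (FAr Q \<alpha>) = FOb Q (NCod \<alpha>) \<and>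
        At (FAr Q \<alpha>) \<in> extensional (Ob C) \<and>
        (\<forall>x\<in>Ob C. SDom (At (FAr Q \<alpha>) x) = FOb (FOb Q (NDom \<alpha>)) x \<and>
                  SCod (At (FAr Q \<alpha>) x) = FOb (FOb Q (NCod \<alpha>)) x \<and>
                  app (At (FAr Q \<alpha>) x) \<in> extensional (FOb (FOb Q (NDom \<alpha>)) x)))"

text \<open>
  Transport of structure is used twice: in \<open>Set\<close>, to see that each \<open>Q(X)\<close> is a presheaf isomorphic to
  \<open>P(X)\<close>, and then in the category of presheaves, with these isomorphisms.
\<close>

lemma transport_endofunctor:
  fixes C :: "'u::set_universe scat"
  assumes "category C" and P: "is_functor (PSh C) (PSh C) P" and Q: "endo_data C Q"
    and bij: "\<And>X x. X \<in> Ob (PSh C) \<Longrightarrow> x \<in> Ob C \<Longrightarrow> bij_betw (b X x) (FOb (FOb P X) x) (FOb (FOb Q X) x)"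
    and small: "\<And>X x. X \<in> Ob (PSh C) \<Longrightarrow> x \<in> Ob C \<Longrightarrow> small (FOb (FOb Q X) x)"
    and act: "\<And>X f x y z. X \<in> Ob (PSh C) \<Longrightarrow> f \<in> Hom C x y \<Longrightarrow> z \<in> FOb (FOb P X) y \<Longrightarrow>
      app (FAr (FOb Q X) f) (b X y z) = b X x (app (FAr (FOb P X) f) z)"
    and nat: "\<And>X Y \<alpha> x z. \<alpha> \<in> Hom (PSh C) X Y \<Longrightarrow> x \<in> Ob C \<Longrightarrow> z \<in> FOb (FOb P X) x \<Longrightarrow>
      app (At (FAr Q \<alpha>) x) (b X x z) = b Y x (app (At (FAr P \<alpha>) x) z)"
  shows "is_functor (PSh C) (PSh C) Q" and "isomorphic (fun_cat (PSh C) (PSh C)) P Q"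
proof -
  interpret C: category C by fact
  interpret O: category "op_cat C" using category_op_cat[OF assms(1)] .
  interpret S: category "PSh C" using category_PSh[OF assms(1)] .
  define e where "e = (\<lambda>X x. sarr_of (FOb (FOb P X) x) (FOb (FOb Q X) x) (b X x))"
  define e' where
    "e' = (\<lambda>X x. sarr_of (FOb (FOb Q X) x) (FOb (FOb P X) x) (inv_into (FOb (FOb P X) x) (b X x)))"
  have PX: "is_functor (op_cat C) Set_cat (FOb P X)" if "X \<in> Ob (PSh C)" for X
    using is_functorD(3)[OF P that] by simp
  have e: "e X x \<in> Hom Set_cat (FOb (FOb P X) x) (FOb (FOb Q X) x)"
      "e' X x \<in> Hom Set_cat (FOb (FOb Q X) x) (FOb (FOb P X) x)"
      "Comp Set_cat (e' X x) (e X x) = Ide Set_cat (FOb (FOb P X) x)"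
      "Comp Set_cat (e X x) (e' X x) = Ide Set_cat (FOb (FOb Q X) x)"
    if "X \<in> Ob (PSh C)" "x \<in> Ob (op_cat C)" for X x
    using sarr_of_bij[OF bij[of X x] _ small[of X x]] that set_functorD(1)[OF PX that(2)]
    by (simp_all add: e_def e'_def)
  have bP: "b X x z \<in> FOb (FOb Q X) x" if "X \<in> Ob (PSh C)" "x \<in> Ob C" "z \<in> FOb (FOb P X) x" for X x z
    using bij_betwE[OF bij[OF that(1,2)]] that(3) by blast
  have QE: "\<exists>z'\<in>FOb (FOb P X) x. z = b X x z'"
    if "X \<in> Ob (PSh C)" "x \<in> Ob C" "z \<in> FOb (FOb Q X) x" for X x z
    using bij_betw_imp_surj_on[OF bij[OF that(1,2)]] that(3) by blast
  define B where "B X = \<lparr>NDom = FOb P X, NCod = FOb Q X, At = restrict (e X) (Ob (op_cat C))\<rparr>" for X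
  define B' where "B' X = \<lparr>NDom = FOb Q X, NCod = FOb P X, At = restrict (e' X) (Ob (op_cat C))\<rparr>" for X
  have QX: "is_functor (op_cat C) Set_cat (FOb Q X)"
    and B: "B X \<in> Hom (PSh C) (FOb P X) (FOb Q X)" "B' X \<in> Hom (PSh C) (FOb Q X) (FOb P X)"
      "Comp (PSh C) (B' X) (B X) = Ide (PSh C) (FOb P X)"
      "Comp (PSh C) (B X) (B' X) = Ide (PSh C) (FOb Q X)"
    if X: "X \<in> Ob (PSh C)" for X
  proof -
    have H: "FAr (FOb Q X) f \<in> Hom Set_cat (FOb (FOb Q X) x) (FOb (FOb Q X) y)" if f: "f \<in> Hom
      (op_cat C) x y" for f x y
    proof -
      have f': "f \<in> Hom C y x" "x \<in> Ob C" "y \<in> Ob C" using f C.Hom_Ob[of f y x] by simp_all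
      have "app (FAr (FOb Q X) f) z \<in> FOb (FOb Q X) y" if z: "z \<in> FOb (FOb Q X) x" for z
      proof -
        obtain z' where z': "z' \<in> FOb (FOb P X) x" "z = b X x z'" using QE[OF X f'(2) z] by blast
        then show ?thesis
          using act[OF X f'(1) z'(1)] bP[OF X f'(3)] pshD(2)[OF PX[OF X] f'(1) z'(1)] by simp
      qed
      moreover have "SDom (FAr (FOb Q X) f) = FOb (FOb Q X) x" "SCod (FAr (FOb Q X) f) = FOb (FOb Q X) y"
        "app (FAr (FOb Q X) f) \<in> extensional (FOb (FOb Q X) x)"
        using Q X HomD[OF f'(1)] unfolding endo_data_def by auto
      ultimately show ?thesis using small[OF X] f' by (simp add: Set_Hom_iff)
    qed
    have N: "Comp Set_cat (FAr (FOb Q X) f) (e X x) = Comp Set_cat (e X y) (FAr (FOb P X) f)"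
      if f: "f \<in> Hom (op_cat C) x y" for f x y
    proof -
      have f': "f \<in> Hom C y x" using f by simp
      note ex = e(1)[OF X O.Hom_Ob(1)[OF f]] and ey = e(1)[OF X O.Hom_Ob(2)[OF f]]
      note Pf = is_functorD(4)[OF PX[OF X] f]
      show ?thesis
      proof (rule Set_eqI[OF Set_Comp_Hom[OF ex H[OF f]] Set_Comp_Hom[OF Pf ey]])
        fix a assume a: "a \<in> FOb (FOb P X) x"
        then have "app (FAr (FOb P X) f) a \<in> FOb (FOb P X) y"
          using pshD(2)[OF PX[OF X] f'] by simp
        then show "app (Comp Set_cat (FAr (FOb Q X) f) (e X x)) a
          = app (Comp Set_cat (e X y) (FAr (FOb P X) f)) a"
          unfolding app_Comp[OF ex a] app_Comp[OF Pf a] using act[OF X f' a] a by (simp add: e_def)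
      qed
    qed
    have Qe: "FOb (FOb Q X) \<in> extensional (Ob (op_cat C))" "FAr (FOb Q X) \<in> extensional (Ar (op_cat C))"
      using Q X unfolding endo_data_def by auto
    note T = transport_functor[OF O.category_axioms category_Set PX[OF X] Qe e[OF X] H N,
        folded B_def B'_def PSh_def]
    show "is_functor (op_cat C) Set_cat (FOb Q X)"
      "B X \<in> Hom (PSh C) (FOb P X) (FOb Q X)" "B' X \<in> Hom (PSh C) (FOb Q X) (FOb P X)"
      "Comp (PSh C) (B' X) (B X) = Ide (PSh C) (FOb P X)"
      "Comp (PSh C) (B X) (B' X) = Ide (PSh C) (FOb Q X)"
      by (rule T; assumption)+
  qed
  have BX: "app (At (B X) x) z = b X x z" if "x \<in> Ob C" "z \<in> FOb (FOb P X) x" for X x z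
    using that by (simp add: B_def e_def)
  have H: "FAr Q \<alpha> \<in> Hom (PSh C) (FOb Q X) (FOb Q Y)"
    and N: "Comp (PSh C) (FAr Q \<alpha>) (B X) = Comp (PSh C) (B Y) (FAr P \<alpha>)"
    if a: "\<alpha> \<in> Hom (PSh C) X Y" for \<alpha> X Y
  proof -
    have XY: "X \<in> Ob (PSh C)" "Y \<in> Ob (PSh C)" and aD: "\<alpha> \<in> Ar (PSh C)" "NDom \<alpha> = X" "NCod \<alpha> = Y"
      using S.Hom_Ob[OF a] HomD[OF a] by auto
    note Pa = is_functorD(4)[OF P a]
    have Qa: "app (At (FAr Q \<alpha>) x) z \<in> FOb (FOb Q Y) x"
      if x: "x \<in> Ob C" and z: "z \<in> FOb (FOb Q X) x" for x z
    proof -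
      obtain z' where z': "z' \<in> FOb (FOb P X) x" "z = b X x z'" using QE[OF XY(1) x z] by blast
      then show ?thesis using nat[OF a x z'(1)] bP[OF XY(2) x psh_ntrD(1)[OF Pa x z'(1)]] by simp
    qed
    show H: "FAr Q \<alpha> \<in> Hom (PSh C) (FOb Q X) (FOb Q Y)" unfolding PSh_Hom
    proof (rule set_ntrI[OF QX[OF XY(1)] QX[OF XY(2)]])
      show "NDom (FAr Q \<alpha>) = FOb Q X" "NCod (FAr Q \<alpha>) = FOb Q Y" "At (FAr Q \<alpha>) \<in> extensional (Ob (op_cat C))"
        using Q aD unfolding endo_data_def by auto
      show "At (FAr Q \<alpha>) x \<in> Hom Set_cat (FOb (FOb Q X) x) (FOb (FOb Q Y) x)" if "x \<in> Ob (op_cat C)" for x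
        using that Q aD small[OF XY(1)] small[OF XY(2)] Qa unfolding endo_data_def Set_Hom_iff by auto
      show "app (At (FAr Q \<alpha>) y) (app (FAr (FOb Q X) f) z) = app (FAr (FOb Q Y) f) (app (At (FAr Q \<alpha>) x) z)"
        if f: "f \<in> Hom (op_cat C) x y" and z: "z \<in> FOb (FOb Q X) x" for f x y z
      proof -
        have f': "f \<in> Hom C y x" "x \<in> Ob C" "y \<in> Ob C" using f C.Hom_Ob[of f y x] by simp_all
        obtain z' where z': "z' \<in> FOb (FOb P X) x" "z = b X x z'" using QE[OF XY(1) f'(2) z] by blast
        have "app (FAr (FOb P X) f) z' \<in> FOb (FOb P X) y" using pshD(2)[OF PX[OF XY(1)] f'(1) z'(1)] .
        then show ?thesis
          using act[OF XY(1) f'(1) z'(1)] act[OF XY(2) f'(1) psh_ntrD(1)[OF Pa f'(2) z'(1)]]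
            nat[OF a f'(3)] nat[OF a f'(2) z'(1)] psh_ntrD(2)[OF Pa f'(1,2) z'(1)] z'(2) by simp
      qed
    qed (rule O.category_axioms)
    show "Comp (PSh C) (FAr Q \<alpha>) (B X) = Comp (PSh C) (B Y) (FAr P \<alpha>)"
    proof (rule psh_map_eqI[OF S.Comp_Hom[OF B(1)[OF XY(1)] H] S.Comp_Hom[OF Pa B(1)[OF XY(2)]]])
      fix x z assume x: "x \<in> Ob C" and z: "z \<in> FOb (FOb P X) x"
      show "app (At (Comp (PSh C) (FAr Q \<alpha>) (B X)) x) z = app (At (Comp (PSh C) (B Y) (FAr P \<alpha>)) x) z"
        using PSh_Comp_At[OF B(1)[OF XY(1)] x z] PSh_Comp_At[OF Pa x z] BX[OF x z]
          BX[OF x psh_ntrD(1)[OF Pa x z]] nat[OF a x z] by simp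
    qed
  qed
  have Qe: "FOb Q \<in> extensional (Ob (PSh C))" "FAr Q \<in> extensional (Ar (PSh C))"
    using Q unfolding endo_data_def by auto
  note T = transport_functor[OF S.category_axioms S.category_axioms P Qe B H N]
  show "is_functor (PSh C) (PSh C) Q" "isomorphic (fun_cat (PSh C) (PSh C)) P Q"
    by (rule T; assumption)+
qed

text \<open>
  When \<open>Q\<close> is a quotient, the bijections are more easily given as maps out of \<open>Q\<close>.
\<close>

lemma transport_endofunctor_back:
  fixes C :: "'u::set_universe scat"
  assumes "category C" and P: "is_functor (PSh C) (PSh C) P" and Q: "endo_data C Q"
    and bij: "\<And>X x. X \<in> Ob (PSh C) \<Longrightarrow> x \<in> Ob C \<Longrightarrow> bij_betw (k X x) (FOb (FOb Q X) x) (FOb (FOb P X) x)"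
    and small: "\<And>X x. X \<in> Ob (PSh C) \<Longrightarrow> x \<in> Ob C \<Longrightarrow> small (FOb (FOb Q X) x)"
    and act: "\<And>X f x y w. X \<in> Ob (PSh C) \<Longrightarrow> f \<in> Hom C x y \<Longrightarrow> w \<in> FOb (FOb Q X) y \<Longrightarrow>
      app (FAr (FOb Q X) f) w \<in> FOb (FOb Q X) x \<and>
      k X x (app (FAr (FOb Q X) f) w) = app (FAr (FOb P X) f) (k X y w)"
    and nat: "\<And>X Y \<alpha> x w. \<alpha> \<in> Hom (PSh C) X Y \<Longrightarrow> x \<in> Ob C \<Longrightarrow> w \<in> FOb (FOb Q X) x \<Longrightarrow>
      app (At (FAr Q \<alpha>) x) w \<in> FOb (FOb Q Y) x \<and>
      k Y x (app (At (FAr Q \<alpha>) x) w) = app (At (FAr P \<alpha>) x) (k X x w)"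
  shows "isomorphic (fun_cat (PSh C) (PSh C)) P Q"
proof -
  interpret category C by fact
  define b where "b X x = inv_into (FOb (FOb Q X) x) (k X x)" for X x
  have kE: "\<exists>w\<in>FOb (FOb Q X) x. z = k X x w"
    if "X \<in> Ob (PSh C)" "x \<in> Ob C" "z \<in> FOb (FOb P X) x" for X x z
    using bij_betw_imp_surj_on[OF bij[OF that(1,2)]] that(3) by blast
  have bk: "b X x (k X x w) = w" if "X \<in> Ob (PSh C)" "x \<in> Ob C" "w \<in> FOb (FOb Q X) x" for X x w
    using bij_betw_inv_into_left[OF bij[OF that(1,2)] that(3)] by (simp add: b_def)
  have b: "bij_betw (b X x) (FOb (FOb P X) x) (FOb (FOb Q X) x)" if "X \<in> Ob (PSh C)" "x \<in> Ob C" for X x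
    unfolding b_def by (rule bij_betw_inv_into[OF bij[OF that]])
  show ?thesis
  proof (rule transport_endofunctor(2)[OF assms(1) P Q b small])
    fix X f x y z assume h: "X \<in> Ob (PSh C)" "f \<in> Hom C x y" and z: "z \<in> FOb (FOb P X) y"
    note o = Hom_Ob[OF h(2)]
    obtain w where w: "w \<in> FOb (FOb Q X) y" "z = k X y w" using kE[OF h(1) o(2) z] by blast
    show "app (FAr (FOb Q X) f) (b X y z) = b X x (app (FAr (FOb P X) f) z)"
      using act[OF h w(1)] bk[OF h(1) o(2) w(1)] bk[OF h(1) o(1)] w(2) by metis
  next
    fix X Y \<alpha> x z assume h: "\<alpha> \<in> Hom (PSh C) X Y" "x \<in> Ob C" and z: "z \<in> FOb (FOb P X) x"
    have o: "X \<in> Ob (PSh C)" "Y \<in> Ob (PSh C)"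
      using category.Hom_Ob[OF category_PSh[OF category_axioms] h(1)] by simp_all
    obtain w where w: "w \<in> FOb (FOb Q X) x" "z = k X x w" using kE[OF o(1) h(2) z] by blast
    show "app (At (FAr Q \<alpha>) x) (b X x z) = b Y x (app (At (FAr P \<alpha>) x) z)"
      using nat[OF h w(1)] bk[OF o(1) h(2) w(1)] bk[OF o(2) h(2)] w(2) by metis
  qed
qed

section \<open>Free strict monoidal and free symmetric strict monoidal categories\<close>

lemma M_simps [simp]: "Ob (M C) = lists (Ob C)" "Ar (M C) = lists (Ar C)" "Dom (M C) = map (Dom C)"
  "Cod (M C) = map (Cod C)" "Ide (M C) = map (Ide C)" "Comp (M C) = map2 (Comp C)"
  by (simp_all add: M_def)

lemma Ob_M_iff: "p \<in> lists A \<longleftrightarrow> (\<forall>i<length p. p ! i \<in> A)"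
  by (auto simp: lists_eq_set subset_iff in_set_conv_nth)

lemma M_Hom_iff:
  "v \<in> Hom (M C) q p \<longleftrightarrow> length v = length q \<and> length p = length q \<and>
    (\<forall>i<length q. v ! i \<in> Hom C (q ! i) (p ! i))"
  by (auto simp: Hom_def list_eq_iff_nth_eq Ob_M_iff)

lemma sM_simps [simp]: "Ob (sM C) = lists (Ob C)" "Ide (sM C) p = (id, map (Ide C) p)"
  "Comp (sM C) (\<tau>, w) (\<sigma>, v) = (\<tau> \<circ> \<sigma>, map2 (Comp C) (permute_list \<sigma> w) v)"
  by (simp_all add: sM_def)

text \<open>
  The codomain of \<open>(\<sigma>, v)\<close> is listed through \<open>inv \<sigma>\<close>. Described by positions, without the inverse,
  arrows compose entry by entry, and each law of \<open>sM C\<close> reduces to the same law in \<open>C\<close>.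
\<close>

lemma sM_Hom_iff:
  "(\<sigma>, v) \<in> Hom (sM C) q p \<longleftrightarrow>
     length v = length q \<and> length p = length q \<and> \<sigma> permutes {..<length q} \<and>
     (\<forall>i<length q. v ! i \<in> Hom C (q ! i) (p ! \<sigma> i))" (is "?L \<longleftrightarrow> ?R")
proof
  assume L: ?L
  then have v: "v \<in> lists (Ar C)" "\<sigma> permutes {..<length v}" "map (Dom C) v = q"
    "permute_list (inv \<sigma>) (map (Cod C) v) = p"
    by (auto simp: Hom_def sM_def)
  have "v ! i \<in> Hom C (q ! i) (p ! \<sigma> i)" if i: "i < length q" for i
  proof -
    have "\<sigma> i < length v" using permutes_in_image[OF v(2), of i] i v(3) by auto
    then have "p ! \<sigma> i = Cod C (v ! i)"
      using permute_list_nth[of "inv \<sigma>" "map (Cod C) v" "\<sigma> i"] permutes_inv[OF v(2)] v(4)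
        permutes_inverses(2)[OF v(2)] i v(3) by auto
    then show ?thesis using v(1,3) i by (auto simp: Hom_def Ob_M_iff)
  qed
  then show ?R using v by auto
next
  assume R: ?R
  note [simp] = permutes_in_image[of \<sigma> "{..<length q}", simplified]
  have inv: "inv \<sigma> permutes {..<length q}" using R permutes_inv by blast
  have "permute_list (inv \<sigma>) (map (Cod C) v) = p"
  proof (rule nth_equalityI)
    fix j assume "j < length (permute_list (inv \<sigma>) (map (Cod C) v))"
    then have j: "j < length q" using R by simp
    then have "inv \<sigma> j < length q" using permutes_in_image[OF inv] by simp
    then have "Cod C (v ! inv \<sigma> j) = p ! j"
      using R permutes_inverses(1)[of \<sigma> "{..<length q}" j] by (auto simp: Hom_def)
    then show "permute_list (inv \<sigma>) (map (Cod C) v) ! j = p ! j"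
      using j R inv permute_list_nth[of "inv \<sigma>" "map (Cod C) v" j] \<open>inv \<sigma> j < length q\<close> by simp
  qed (use R in simp)
  moreover have "map (Dom C) v = q" "v \<in> lists (Ar C)"
    using R by (auto simp: list_eq_iff_nth_eq Hom_def Ob_M_iff)
  ultimately show ?L using R by (simp add: Hom_def sM_def)
qed

lemma sM_HomD:
  assumes "(\<sigma>, v) \<in> Hom (sM C) q p"
  shows "length v = length q" "length p = length q" "\<sigma> permutes {..<length q}"
    and "\<And>i. i < length q \<Longrightarrow> \<sigma> i < length q"
    and "\<And>i. i < length q \<Longrightarrow> v ! i \<in> Hom C (q ! i) (p ! \<sigma> i)"
  using assms permutes_in_image[of \<sigma> "{..<length q}"] by (auto simp: sM_Hom_iff)

lemma Comp_sM_nth: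
  assumes "(\<sigma>, v) \<in> Hom (sM C) q p" "(\<tau>, w) \<in> Hom (sM C) p r"
  shows "i < length q \<Longrightarrow> map2 (Comp C) (permute_list \<sigma> w) v ! i = Comp C (w ! \<sigma> i) (v ! i)"
    and "length (map2 (Comp C) (permute_list \<sigma> w) v) = length q"
  using sM_HomD(1-3)[OF assms(1)] sM_HomD(1-3)[OF assms(2)] by (simp_all add: permute_list_nth)

lemma category_M: assumes "category C" shows "category (M C)"
proof -
  interpret category C by fact
  show ?thesis
  proof
    fix f x y assume f: "f \<in> Hom (M C) x y"
    show "Comp (M C) f (Ide (M C) x) = f" "Comp (M C) (Ide (M C) y) f = f"
      using f by (auto simp: M_Hom_iff list_eq_iff_nth_eq intro: Comp_Ide_left Comp_Ide_right)
  next
    fix f g h x y z w assume "f \<in> Hom (M C) x y" "g \<in> Hom (M C) y z" "h \<in> Hom (M C) z w"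
    then show "Comp (M C) h (Comp (M C) g f) = Comp (M C) (Comp (M C) h g) f"
      by (auto simp: M_Hom_iff list_eq_iff_nth_eq intro: Comp_assoc)
  next
    fix f g x y z assume "f \<in> Hom (M C) x y" "g \<in> Hom (M C) y z"
    then show "Comp (M C) g f \<in> Hom (M C) x z"
      by (auto simp: M_Hom_iff intro: Comp_Hom)
  next
    fix x assume "x \<in> Ob (M C)"
    then show "Ide (M C) x \<in> Hom (M C) x x"
      by (auto simp: M_Hom_iff Ob_M_iff intro: Ide_Hom)
  qed (auto simp: lists_eq_set Dom_Ob Cod_Ob)
qed

lemma category_sM: assumes "category C" shows "category (sM C)"
proof -
  interpret category C by fact
  have comp: "Comp (sM C) g f \<in> Hom (sM C) x z"
    if f: "f \<in> Hom (sM C) x y" and g: "g \<in> Hom (sM C) y z" for f g x y z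
  proof -
    obtain \<sigma> v \<tau> w where e: "f = (\<sigma>, v)" "g = (\<tau>, w)" by (metis surj_pair)
    note f' = f[unfolded e] and g' = g[unfolded e]
    have "Comp C (w ! \<sigma> i) (v ! i) \<in> Hom C (x ! i) (z ! \<tau> (\<sigma> i))" if "i < length x" for i
      using Comp_Hom[OF sM_HomD(5)[OF f' that] sM_HomD(5)[OF g', of "\<sigma> i"]]
        sM_HomD(2,4)[OF f'] that by simp
    then show ?thesis unfolding e sM_simps sM_Hom_iff
      using sM_HomD(1-4)[OF f'] sM_HomD(1-4)[OF g'] Comp_sM_nth[OF f' g']
      by (auto intro!: permutes_compose)
  qed
  show ?thesis
  proof
    fix f x y assume f: "f \<in> Hom (sM C) x y"
    obtain \<sigma> v where e: "f = (\<sigma>, v)" by (metis surj_pair)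
    note f' = sM_HomD[OF f[unfolded e]]
    have "map2 (Comp C) (permute_list id v) (map (Ide C) x) = v"
      using f' by (auto simp: list_eq_iff_nth_eq intro: Comp_Ide_right)
    then show "Comp (sM C) f (Ide (sM C) x) = f" by (simp add: e)
    have "map2 (Comp C) (permute_list \<sigma> (map (Ide C) y)) v = v"
      using f' by (auto simp: list_eq_iff_nth_eq permute_list_nth intro: Comp_Ide_left)
    then show "Comp (sM C) (Ide (sM C) y) f = f" by (simp add: e)
  next
    fix f g h x y z w
    assume f: "f \<in> Hom (sM C) x y" and g: "g \<in> Hom (sM C) y z" and h: "h \<in> Hom (sM C) z w"
    obtain \<sigma> v \<tau> u \<rho> t where e: "f = (\<sigma>, v)" "g = (\<tau>, u)" "h = (\<rho>, t)" by (metis surj_pair)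
    note f' = f[unfolded e] and g' = g[unfolded e] and h' = h[unfolded e]
    note gf = comp[OF f' g', unfolded sM_simps] and hg = comp[OF g' h', unfolded sM_simps]
    show "Comp (sM C) h (Comp (sM C) g f) = Comp (sM C) (Comp (sM C) h g) f"
      unfolding e sM_simps prod.inject
    proof (intro conjI o_assoc nth_equalityI)
      fix i assume "i < length (map2 (Comp C) (permute_list (\<tau> \<circ> \<sigma>) t) (map2 (Comp C) (permute_list \<sigma> u) v))"
      then have i: "i < length x" unfolding Comp_sM_nth(2)[OF gf h'] .
      show "map2 (Comp C) (permute_list (\<tau> \<circ> \<sigma>) t) (map2 (Comp C) (permute_list \<sigma> u) v) ! i
          = map2 (Comp C) (permute_list \<sigma> (map2 (Comp C) (permute_list \<tau> t) u)) v ! i"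
        using Comp_sM_nth(1)[OF gf h' i] Comp_sM_nth(1)[OF f' g' i] Comp_sM_nth(1)[OF f' hg i]
          Comp_sM_nth(1)[OF g' h', of "\<sigma> i"] sM_HomD(2,4)[OF f'] sM_HomD(2,4)[OF g'] i
          Comp_assoc[OF sM_HomD(5)[OF f' i] sM_HomD(5)[OF g', of "\<sigma> i"] sM_HomD(5)[OF h', of "\<tau> (\<sigma> i)"]]
        by simp
    qed (use Comp_sM_nth(2)[OF gf h'] Comp_sM_nth(2)[OF f' hg] in simp)
  next
    fix x assume "x \<in> Ob (sM C)"
    then show "Ide (sM C) x \<in> Hom (sM C) x x"
      by (auto simp: sM_Hom_iff Ob_M_iff permutes_id intro: Ide_Hom)
  next
    fix f assume "f \<in> Ar (sM C)"
    then obtain \<sigma> v where f: "f = (\<sigma>, v)" "v \<in> lists (Ar C)" "\<sigma> permutes {..<length v}" by (auto simp: sM_def)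
    have "inv \<sigma> permutes {..<length (map (Cod C) v)}" using permutes_inv[OF f(3)] by simp
    then show "Dom (sM C) f \<in> Ob (sM C)" "Cod (sM C) f \<in> Ob (sM C)"
      using f set_permute_list[of "inv \<sigma>" "map (Cod C) v"] Dom_Ob Cod_Ob
      by (auto simp: sM_def lists_eq_set)
  qed (rule comp)
qed

lemma incl_Hom: "v \<in> Hom (M C) q p \<Longrightarrow> incl v \<in> Hom (sM C) q p"
  by (auto simp: incl_def sM_Hom_iff M_Hom_iff permutes_id)

lemma incl_Ide: "incl (Ide (M C) p) = Ide (sM C) p"
  by (simp add: incl_def)

lemma incl_Comp: "incl (Comp (M C) w v) = Comp (sM C) (incl w) (incl v)"
  by (simp add: incl_def)

definition sM_map :: "'u sftr \<Rightarrow> 'u smarr \<Rightarrow> 'u smarr" where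
  "sM_map u = (\<lambda>(\<sigma>, v). (\<sigma>, map (FAr u) v))"

lemma sM_map_Hom:
  assumes "is_functor C D u" "m \<in> Hom (sM C) q p"
  shows "sM_map u m \<in> Hom (sM D) (map (FOb u) q) (map (FOb u) p)"
proof -
  obtain \<sigma> v where e: "m = (\<sigma>, v)" by (metis surj_pair)
  show ?thesis unfolding e sM_map_def prod.case sM_Hom_iff
    using sM_HomD[OF assms(2)[unfolded e]] is_functorD(4)[OF assms(1)] by auto
qed

lemma sM_map_Comp:
  assumes "is_functor C D u" "m \<in> Hom (sM C) q p" "n \<in> Hom (sM C) p r"
  shows "sM_map u (Comp (sM C) n m) = Comp (sM D) (sM_map u n) (sM_map u m)"
proof -
  obtain \<sigma> v \<tau> w where e: "m = (\<sigma>, v)" "n = (\<tau>, w)" by (metis surj_pair)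
  note m = assms(2)[unfolded e] and n = assms(3)[unfolded e]
  have "FAr u (Comp C (w ! \<sigma> i) (v ! i)) = Comp D (FAr u (w ! \<sigma> i)) (FAr u (v ! i))" if "i < length q" for i
    using sM_HomD(2,4,5)[OF m] sM_HomD(5)[OF n] that by (intro is_functorD(6)[OF assms(1)]) auto
  then show ?thesis using sM_HomD[OF m] sM_HomD[OF n] Comp_sM_nth[OF m n]
    by (auto simp: e sM_map_def list_eq_iff_nth_eq permute_list_nth)
qed

lemma sM_map_Ide: "is_functor C D u \<Longrightarrow> p \<in> lists (Ob C) \<Longrightarrow>
    sM_map u (Ide (sM C) p) = Ide (sM D) (map (FOb u) p)"
  by (auto simp: sM_map_def is_functorD(5))

subsection \<open>Powers of a presheaf\<close>

lemma pow_iff: "xs \<in> pow X p \<longleftrightarrow> length xs = length p \<and> (\<forall>i<length p. xs ! i \<in> FOb X (p ! i))"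
  by (auto simp: pow_def list_all2_conv_all_nth)

lemma pow_act_nth:
  assumes "(\<sigma>, v) \<in> Hom (sM C) q p" "length xs = length p"
  shows "i < length q \<Longrightarrow> pow_act X (\<sigma>, v) xs ! i = app (FAr X (v ! i)) (xs ! \<sigma> i)"
    and "length (pow_act X (\<sigma>, v) xs) = length q"
  using sM_HomD[OF assms(1)] assms(2) by (simp_all add: pow_act_def permute_list_nth)

lemma pow_act_pow:
  assumes X: "X \<in> Ob (PSh C)" and m: "m \<in> Hom (sM C) q p" and xs: "xs \<in> pow X p"
  shows "pow_act X m xs \<in> pow X q"
proof -
  obtain \<sigma> v where e: "m = (\<sigma>, v)" by (metis surj_pair)
  note h = sM_HomD[OF m[unfolded e]]
  have X': "is_functor (op_cat C) Set_cat X" using X by simp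
  show ?thesis unfolding e pow_iff
    using pow_act_nth[OF m[unfolded e], of xs] h xs pshD(2)[OF X' h(5)] by (auto simp: pow_iff)
qed

lemma pow_act_Comp:
  assumes X: "X \<in> Ob (PSh C)" and m: "m \<in> Hom (sM C) q p" and n: "n \<in> Hom (sM C) p r" and xs: "xs \<in> pow X r"
    and C: "category C"
  shows "pow_act X (Comp (sM C) n m) xs = pow_act X m (pow_act X n xs)"
proof -
  obtain \<sigma> v \<tau> w where e: "m = (\<sigma>, v)" "n = (\<tau>, w)" by (metis surj_pair)
  note m' = m[unfolded e] and n' = n[unfolded e]
  note nm = category.Comp_Hom[OF category_sM[OF C] m' n', unfolded sM_simps]
  have l: "length xs = length r" using xs by (simp add: pow_iff)
  have l': "length (pow_act X (\<tau>, w) xs) = length p" using pow_act_nth(2)[OF n' l] .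
  show ?thesis unfolding e sM_simps
  proof (rule nth_equalityI)
    show "length (pow_act X (\<tau> \<circ> \<sigma>, map2 (Comp C) (permute_list \<sigma> w) v) xs)
      = length (pow_act X (\<sigma>, v) (pow_act X (\<tau>, w) xs))"
      using pow_act_nth(2)[OF nm l] pow_act_nth(2)[OF m' l'] by simp
    fix i assume "i < length (pow_act X (\<tau> \<circ> \<sigma>, map2 (Comp C) (permute_list \<sigma> w) v) xs)"
    then have i: "i < length q" using pow_act_nth(2)[OF nm l] by simp
    have si: "\<sigma> i < length p" using sM_HomD(2,4)[OF m'] i by simp
    have ti: "xs ! \<tau> (\<sigma> i) \<in> FOb X (r ! \<tau> (\<sigma> i))"
      using xs sM_HomD(2,4)[OF n'] si by (simp add: pow_iff)
    have X': "is_functor (op_cat C) Set_cat X" using X by simp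
    show "pow_act X (\<tau> \<circ> \<sigma>, map2 (Comp C) (permute_list \<sigma> w) v) xs ! i
        = pow_act X (\<sigma>, v) (pow_act X (\<tau>, w) xs) ! i"
      using pow_act_nth(1)[OF nm l i] pow_act_nth(1)[OF m' l' i] pow_act_nth(1)[OF n' l si]
        Comp_sM_nth(1)[OF m' n' i] pshD(4)[OF X' sM_HomD(5)[OF n' si] sM_HomD(5)[OF m' i] ti] by simp
  qed
qed

lemma pow_map_pow:
  assumes "\<alpha> \<in> Hom (PSh C) X Y" "p \<in> lists (Ob C)" "xs \<in> pow X p"
  shows "pow_map \<alpha> p xs \<in> pow Y p"
  using assms(2,3) psh_ntrD(1)[OF assms(1)] by (auto simp: pow_map_def pow_iff Ob_M_iff)

lemma pow_map_act:
  assumes a: "\<alpha> \<in> Hom (PSh C) X Y" and m: "m \<in> Hom (sM C) q p" and xs: "xs \<in> pow X p"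
    and C: "category C"
  shows "pow_map \<alpha> q (pow_act X m xs) = pow_act Y m (pow_map \<alpha> p xs)"
proof -
  obtain \<sigma> v where e: "m = (\<sigma>, v)" by (metis surj_pair)
  note m' = m[unfolded e] and h = sM_HomD[OF m[unfolded e]]
  have l: "length xs = length p" "length (pow_map \<alpha> p xs) = length p" using xs
    by (simp_all add: pow_iff pow_map_def)
  have pm: "pow_map \<alpha> p xs ! j = app (At \<alpha> (p ! j)) (xs ! j)" if "j < length q" for j
    using that l h by (simp add: pow_map_def)
  show ?thesis unfolding e
  proof (rule nth_equalityI)
    show "length (pow_map \<alpha> q (pow_act X (\<sigma>, v) xs)) = length (pow_act Y (\<sigma>, v) (pow_map \<alpha> p xs))"
      using pow_act_nth(2)[OF m' l(1)] pow_act_nth(2)[OF m' l(2)] by (simp add: pow_map_def)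
    fix i assume "i < length (pow_map \<alpha> q (pow_act X (\<sigma>, v) xs))"
    then have i: "i < length q" using pow_act_nth(2)[OF m' l(1)] by (simp add: pow_map_def)
    have "p ! \<sigma> i \<in> Ob C" using category.Hom_Ob(2)[OF C h(5)[OF i]] .
    moreover have "xs ! \<sigma> i \<in> FOb X (p ! \<sigma> i)" using xs h(2,4) i by (simp add: pow_iff)
    moreover have "pow_map \<alpha> q (pow_act X (\<sigma>, v) xs) ! i = app (At \<alpha> (q ! i)) (pow_act X (\<sigma>, v) xs ! i)"
      using i pow_act_nth(2)[OF m' l(1)] by (simp add: pow_map_def)
    ultimately show "pow_map \<alpha> q (pow_act X (\<sigma>, v) xs) ! i = pow_act Y (\<sigma>, v) (pow_map \<alpha> p xs) ! i"
      using pow_act_nth(1)[OF m' l(1) i] pow_act_nth(1)[OF m' l(2) i] pm[OF h(4)[OF i]]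
        psh_ntrD(2)[OF a h(5)[OF i]] by simp
  qed
qed

subsection \<open>Smallness\<close>

locale small_category = category C for C :: "'u::set_universe scat" +
  assumes small_Ob: "small (Ob C)" and small_Ar: "small (Ar C)"

lemma small_cats_iff: "C \<in> small_cats \<longleftrightarrow> small_category C"
  by (simp add: small_cats_def small_category_def small_category_axioms_def)

lemma (in small_category) ess_small_words: "ess_small TYPE('u) (lists (Ob C))"
  by (rule ess_small_lists[OF small_ess_small[OF small_Ob]])

lemma (in small_category) ess_small_pow:
  assumes "X \<in> Ob (PSh C)" shows "ess_small TYPE('u) (\<Union>p\<in>lists (Ob C). pow X p)"
proof -
  have X: "is_functor (op_cat C) Set_cat X" using assms by simp
  have "small (\<Union>x\<in>Ob C. FOb X x)"
    by (rule small_UN[OF small_Ob]) (use pshD(1)[OF X] in simp)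
  from ess_small_lists[OF small_ess_small[OF this]] show ?thesis
  proof (rule ess_small_subset, intro subsetI, elim UN_E)
    fix p xs assume "p \<in> lists (Ob C)" "xs \<in> pow X p"
    then have "\<forall>i<length xs. \<exists>x\<in>Ob C. xs ! i \<in> FOb X x" by (auto simp: pow_iff Ob_M_iff)
    then show "xs \<in> lists (\<Union>x\<in>Ob C. FOb X x)" by (simp add: Ob_M_iff)
  qed
qed

text \<open>A permutation of the positions of \<open>v\<close> is determined by the list of its values there.\<close>

lemma (in small_category) ess_small_sM: "ess_small TYPE('u) (Ar (sM C))"
proof -
  let ?e = "\<lambda>(ns, v). ((\<lambda>i. if i < length v then ns ! i else i), v) :: 'u smarr"
  have "ess_small TYPE('u) (lists (UNIV :: nat set) \<times> lists (Ar C))"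
    by (intro ess_small_Times ess_small_lists ess_small_nat small_ess_small small_Ar)
  from ess_small_image[OF this, of ?e] show ?thesis
  proof (rule ess_small_subset, safe)
    fix \<sigma> v assume "(\<sigma>, v) \<in> Ar (sM C)"
    then have s: "v \<in> lists (Ar C)" "\<sigma> permutes {..<length v}" by (auto simp: sM_def)
    have "\<sigma> = (\<lambda>i. if i < length v then map \<sigma> [0..<length v] ! i else i)"
      using permutes_not_in[OF s(2)] by (auto simp: fun_eq_iff)
    then have "(\<sigma>, v) = ?e (map \<sigma> [0..<length v], v)" by simp
    then show "(\<sigma>, v) \<in> ?e ` (lists UNIV \<times> lists (Ar C))" using s(1) by blast
  qed
qed

section \<open>Graphs and their symmetrization\<close>

lemma gcat_simps [simp]: "Ob (gcat C) = Ob C \<times> lists (Ob C)" "Ar (gcat C) = Ar C \<times> lists (Ar C)"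
  "Ide (gcat C) (x, p) = (Ide C x, Ide (M C) p)"
  "Comp (gcat C) (g, w) (f, v) = (Comp C f g, Comp (M C) w v)"
  by (simp_all add: gcat_def prod_cat_def)

lemma gcat_Hom_iff: "(f, v) \<in> Hom (gcat C) (y, q) (x, p) \<longleftrightarrow> f \<in> Hom C x y \<and> v \<in> Hom (M C) q p"
  by (auto simp: gcat_def prod_cat_def Hom_def)

lemma category_prod_cat: assumes "category C" "category D" shows "category (prod_cat C D)"
proof -
  interpret C: category C by fact
  interpret D: category D by fact
  have H: "h \<in> Hom (prod_cat C D) x y \<longleftrightarrow> fst h \<in> Hom C (fst x) (fst y) \<and> snd h \<in> Hom D (snd x) (snd y)"
    for h x y
    by (cases h; cases x; cases y) (auto simp: prod_cat_def Hom_def)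
  have S: "Ob (prod_cat C D) = Ob C \<times> Ob D" "Ar (prod_cat C D) = Ar C \<times> Ar D"
    "Dom (prod_cat C D) h = (Dom C (fst h), Dom D (snd h))"
    "Cod (prod_cat C D) h = (Cod C (fst h), Cod D (snd h))"
    "Ide (prod_cat C D) x = (Ide C (fst x), Ide D (snd x))"
    "Comp (prod_cat C D) h k = (Comp C (fst h) (fst k), Comp D (snd h) (snd k))" for h k x
    by (cases h; cases k; cases x; simp add: prod_cat_def)+
  show ?thesis
    by standard (auto simp: H S C.Comp_assoc D.Comp_assoc C.Comp_Ide_left C.Comp_Ide_right
        D.Comp_Ide_left D.Comp_Ide_right
        intro: C.Dom_Ob C.Cod_Ob D.Dom_Ob D.Cod_Ob C.Ide_Hom D.Ide_Hom C.Comp_Hom D.Comp_Hom)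
qed

lemma category_gcat: "category C \<Longrightarrow> category (gcat C)"
  unfolding gcat_def by (intro category_prod_cat category_op_cat category_M)

text \<open>
  The left and right actions on a graph: the functor on \<open>C\<^sup>o\<^sup>p \<times> M C\<close> with one argument held at an
  identity.
\<close>

definition lact :: "'u scat \<Rightarrow> 'u gph \<Rightarrow> 'u \<Rightarrow> 'u list \<Rightarrow> 'u \<Rightarrow> 'u" where
  "lact C A f p a = app (FAr A (f, Ide (M C) p)) a"

definition ract :: "'u scat \<Rightarrow> 'u gph \<Rightarrow> 'u \<Rightarrow> 'u list \<Rightarrow> 'u \<Rightarrow> 'u" where
  "ract C A x v a = app (FAr A (Ide C x, v)) a"

locale graph = small_category C for C :: "'u::set_universe scat" +
  fixes A :: "'u gph"
  assumes A_functor: "is_functor (gcat C) Set_cat A"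
begin

sublocale M: category "M C" by (rule category_M) unfold_locales
sublocale sM: category "sM C" by (rule category_sM) unfold_locales

abbreviation "words \<equiv> lists (Ob C)"

lemma gph_small: "x \<in> Ob C \<Longrightarrow> p \<in> words \<Longrightarrow> small (FOb A (x, p))"
  using set_functorD(1)[OF A_functor, of "(x, p)"] by simp

lemma gph_in: "f \<in> Hom C x y \<Longrightarrow> v \<in> Hom (M C) q p \<Longrightarrow> a \<in> FOb A (y, q) \<Longrightarrow> app (FAr A (f, v)) a \<in> FOb A (x, p)"
  using set_functorD(2)[OF A_functor, of "(f, v)" "(y, q)" "(x, p)"] by (simp add: gcat_Hom_iff)

lemma gph_Comp:
  assumes "f \<in> Hom C x y" "g \<in> Hom C y z" "v \<in> Hom (M C) q p" "w \<in> Hom (M C) p r" "a \<in> FOb A (z, q)"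
  shows "app (FAr A (Comp C g f, Comp (M C) w v)) a = app (FAr A (f, w)) (app (FAr A (g, v)) a)"
  using set_functorD(4)[OF A_functor, of "(g, v)" "(z, q)" "(y, p)" "(f, w)" "(x, r)" a] assms
  by (simp add: gcat_Hom_iff)

lemma word_Ide: "p \<in> words \<Longrightarrow> Ide (M C) p \<in> Hom (M C) p p"
  using M.Ide_Hom[of p] by simp

lemma lact_in: "f \<in> Hom C x y \<Longrightarrow> p \<in> words \<Longrightarrow> a \<in> FOb A (y, p) \<Longrightarrow> lact C A f p a \<in> FOb A (x, p)"
  unfolding lact_def by (rule gph_in[OF _ word_Ide])

lemma ract_in: "x \<in> Ob C \<Longrightarrow> v \<in> Hom (M C) q p \<Longrightarrow> a \<in> FOb A (x, q) \<Longrightarrow> ract C A x v a \<in> FOb A (x, p)"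
  unfolding ract_def by (rule gph_in[OF Ide_Hom])

lemma gph_Ide: "x \<in> Ob C \<Longrightarrow> p \<in> words \<Longrightarrow> a \<in> FOb A (x, p) \<Longrightarrow> app (FAr A (Ide C x, Ide (M C) p)) a = a"
  using set_functorD(3)[OF A_functor, of "(x, p)" a] by simp

lemma lact_Ide: "x \<in> Ob C \<Longrightarrow> p \<in> words \<Longrightarrow> a \<in> FOb A (x, p) \<Longrightarrow> lact C A (Ide C x) p a = a"
  unfolding lact_def by (rule gph_Ide)

lemma lact_Comp:
  assumes "f \<in> Hom C x y" "g \<in> Hom C y z" "p \<in> words" "a \<in> FOb A (z, p)"
  shows "lact C A (Comp C g f) p a = lact C A f p (lact C A g p a)"
  using gph_Comp[OF assms(1,2) word_Ide word_Ide assms(4)] assms(3) M.Comp_Ide_left[OF word_Ide]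
  unfolding lact_def by metis

text \<open>
  The two actions commute because either order of acting is the joint action of the pair.
\<close>

lemma ract_lact:
  assumes "f \<in> Hom C x y" "v \<in> Hom (M C) q p" "a \<in> FOb A (y, q)"
  shows "ract C A x v (lact C A f q a) = app (FAr A (f, v)) a"
    and "lact C A f p (ract C A y v a) = app (FAr A (f, v)) a"
proof -
  have o: "x \<in> Ob C" "y \<in> Ob C" "p \<in> words" "q \<in> words"
    using Hom_Ob[OF assms(1)] M.Hom_Ob[OF assms(2)] by simp_all
  show "ract C A x v (lact C A f q a) = app (FAr A (f, v)) a"
    using gph_Comp[OF Ide_Hom[OF o(1)] assms(1) word_Ide[OF o(4)] assms(2,3)]
      Comp_Ide_right[OF assms(1)] M.Comp_Ide_right[OF assms(2)] unfolding lact_def ract_def by metis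
  show "lact C A f p (ract C A y v a) = app (FAr A (f, v)) a"
    using gph_Comp[OF assms(1) Ide_Hom[OF o(2)] assms(2) word_Ide[OF o(3)] assms(3)]
      Comp_Ide_left[OF assms(1)] M.Comp_Ide_left[OF assms(2)] unfolding lact_def ract_def by metis
qed

text \<open>
  This bounds the middle component of the generators of both coends at \<open>x\<close>.
\<close>

lemma small_gph_union: "x \<in> Ob C \<Longrightarrow> small (\<Union>p\<in>words. FOb A (x, p))"
  by (rule small_UN_ess[OF ess_small_words]) (rule gph_small)

subsection \<open>The classes that make up the symmetrization\<close>

lemma Gen_symP: "Gen (symP C A x p) = {(q, a, m). q \<in> words \<and> a \<in> FOb A (x, q) \<and> m \<in> Hom (sM C) q p}"
  by (auto simp: symP_def coend_def)

lemma Rel_symP: "Rel (symP C A x p) =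
  {((q, a, Comp (sM C) m (incl v)), (q', ract C A x v a, m)) | v q q' a m.
     v \<in> Hom (M C) q q' \<and> a \<in> FOb A (x, q) \<and> m \<in> Hom (sM C) q' p}"
  unfolding symP_def coend_def ract_def by (fastforce simp: Hom_def simp del: sM_simps)

lemma small_symP: "x \<in> Ob C \<Longrightarrow> small_pres TYPE('u) (symP C A x p)"
proof -
  assume "x \<in> Ob C"
  then have "ess_small TYPE('u) (words \<times> (\<Union>p\<in>words. FOb A (x, p)) \<times> Ar (sM C))"
    by (intro ess_small_Times ess_small_words ess_small_sM small_ess_small small_gph_union)
  then show ?thesis by (rule ess_small_subset) (auto simp: Gen_symP dest: HomD)
qed

lemma sym_GenI: "a \<in> FOb A (x, q) \<Longrightarrow> m \<in> Hom (sM C) q p \<Longrightarrow> (q, a, m) \<in> Gen (symP C A x p)"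
  using sM.Hom_Ob[of m q p] by (simp add: Gen_symP)

lemma sym_rel:
  assumes "x \<in> Ob C" "v \<in> Hom (M C) q q'" "a \<in> FOb A (x, q)" "m \<in> Hom (sM C) q' p"
  shows "(cls (symP C A x p) (q, a, Comp (sM C) m (incl v)) :: 'u)
    = cls (symP C A x p) (q', ract C A x v a, m)"
proof (rule cls_rel[OF small_symP[OF assms(1)]])
  show "((q, a, Comp (sM C) m (incl v)), q', ract C A x v a, m) \<in> Rel (symP C A x p)"
    unfolding Rel_symP using assms by blast
  show "(q, a, Comp (sM C) m (incl v)) \<in> Gen (symP C A x p)"
    by (rule sym_GenI[OF assms(3) sM.Comp_Hom[OF incl_Hom[OF assms(2)] assms(4)]])
  show "(q', ract C A x v a, m) \<in> Gen (symP C A x p)"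
    by (rule sym_GenI[OF ract_in[OF assms(1-3)] assms(4)])
qed

lemma sym_lift:
  assumes "x \<in> Ob C"
    and "\<And>v q q' a m. v \<in> Hom (M C) q q' \<Longrightarrow> a \<in> FOb A (x, q) \<Longrightarrow> m \<in> Hom (sM C) q' p \<Longrightarrow>
        k (q, a, Comp (sM C) m (incl v)) = k (q', ract C A x v a, m)"
    and "(cls (symP C A x p) t :: 'u) = cls (symP C A x p) t'" "t \<in> Gen (symP C A x p)"
      "t' \<in> Gen (symP C A x p)"
  shows "k t = k t'"
proof (rule cls_lift[OF small_symP[OF assms(1)] _ assms(3-5)])
  fix b c assume "(b, c) \<in> Rel (symP C A x p)"
  then show "k b = k c" unfolding Rel_symP using assms(2) by blast
qed

lemma app_qmap_sym:
  assumes "x \<in> Ob C"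
    and "\<And>v q q' a m. v \<in> Hom (M C) q q' \<Longrightarrow> a \<in> FOb A (x, q) \<Longrightarrow> m \<in> Hom (sM C) q' p \<Longrightarrow>
        (cls Q (h (q, a, Comp (sM C) m (incl v))) :: 'u) = cls Q (h (q', ract C A x v a, m))"
    and "a \<in> FOb A (x, q)" "m \<in> Hom (sM C) q p"
  shows "app (qmap (symP C A x p) Q h) (cls (symP C A x p) (q, a, m) :: 'u) = cls Q (h (q, a, m))"
proof (rule app_qmap[OF small_symP[OF assms(1)] _ sym_GenI[OF assms(3,4)]])
  fix b c assume "(b, c) \<in> Rel (symP C A x p)"
  then show "(cls Q (h b) :: 'u) = cls Q (h c)" unfolding Rel_symP using assms(2) by blast
qed

lemma symE:
  assumes "s \<in> quot (symP C A x p)"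
  obtains q a m where "a \<in> FOb A (x, q)" "m \<in> Hom (sM C) q p" "s = cls (symP C A x p) (q, a, m)"
  using assms by (elim quotE) (auto simp: Gen_symP)

lemma rep_symE:
  assumes "s \<in> quot (symP C A x p)"
  obtains q a m where "a \<in> FOb A (x, q)" "m \<in> Hom (sM C) q p"
    "s = cls (symP C A x p) (q, a, m)" "rep (symP C A x p) s = (q, a, m)"
  using rep_quot[OF assms] by (cases "rep (symP C A x p) s") (auto simp: Gen_symP)

lemma Sym_FOb [simp]: "x \<in> Ob C \<Longrightarrow> p \<in> words \<Longrightarrow> FOb (Sym C A) (x, p) = quot (symP C A x p)"
  by (simp add: Sym_def)

lemma Sym_FAr_Hom:
  assumes "f \<in> Hom C x y" "v \<in> Hom (M C) p p'"
  shows "FAr (Sym C A) (f, v) = qmap (symP C A y p) (symP C A x p')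
    (\<lambda>(q, a, m). (q, lact C A f q a, Comp (sM C) (incl v) m))"
  using assms by (auto simp: Sym_def Hom_def lact_def)

text \<open>
  The left action is well defined on classes because it commutes with the right action, the right one
  because it composes on the other side of \<open>m\<close> than the relations do.
\<close>

lemma app_Sym:
  assumes f: "f \<in> Hom C x y" and v: "v \<in> Hom (M C) p p'" and a: "a \<in> FOb A (y, q)" and m: "m \<in> Hom (sM C) q p"
  shows "app (FAr (Sym C A) (f, v)) (cls (symP C A y p) (q, a, m)) =
    cls (symP C A x p') (q, lact C A f q a, Comp (sM C) (incl v) m)"
  unfolding Sym_FAr_Hom[OF f v]
proof (rule trans[OF app_qmap_sym[OF Hom_Ob(2)[OF f] _ a m]])
  fix w r r' b n assume h: "w \<in> Hom (M C) r r'" "b \<in> FOb A (y, r)" "n \<in> Hom (sM C) r' p"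
  have r: "r \<in> words" using M.Hom_Ob(1)[OF h(1)] by simp
  have r': "r' \<in> words" using M.Hom_Ob(2)[OF h(1)] by simp
  have "(cls (symP C A x p') (r, lact C A f r b, Comp (sM C) (incl v) (Comp (sM C) n (incl w))) :: 'u)
    = cls (symP C A x p') (r', ract C A x w (lact C A f r b), Comp (sM C) (incl v) n)"
    using sym_rel[OF Hom_Ob(1)[OF f] h(1) lact_in[OF f r h(2)] sM.Comp_Hom[OF h(3) incl_Hom[OF v]]]
      sM.Comp_assoc[OF incl_Hom[OF h(1)] h(3) incl_Hom[OF v]] by simp
  then show "(cls (symP C A x p') (case (r, b, Comp (sM C) n (incl w)) of (q, a, m) \<Rightarrow>
      (q, lact C A f q a, Comp (sM C) (incl v) m)) :: 'u)
    = cls (symP C A x p') (case (r', ract C A y w b, n) of (q, a, m) \<Rightarrow> (q, lact C A f q a, Comp (sM C)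
      (incl v) m))"
    unfolding prod.case using ract_lact[OF f h(1,2)] by simp
qed simp

lemma Sym_functor: "is_functor (gcat C) Set_cat (Sym C A)"
proof (rule set_functorI[OF _ _ _ _ _ _ category_gcat])
  show "FOb (Sym C A) \<in> extensional (Ob (gcat C))" "FAr (Sym C A) \<in> extensional (Ar (gcat C))"
    by (simp_all add: Sym_def)
  show "small (FOb (Sym C A) z)" if "z \<in> Ob (gcat C)" for z
    using that small_quot[OF small_symP] Sym_FOb[of "fst z" "snd z"] by (cases z) simp
  show "FAr (Sym C A) k \<in> Hom Set_cat (FOb (Sym C A) z) (FOb (Sym C A) z')"
    if k: "k \<in> Hom (gcat C) z z'" for k z z'
  proof -
    obtain f v y p x p' where e: "k = (f, v)" "z = (y, p)" "z' = (x, p')" by (metis surj_pair)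
    then have h: "f \<in> Hom C x y" "v \<in> Hom (M C) p p'" using k by (simp_all add: gcat_Hom_iff)
    have o: "x \<in> Ob C" "y \<in> Ob C" "p \<in> words" "p' \<in> words"
      using Hom_Ob[OF h(1)] M.Hom_Ob[OF h(2)] by simp_all
    have "app (FAr (Sym C A) (f, v)) s \<in> quot (symP C A x p')" if s: "s \<in> quot (symP C A y p)" for s
    proof -
      obtain q a m where s: "a \<in> FOb A (y, q)" "m \<in> Hom (sM C) q p" "s = cls (symP C A y p) (q, a, m)"
        using symE[OF s] .
      have q: "q \<in> words" using sM.Hom_Ob(1)[OF s(2)] by simp
      show ?thesis unfolding s(3) app_Sym[OF h s(1,2)]
        by (intro cls_in_quot sym_GenI lact_in[OF h(1) q s(1)] sM.Comp_Hom[OF s(2) incl_Hom[OF h(2)]])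
    qed
    then show ?thesis using o small_quot[OF small_symP]
      by (simp add: e Set_Hom_iff) (simp add: Sym_FAr_Hom[OF h] app_qmap_ext)
  qed
  show "app (FAr (Sym C A) (Ide (gcat C) z)) s = s" if z: "z \<in> Ob (gcat C)" and s: "s \<in> FOb (Sym C A) z"
    for z s
  proof -
    obtain x p where e: "z = (x, p)" and o: "x \<in> Ob C" "p \<in> words" using z by auto
    obtain q a m where s: "a \<in> FOb A (x, q)" "m \<in> Hom (sM C) q p" "s = cls (symP C A x p) (q, a, m)"
      using symE[OF s[unfolded e Sym_FOb[OF o]]] .
    have q: "q \<in> words" using sM.Hom_Ob(1)[OF s(2)] by simp
    show ?thesis
      unfolding e gcat_simps(3) s(3) app_Sym[OF Ide_Hom[OF o(1)] word_Ide[OF o(2)] s(1,2)]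
        incl_Ide lact_Ide[OF o(1) q s(1)] sM.Comp_Ide_left[OF s(2)] ..
  qed
  show "app (FAr (Sym C A) (Comp (gcat C) l k)) s = app (FAr (Sym C A) l) (app (FAr (Sym C A) k) s)"
    if k: "k \<in> Hom (gcat C) z z'" and l: "l \<in> Hom (gcat C) z' z''" and s: "s \<in> FOb (Sym C A) z"
      for k l z z' z'' s
  proof -
    obtain f v y p x p' where e: "k = (f, v)" "z = (y, p)" "z' = (x, p')" by (metis surj_pair)
    obtain g w x' p'' where e': "l = (g, w)" "z'' = (x', p'')" by (metis surj_pair)
    have h: "f \<in> Hom C x y" "v \<in> Hom (M C) p p'" "g \<in> Hom C x' x" "w \<in> Hom (M C) p' p''"
      using k l e e' by (simp_all add: gcat_Hom_iff)
    have o: "y \<in> Ob C" "p \<in> words" using Hom_Ob[OF h(1)] M.Hom_Ob[OF h(2)] by simp_all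
    obtain q a m where s: "a \<in> FOb A (y, q)" "m \<in> Hom (sM C) q p" "s = cls (symP C A y p) (q, a, m)"
      using symE[OF s[unfolded e Sym_FOb[OF o]]] .
    have q: "q \<in> words" using sM.Hom_Ob(1)[OF s(2)] by simp
    show ?thesis
      unfolding e e' gcat_simps(4) s(3) app_Sym[OF Comp_Hom[OF h(3,1)] M.Comp_Hom[OF h(2,4)] s(1,2)]
        app_Sym[OF h(1,2) s(1,2)]
        app_Sym[OF h(3,4) lact_in[OF h(1) q s(1)] sM.Comp_Hom[OF s(2) incl_Hom[OF h(2)]]]
        incl_Comp lact_Comp[OF h(3,1) q s(1)] sM.Comp_assoc[OF s(2) incl_Hom[OF h(2)] incl_Hom[OF h(4)]] ..
  qed
qed unfold_locales

lemma graph_Sym: "graph C (Sym C A)"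
  by unfold_locales (rule Sym_functor)

lemma ract_Sym:
  assumes "x \<in> Ob C" "v \<in> Hom (M C) p p'" "a \<in> FOb A (x, q)" "m \<in> Hom (sM C) q p"
  shows "ract C (Sym C A) x v (cls (symP C A x p) (q, a, m))
    = cls (symP C A x p') (q, a, Comp (sM C) (incl v) m)"
proof -
  have "q \<in> words" using sM.Hom_Ob(1)[OF assms(4)] by simp
  then show ?thesis unfolding ract_def app_Sym[OF Ide_Hom[OF assms(1)] assms(2-4)]
    using lact_Ide assms(1,3) by simp
qed

subsection \<open>The classes that make up the product with a presheaf\<close>

context fixes X :: "'u psh" assumes X: "X \<in> Ob (PSh C)"
begin

lemma Gen_starP: "Gen (starP C A X x) = {(p, a, xs). p \<in> words \<and> a \<in> FOb A (x, p) \<and> xs \<in> pow X p}"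
  by (auto simp: starP_def coend_def)

lemma Rel_starP: "Rel (starP C A X x) =
  {((q, a, pow_act X (incl v) xs), (p, ract C A x v a, xs)) | v q p a xs.
     v \<in> Hom (M C) q p \<and> a \<in> FOb A (x, q) \<and> xs \<in> pow X p}"
  unfolding starP_def coend_def ract_def by (fastforce simp: Hom_def)

lemma small_starP: "x \<in> Ob C \<Longrightarrow> small_pres TYPE('u) (starP C A X x)"
proof -
  assume "x \<in> Ob C"
  then have "ess_small TYPE('u) (words \<times> (\<Union>p\<in>words. FOb A (x, p)) \<times> (\<Union>p\<in>words. pow X p))"
    by (intro ess_small_Times ess_small_words ess_small_pow small_ess_small small_gph_union X)
  then show ?thesis by (rule ess_small_subset) (auto simp: Gen_starP)
qed

lemma star_GenI: "p \<in> words \<Longrightarrow> a \<in> FOb A (x, p) \<Longrightarrow> xs \<in> pow X p \<Longrightarrow> (p, a, xs) \<in> Gen (starP C A X x)"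
  by (simp add: Gen_starP)

lemma star_rel:
  assumes "x \<in> Ob C" "v \<in> Hom (M C) q p" "a \<in> FOb A (x, q)" "xs \<in> pow X p"
  shows "(cls (starP C A X x) (q, a, pow_act X (incl v) xs) :: 'u)
    = cls (starP C A X x) (p, ract C A x v a, xs)"
proof (rule cls_rel[OF small_starP[OF assms(1)]])
  show "((q, a, pow_act X (incl v) xs), p, ract C A x v a, xs) \<in> Rel (starP C A X x)"
    unfolding Rel_starP using assms by blast
  have "p \<in> words" "q \<in> words" using M.Hom_Ob[OF assms(2)] by simp_all
  then show "(q, a, pow_act X (incl v) xs) \<in> Gen (starP C A X x)"
    "(p, ract C A x v a, xs) \<in> Gen (starP C A X x)"
    by (auto intro!: star_GenI pow_act_pow[OF X incl_Hom] ract_in assms)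
qed

lemma app_qmap_star:
  assumes "x \<in> Ob C"
    and "\<And>v q p a xs. v \<in> Hom (M C) q p \<Longrightarrow> a \<in> FOb A (x, q) \<Longrightarrow> xs \<in> pow X p \<Longrightarrow>
        (cls Q (h (q, a, pow_act X (incl v) xs)) :: 'u) = cls Q (h (p, ract C A x v a, xs))"
    and "p \<in> words" "a \<in> FOb A (x, p)" "xs \<in> pow X p"
  shows "app (qmap (starP C A X x) Q h) (cls (starP C A X x) (p, a, xs) :: 'u) = cls Q (h (p, a, xs))"
proof (rule app_qmap[OF small_starP[OF assms(1)] _ star_GenI[OF assms(3-5)]])
  fix b c assume "(b, c) \<in> Rel (starP C A X x)"
  then show "(cls Q (h b) :: 'u) = cls Q (h c)" unfolding Rel_starP using assms(2) by blast
qed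

lemma app_star:
  assumes f: "f \<in> Hom C x y" and g: "p \<in> words" "a \<in> FOb A (y, p)" "xs \<in> pow X p"
  shows "app (FAr (star C A X) f) (cls (starP C A X y) (p, a, xs))
    = cls (starP C A X x) (p, lact C A f p a, xs)"
proof -
  have "FAr (star C A X) f = qmap (starP C A X y) (starP C A X x) (\<lambda>(p, a, xs). (p, lact C A f p a, xs))"
    using HomD[OF f] by (simp add: star_def lact_def)
  also have "app \<dots> (cls (starP C A X y) (p, a, xs)) = cls (starP C A X x) (p, lact C A f p a, xs)"
  proof (rule trans[OF app_qmap_star[OF Hom_Ob(2)[OF f] _ g]])
    fix v q p a xs assume h: "v \<in> Hom (M C) q p" "a \<in> FOb A (y, q)" "xs \<in> pow X p"
    have q: "q \<in> words" using M.Hom_Ob(1)[OF h(1)] by simp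
    show "(cls (starP C A X x) (case (q, a, pow_act X (incl v) xs) of (p, a, xs) \<Rightarrow>
      (p, lact C A f p a, xs)) :: 'u) =
        cls (starP C A X x) (case (p, ract C A y v a, xs) of (p, a, xs) \<Rightarrow> (p, lact C A f p a, xs))"
      using star_rel[OF Hom_Ob(1)[OF f] h(1) lact_in[OF f q h(2)] h(3)] ract_lact[OF f h(1,2)] by simp
  qed simp
  finally show ?thesis .
qed

end

lemma app_star_map:
  assumes al: "\<alpha> \<in> Hom (PSh C) X Y" and x: "x \<in> Ob C" and g: "p \<in> words" "a \<in> FOb A (x, p)" "xs \<in> pow X p"
  shows "app (At (star_map C A \<alpha>) x) (cls (starP C A X x) (p, a, xs))
    = cls (starP C A Y x) (p, a, pow_map \<alpha> p xs)"
proof -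
  have XY: "X \<in> Ob (PSh C)" "Y \<in> Ob (PSh C)"
    using category.Hom_Ob[OF category_PSh al] category_axioms by auto
  have "At (star_map C A \<alpha>) x = qmap (starP C A X x) (starP C A Y x) (\<lambda>(p, a, xs). (p, a, pow_map \<alpha> p xs))"
    using HomD[OF al] x by (simp add: star_map_def)
  also have "app \<dots> (cls (starP C A X x) (p, a, xs)) = cls (starP C A Y x) (p, a, pow_map \<alpha> p xs)"
  proof (rule trans[OF app_qmap_star[OF XY(1) x _ g]])
    fix v q p a xs assume h: "v \<in> Hom (M C) q p" "a \<in> FOb A (x, q)" "xs \<in> pow X p"
    have p: "p \<in> words" using M.Hom_Ob(2)[OF h(1)] by simp
    show "(cls (starP C A Y x) (case (q, a, pow_act X (incl v) xs) of (p, a, xs) \<Rightarrow>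
      (p, a, pow_map \<alpha> p xs)) :: 'u) =
        cls (starP C A Y x) (case (p, ract C A x v a, xs) of (p, a, xs) \<Rightarrow> (p, a, pow_map \<alpha> p xs))"
      using star_rel[OF XY(2) x h(1,2) pow_map_pow[OF al p h(3)]]
        pow_map_act[OF al incl_Hom[OF h(1)] h(3) category_axioms] by simp
  qed simp
  finally show ?thesis .
qed

end

section \<open>Actions of permutations on a graph, and their endofunctors\<close>

text \<open>
  The common content of an algebra and of a functor from \<open>sM C\<close> to presheaves: the arrows of \<open>sM C\<close> act
  on the values of \<open>A\<close>, functorially, compatibly with the left action, and extending the right
  action; \<open>\<phi>\<close> is the corresponding function on the symmetrization.
\<close>

locale sym_action = graph C A for C :: "'u::set_universe scat" and A +
  fixes \<phi> :: "'u gmap" and act :: "'u \<Rightarrow> 'u smarr \<Rightarrow> 'u \<Rightarrow> 'u"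
  assumes act_in: "x \<in> Ob C \<Longrightarrow> m \<in> Hom (sM C) q p \<Longrightarrow> a \<in> FOb A (x, q) \<Longrightarrow> act x m a \<in> FOb A (x, p)"
    and act_Ide: "x \<in> Ob C \<Longrightarrow> p \<in> lists (Ob C) \<Longrightarrow> a \<in> FOb A (x, p) \<Longrightarrow> act x (Ide (sM C) p) a = a"
    and act_Comp: "x \<in> Ob C \<Longrightarrow> m \<in> Hom (sM C) q p \<Longrightarrow> n \<in> Hom (sM C) p r \<Longrightarrow> a \<in> FOb A (x, q) \<Longrightarrow>
      act x (Comp (sM C) n m) a = act x n (act x m a)"
    and act_incl: "x \<in> Ob C \<Longrightarrow> v \<in> Hom (M C) q p \<Longrightarrow> a \<in> FOb A (x, q) \<Longrightarrow> act x (incl v) a = ract C A x v a"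
    and act_lact: "f \<in> Hom C x y \<Longrightarrow> m \<in> Hom (sM C) q p \<Longrightarrow> a \<in> FOb A (y, q) \<Longrightarrow>
      lact C A f p (act y m a) = act x m (lact C A f q a)"
    and phi_act: "x \<in> Ob C \<Longrightarrow> m \<in> Hom (sM C) q p \<Longrightarrow> a \<in> FOb A (x, q) \<Longrightarrow>
      app (At \<phi> (x, p)) (cls (symP C A x p) (q, a, m)) = act x m a"
begin

text \<open>
  The image of a generator of \<open>A \<star> X\<close> under the two successive quotient maps to the coequalizer.
\<close>

definition rdd_cls :: "'u psh \<Rightarrow> 'u \<Rightarrow> 'u list \<times> 'u \<times> 'u list \<Rightarrow> 'u" where
  "rdd_cls X x t = cls (rddP C A \<phi> X x) (cls (starP C A X x) t)"

sublocale S: graph C "Sym C A" by (rule graph_Sym)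

context fixes X x assumes X: "X \<in> Ob (PSh C)" and x: "x \<in> Ob C"
begin

lemma app_star_alg:
  assumes m: "m \<in> Hom (sM C) q p" and a: "a \<in> FOb A (x, q)" and xs: "xs \<in> pow X p"
  shows "app (At (star_alg C A \<phi> X) x) (cls (starP C (Sym C A) X x) (p, cls (symP C A x p) (q, a, m), xs))
    = cls (starP C A X x) (p, act x m a, xs)"
proof -
  have p: "p \<in> words" using sM.Hom_Ob[OF m] by simp
  have s: "cls (symP C A x p) (q, a, m) \<in> FOb (Sym C A) (x, p)"
    using cls_in_quot[OF sym_GenI[OF a m]] Sym_FOb[OF x p] by simp
  have "At (star_alg C A \<phi> X) x = qmap (starP C (Sym C A) X x) (starP C A X x)
      (\<lambda>(p, s, xs). (p, app (At \<phi> (x, p)) s, xs))"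
    using x by (simp add: star_alg_def)
  also have "app \<dots> (cls (starP C (Sym C A) X x) (p, cls (symP C A x p) (q, a, m), xs))
    = cls (starP C A X x) (p, act x m a, xs)"
  proof (rule trans[OF S.app_qmap_star[OF X x _ p s xs]])
    fix v r p' s ys assume v: "v \<in> Hom (M C) r p'" and s: "s \<in> FOb (Sym C A) (x, r)" and ys: "ys \<in> pow X p'"
    have o: "r \<in> words" using M.Hom_Ob(1)[OF v] by simp
    obtain q' b n where h: "b \<in> FOb A (x, q')" "n \<in> Hom (sM C) q' r" "s = cls (symP C A x r) (q', b, n)"
      using symE[OF s[unfolded Sym_FOb[OF x o]]] .
    have "act x (Comp (sM C) (incl v) n) b = ract C A x v (act x n b)"
      using act_Comp[OF x h(2) incl_Hom[OF v] h(1)] act_incl[OF x v act_in[OF x h(2,1)]] by simp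
    then show "(cls (starP C A X x) (case (r, s, pow_act X (incl v) ys) of (p, s, xs) \<Rightarrow> (p, app (At \<phi>
      (x, p)) s, xs)) :: 'u)
      = cls (starP C A X x) (case (p', ract C (Sym C A) x v s, ys) of (p, s, xs) \<Rightarrow> (p, app (At \<phi>
        (x, p)) s, xs))"
      using star_rel[OF X x v act_in[OF x h(2,1)] ys] phi_act[OF x h(2,1)]
        phi_act[OF x sM.Comp_Hom[OF h(2) incl_Hom[OF v]] h(1)] ract_Sym[OF x v h(1,2)] h(3) by simp
  qed (simp add: phi_act[OF x m a])
  finally show ?thesis .
qed

text \<open>
  The relations of the symmetrization move an arrow \<open>incl v\<close> from \<open>m\<close> to \<open>a\<close>; since \<open>m\<close> acts contravariantly
  on \<open>xs\<close>, this turns into a relation of \<open>A \<star> X\<close>. Hence the second map of the coequalizer does not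
  depend on the representative chosen in its definition.
\<close>

lemma cls_star_perm:
  assumes "(cls (symP C A x p) (q, a, m) :: 'u) = cls (symP C A x p) (q', a', m')"
    and "a \<in> FOb A (x, q)" "m \<in> Hom (sM C) q p" "a' \<in> FOb A (x, q')" "m' \<in> Hom (sM C) q' p"
      and xs: "xs \<in> pow X p"
  shows "(cls (starP C A X x) (q, a, pow_act X m xs) :: 'u) = cls (starP C A X x) (q', a', pow_act X m' xs)"
proof -
  let ?k = "\<lambda>(q, a, m). cls (starP C A X x) (q, a, pow_act X m xs) :: 'u"
  have "?k (q, a, m) = ?k (q', a', m')"
  proof (rule sym_lift[OF x _ assms(1) sym_GenI[OF assms(2,3)] sym_GenI[OF assms(4,5)]])
    fix v r r' b n assume h: "v \<in> Hom (M C) r r'" "b \<in> FOb A (x, r)" "n \<in> Hom (sM C) r' p"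
    show "?k (r, b, Comp (sM C) n (incl v)) = ?k (r', ract C A x v b, n)"
      using star_rel[OF X x h(1,2) pow_act_pow[OF X h(3) xs]]
        pow_act_Comp[OF X incl_Hom[OF h(1)] h(3) xs category_axioms] by simp
  qed
  then show ?thesis by simp
qed

lemma app_star_perm:
  assumes m: "m \<in> Hom (sM C) q p" and a: "a \<in> FOb A (x, q)" and xs: "xs \<in> pow X p"
  shows "app (At (star_perm C A X) x) (cls (starP C (Sym C A) X x) (p, cls (symP C A x p) (q, a, m), xs))
    = cls (starP C A X x) (q, a, pow_act X m xs)"
proof -
  let ?h = "\<lambda>(p, s :: 'u, xs). let (q, a, m) = rep (symP C A x p) s in (q, a, pow_act X m xs)"
  have h: "(cls (starP C A X x) (?h (p, cls (symP C A x p) (q, a, m), xs)) :: 'u)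
    = cls (starP C A X x) (q, a, pow_act X m xs)"
    if m: "m \<in> Hom (sM C) q p" and a: "a \<in> FOb A (x, q)" and xs: "xs \<in> pow X p" for p q a m xs
  proof -
    have "(cls (symP C A x p) (q, a, m) :: 'u) \<in> quot (symP C A x p)"
      by (rule cls_in_quot[OF sym_GenI[OF a m]])
    then obtain q' a' m' where r: "a' \<in> FOb A (x, q')" "m' \<in> Hom (sM C) q' p"
      "(cls (symP C A x p) (q, a, m) :: 'u) = cls (symP C A x p) (q', a', m')"
      "rep (symP C A x p) (cls (symP C A x p) (q, a, m) :: 'u) = (q', a', m')"
      by (rule rep_symE)
    then show ?thesis using cls_star_perm[OF r(3) a m r(1,2) xs] by simp
  qed
  have p: "p \<in> words" using sM.Hom_Ob[OF m] by simp
  have s: "cls (symP C A x p) (q, a, m) \<in> FOb (Sym C A) (x, p)"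
    using cls_in_quot[OF sym_GenI[OF a m]] Sym_FOb[OF x p] by simp
  have "At (star_perm C A X) x = qmap (starP C (Sym C A) X x) (starP C A X x) ?h"
    using x by (simp add: star_perm_def)
  also have "app \<dots> (cls (starP C (Sym C A) X x) (p, cls (symP C A x p) (q, a, m), xs))
    = cls (starP C A X x) (q, a, pow_act X m xs)"
  proof (rule trans[OF S.app_qmap_star[OF X x _ p s xs]])
    fix v r p' s ys assume v: "v \<in> Hom (M C) r p'" and s: "s \<in> FOb (Sym C A) (x, r)" and ys: "ys \<in> pow X p'"
    have o: "r \<in> words" using M.Hom_Ob(1)[OF v] by simp
    obtain q' b n where g: "b \<in> FOb A (x, q')" "n \<in> Hom (sM C) q' r" "s = cls (symP C A x r) (q', b, n)"
      using symE[OF s[unfolded Sym_FOb[OF x o]]] .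
    show "(cls (starP C A X x) (?h (r, s, pow_act X (incl v) ys)) :: 'u)
      = cls (starP C A X x) (?h (p', ract C (Sym C A) x v s, ys))"
      unfolding g(3) ract_Sym[OF x v g(1,2)] h[OF g(2,1) pow_act_pow[OF X incl_Hom[OF v] ys]]
        h[OF sM.Comp_Hom[OF g(2) incl_Hom[OF v]] g(1) ys]
        pow_act_Comp[OF X g(2) incl_Hom[OF v] ys category_axioms] ..
  qed (rule h[OF m a xs])
  finally show ?thesis .
qed

lemma Gen_rddP: "Gen (rddP C A \<phi> X x) = quot (starP C A X x)"
  using x by (simp add: rddP_def coeqP_def star_alg_def star_def)

lemma RelE_rddP:
  assumes "(b, c) \<in> Rel (rddP C A \<phi> X x)"
  obtains p q a m xs where "m \<in> Hom (sM C) q p" "a \<in> FOb A (x, q)" "xs \<in> pow X p"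
    "b = cls (starP C A X x) (p, act x m a, xs)" "c = cls (starP C A X x) (q, a, pow_act X m xs)"
proof -
  obtain z where z: "z \<in> quot (starP C (Sym C A) X x)" "b = app (At (star_alg C A \<phi> X) x) z"
    "c = app (At (star_perm C A X) x) z"
    using assms x by (auto simp: rddP_def coeqP_def star_alg_def star_def)
  obtain p s xs where s: "p \<in> words" "s \<in> FOb (Sym C A) (x, p)" "xs \<in> pow X p"
    "z = cls (starP C (Sym C A) X x) (p, s, xs)"
    using z(1) by (elim quotE) (auto simp: S.Gen_starP[OF X])
  obtain q a m where "a \<in> FOb A (x, q)" "m \<in> Hom (sM C) q p" "s = cls (symP C A x p) (q, a, m)"
    using symE[OF s(2)[unfolded Sym_FOb[OF x s(1)]]] .
  then show thesis using that[of m q p a xs] app_star_alg app_star_perm s z by simp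
qed

lemma small_rddP: "small_pres TYPE('u) (rddP C A \<phi> X x)"
  unfolding Gen_rddP by (rule small_ess_small[OF small_quot[OF small_starP[OF X x]]])

text \<open>
  The two maps that are coequalized send the class of \<open>(p, [a, m], xs)\<close> to the two sides.
\<close>

lemma rdd_rel:
  assumes m: "m \<in> Hom (sM C) q p" and a: "a \<in> FOb A (x, q)" and xs: "xs \<in> pow X p"
  shows "rdd_cls X x (q, a, pow_act X m xs) = rdd_cls X x (p, act x m a, xs)"
proof -
  have o: "p \<in> words" "q \<in> words" using sM.Hom_Ob[OF m] by simp_all
  have "(p, cls (symP C A x p) (q, a, m), xs) \<in> Gen (starP C (Sym C A) X x)"
    by (rule S.star_GenI[OF X o(1) _ xs]) (simp only: Sym_FOb[OF x o(1)] cls_in_quot[OF sym_GenI[OF a m]])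
  then have "cls (starP C (Sym C A) X x) (p, cls (symP C A x p) (q, a, m), xs) \<in> FOb (star C (Sym C A) X) x"
    using x by (simp add: star_def cls_in_quot)
  then have "(cls (starP C A X x) (p, act x m a, xs), cls (starP C A X x) (q, a, pow_act X m xs))
      \<in> Rel (rddP C A \<phi> X x)"
    unfolding rddP_def coeqP_def using app_star_alg[OF m a xs] app_star_perm[OF m a xs]
    by (force simp: star_alg_def)
  then show ?thesis unfolding rdd_cls_def
    by (intro cls_rel[OF small_rddP, symmetric])
      (auto simp: Gen_rddP intro!: cls_in_quot star_GenI[OF X] pow_act_pow[OF X m xs] act_in[OF x m a] o a xs
        simp del: in_lists_conv_set)
qed

lemma rdd_surj: "quot (rddP C A \<phi> X x) = rdd_cls X x ` Gen (starP C A X x)"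
  unfolding quot_def[of "rddP C A \<phi> X x"] Gen_rddP unfolding quot_def rdd_cls_def by (simp add: image_image)

text \<open>
  Conversely the relations in \<open>rdd_rel\<close> generate the kernel: those with \<open>m\<close> in \<open>M C\<close> are the relations of
  \<open>A \<star> X\<close>, by \<open>act_incl\<close>, and every relation of the coequalizer is of this form.
\<close>

lemma rdd_lift:
  assumes k: "\<And>m q p a xs. m \<in> Hom (sM C) q p \<Longrightarrow> a \<in> FOb A (x, q) \<Longrightarrow> xs \<in> pow X p \<Longrightarrow>
      k (q, a, pow_act X m xs) = k (p, act x m a, xs)"
    and e: "rdd_cls X x t = rdd_cls X x t'" and t: "t \<in> Gen (starP C A X x)" "t' \<in> Gen (starP C A X x)"
  shows "k t = k t'"
proof -
  let ?k = "\<lambda>z :: 'u. k (rep (starP C A X x) z)"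
  have rk: "?k (cls (starP C A X x) t) = k t" if t: "t \<in> Gen (starP C A X x)" for t
  proof (rule cls_lift[OF small_starP[OF X x]])
    fix b c assume "(b, c) \<in> Rel (starP C A X x)"
    then show "k b = k c" unfolding Rel_starP[OF X] using k[OF incl_Hom] act_incl[OF x] by auto
  qed (use rep_quot[OF cls_in_quot[OF t]] t in auto)
  have "?k (cls (starP C A X x) t) = ?k (cls (starP C A X x) t')"
  proof (rule cls_lift[OF small_rddP])
    fix b c assume "(b, c) \<in> Rel (rddP C A \<phi> X x)"
    then obtain p q a m xs where h: "m \<in> Hom (sM C) q p" "a \<in> FOb A (x, q)" "xs \<in> pow X p"
      "b = cls (starP C A X x) (p, act x m a, xs)" "c = cls (starP C A X x) (q, a, pow_act X m xs)"
      by (rule RelE_rddP)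
    have o: "p \<in> words" "q \<in> words" using sM.Hom_Ob[OF h(1)] by simp_all
    show "?k b = ?k c" unfolding h(4,5)
      using k[OF h(1-3)] rk[OF star_GenI[OF X o(1) act_in[OF x h(1,2)] h(3)]]
        rk[OF star_GenI[OF X o(2) h(2) pow_act_pow[OF X h(1,3)]]] by simp
  qed (use e t in \<open>auto simp: rdd_cls_def Gen_rddP intro: cls_in_quot\<close>)
  then show ?thesis using rk t by simp
qed

lemma app_qmap_rdd:
  assumes k: "\<And>m q p a xs. m \<in> Hom (sM C) q p \<Longrightarrow> a \<in> FOb A (x, q) \<Longrightarrow> xs \<in> pow X p \<Longrightarrow>
      (cls Q (h (cls (starP C A X x) (q, a, pow_act X m xs))) :: 'u)
        = cls Q (h (cls (starP C A X x) (p, act x m a, xs)))"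
    and t: "t \<in> Gen (starP C A X x)"
  shows "app (qmap (rddP C A \<phi> X x) Q h) (rdd_cls X x t) = cls Q (h (cls (starP C A X x) t))"
  unfolding rdd_cls_def
proof (rule app_qmap[OF small_rddP])
  fix b c assume "(b, c) \<in> Rel (rddP C A \<phi> X x)"
  then show "(cls Q (h b) :: 'u) = cls Q (h c)" by (rule RelE_rddP) (use k in simp)
qed (use t in \<open>simp add: Gen_rddP cls_in_quot\<close>)

end

lemma rdd_act:
  assumes X: "X \<in> Ob (PSh C)" and f: "f \<in> Hom C x y" and g: "p \<in> words" "a \<in> FOb A (y, p)" "xs \<in> pow X p"
  shows "app (FAr (FOb (rdd C A \<phi>) X) f) (rdd_cls X y (p, a, xs)) = rdd_cls X x (p, lact C A f p a, xs)"
proof -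
  have o: "x \<in> Ob C" "y \<in> Ob C" using Hom_Ob[OF f] by simp_all
  have "FAr (FOb (rdd C A \<phi>) X) f = qmap (rddP C A \<phi> X y) (rddP C A \<phi> X x) (app (FAr (star C A X) f))"
    using X HomD[OF f] by (simp add: rdd_def rdd_ob_def psh_coeq_def rddP_def star_alg_def)
  also have "app \<dots> (rdd_cls X y (p, a, xs)) = rdd_cls X x (p, lact C A f p a, xs)"
  proof (rule trans[OF app_qmap_rdd[OF X o(2) _ star_GenI[OF X g]]])
    fix m q p a xs assume h: "m \<in> Hom (sM C) q p" "a \<in> FOb A (y, q)" "xs \<in> pow X p"
    have w: "p \<in> words" "q \<in> words" using sM.Hom_Ob[OF h(1)] by simp_all
    show "(cls (rddP C A \<phi> X x) (app (FAr (star C A X) f) (cls (starP C A X y) (q, a, pow_act X m xs))) :: 'u)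
      = cls (rddP C A \<phi> X x) (app (FAr (star C A X) f) (cls (starP C A X y) (p, act y m a, xs)))"
      using rdd_rel[OF X o(1) h(1) lact_in[OF f w(2) h(2)] h(3), unfolded rdd_cls_def]
        act_lact[OF f h(1,2)] app_star[OF X f w(2) h(2) pow_act_pow[OF X h(1,3)]]
        app_star[OF X f w(1) act_in[OF o(2) h(1,2)] h(3)] by simp
  qed (simp add: rdd_cls_def app_star[OF X f g])
  finally show ?thesis .
qed

lemma rdd_map:
  assumes al: "\<alpha> \<in> Hom (PSh C) X Y" and x: "x \<in> Ob C" and g: "p \<in> words" "a \<in> FOb A (x, p)" "xs \<in> pow X p"
  shows "app (At (FAr (rdd C A \<phi>) \<alpha>) x) (rdd_cls X x (p, a, xs)) = rdd_cls Y x (p, a, pow_map \<alpha> p xs)"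
proof -
  have XY: "X \<in> Ob (PSh C)" "Y \<in> Ob (PSh C)"
    using category.Hom_Ob[OF category_PSh al] category_axioms by auto
  have "At (FAr (rdd C A \<phi>) \<alpha>) x = qmap (rddP C A \<phi> X x) (rddP C A \<phi> Y x) (app (At (star_map C A \<alpha>) x))"
    using HomD[OF al] x by (simp add: rdd_def)
  also have "app \<dots> (rdd_cls X x (p, a, xs)) = rdd_cls Y x (p, a, pow_map \<alpha> p xs)"
  proof (rule trans[OF app_qmap_rdd[OF XY(1) x _ star_GenI[OF XY(1) g]]])
    fix m q p a xs assume h: "m \<in> Hom (sM C) q p" "a \<in> FOb A (x, q)" "xs \<in> pow X p"
    have w: "p \<in> words" "q \<in> words" using sM.Hom_Ob[OF h(1)] by simp_all
    show "(cls (rddP C A \<phi> Y x) (app (At (star_map C A \<alpha>) x) (cls (starP C A X x)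
      (q, a, pow_act X m xs))) :: 'u)
      = cls (rddP C A \<phi> Y x) (app (At (star_map C A \<alpha>) x) (cls (starP C A X x) (p, act x m a, xs)))"
      using rdd_rel[OF XY(2) x h(1,2) pow_map_pow[OF al w(1) h(3)], unfolded rdd_cls_def]
        pow_map_act[OF al h(1,3) category_axioms]
        app_star_map[OF al x w(2) h(2) pow_act_pow[OF XY(1) h(1,3)]]
        app_star_map[OF al x w(1) act_in[OF x h(1,2)] h(3)] by simp
  qed (simp add: rdd_cls_def app_star_map[OF al x g])
  finally show ?thesis .
qed

lemma rdd_FOb: "X \<in> Ob (PSh C) \<Longrightarrow> x \<in> Ob C \<Longrightarrow> FOb (FOb (rdd C A \<phi>) X) x = quot (rddP C A \<phi> X x)"
  by (simp add: rdd_def rdd_ob_def psh_coeq_def rddP_def)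

lemma PSh_Ar_NDom: "\<alpha> \<in> Ar (PSh C) \<Longrightarrow> NDom \<alpha> \<in> Ob (PSh C) \<and> NCod \<alpha> \<in> Ob (PSh C)"
  by (simp add: PSh_def is_ntr_def)

lemma endo_data_rdd: "endo_data C (rdd C A \<phi>)"
  unfolding endo_data_def
proof (intro conjI ballI)
  show "FOb (rdd C A \<phi>) \<in> extensional (Ob (PSh C))" "FAr (rdd C A \<phi>) \<in> extensional (Ar (PSh C))"
    by (simp_all add: rdd_def)
  fix X assume X: "X \<in> Ob (PSh C)"
  then have e: "FOb (rdd C A \<phi>) X = rdd_ob C A \<phi> X" by (simp add: rdd_def)
  show "FOb (FOb (rdd C A \<phi>) X) \<in> extensional (Ob C)" "FAr (FOb (rdd C A \<phi>) X) \<in> extensional (Ar C)"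
    unfolding e by (simp_all add: rdd_ob_def psh_coeq_def)
  fix f assume "f \<in> Ar C"
  then show "SDom (FAr (FOb (rdd C A \<phi>) X) f) = FOb (FOb (rdd C A \<phi>) X) (Cod C f)"
    "SCod (FAr (FOb (rdd C A \<phi>) X) f) = FOb (FOb (rdd C A \<phi>) X) (Dom C f)"
    "app (FAr (FOb (rdd C A \<phi>) X) f) \<in> extensional (FOb (FOb (rdd C A \<phi>) X) (Cod C f))"
    unfolding e by (simp_all add: rdd_ob_def psh_coeq_def app_qmap_ext Dom_Ob Cod_Ob)
next
  fix \<alpha> assume a: "\<alpha> \<in> Ar (PSh C)"
  note XY = PSh_Ar_NDom[OF a]
  show "NDom (FAr (rdd C A \<phi>) \<alpha>) = FOb (rdd C A \<phi>) (NDom \<alpha>)"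
    "NCod (FAr (rdd C A \<phi>) \<alpha>) = FOb (rdd C A \<phi>) (NCod \<alpha>)"
    "At (FAr (rdd C A \<phi>) \<alpha>) \<in> extensional (Ob C)"
    using a XY by (simp_all add: rdd_def)
  fix x assume x: "x \<in> Ob C"
  show "SDom (At (FAr (rdd C A \<phi>) \<alpha>) x) = FOb (FOb (rdd C A \<phi>) (NDom \<alpha>)) x"
    "SCod (At (FAr (rdd C A \<phi>) \<alpha>) x) = FOb (FOb (rdd C A \<phi>) (NCod \<alpha>)) x"
    "app (At (FAr (rdd C A \<phi>) \<alpha>) x) \<in> extensional (FOb (FOb (rdd C A \<phi>) (NDom \<alpha>)) x)"
    using x a XY by (simp_all add: rdd_FOb) (simp_all add: rdd_def app_qmap_ext)
qed

end

section \<open>Left Kan extensions of functors on sequences\<close>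

locale species = small_category C for C :: "'u::set_universe scat" +
  fixes F :: "'u smftr"
  assumes F_functor: "is_functor (sM C) (PSh C) F"
begin

sublocale M: category "M C" by (rule category_M) unfold_locales
sublocale sM: category "sM C" by (rule category_sM) unfold_locales

abbreviation "words \<equiv> lists (Ob C)"

lemma F_psh: "p \<in> words \<Longrightarrow> is_functor (op_cat C) Set_cat (FOb F p)"
  using is_functorD(3)[OF F_functor, of p] by simp

lemma F_Hom: "m \<in> Hom (sM C) q p \<Longrightarrow> FAr F m \<in> Hom (PSh C) (FOb F q) (FOb F p)"
  by (rule is_functorD(4)[OF F_functor])

lemma F_act_in: "x \<in> Ob C \<Longrightarrow> m \<in> Hom (sM C) q p \<Longrightarrow> c \<in> FOb (FOb F q) x \<Longrightarrow>
    app (At (FAr F m) x) c \<in> FOb (FOb F p) x"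
  by (rule psh_ntrD(1)[OF F_Hom])

lemma F_act_Ide: "x \<in> Ob C \<Longrightarrow> p \<in> words \<Longrightarrow> c \<in> FOb (FOb F p) x \<Longrightarrow>
    app (At (FAr F (Ide (sM C) p)) x) c = c"
  using is_functorD(5)[OF F_functor, of p] PSh_Ide_At[of x C c "FOb F p"] by simp

lemma F_act_Comp: "x \<in> Ob C \<Longrightarrow> m \<in> Hom (sM C) q p \<Longrightarrow> n \<in> Hom (sM C) p r \<Longrightarrow> c \<in> FOb (FOb F q) x \<Longrightarrow>
    app (At (FAr F (Comp (sM C) n m)) x) c = app (At (FAr F n) x) (app (At (FAr F m) x) c)"
  using is_functorD(6)[OF F_functor, of m q p n r] PSh_Comp_At[OF F_Hom] by simp

lemma F_act_nat: "f \<in> Hom C x y \<Longrightarrow> m \<in> Hom (sM C) q p \<Longrightarrow> c \<in> FOb (FOb F q) y \<Longrightarrow>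
    app (FAr (FOb F p) f) (app (At (FAr F m) y) c) = app (At (FAr F m) x) (app (FAr (FOb F q) f) c)"
  using psh_ntrD(2)[OF F_Hom, of m q p f x y c] Hom_Ob[of f x y] by simp

lemma small_F_union: "x \<in> Ob C \<Longrightarrow> small (\<Union>p\<in>words. FOb (FOb F p) x)"
  by (rule small_UN_ess[OF ess_small_words]) (rule pshD(1)[OF F_psh])

context fixes X x assumes X: "X \<in> Ob (PSh C)" and x: "x \<in> Ob C"
begin

lemma Gen_lanP: "Gen (lanP C F X x) = {(p, c, xs). p \<in> words \<and> c \<in> FOb (FOb F p) x \<and> xs \<in> pow X p}"
  by (auto simp: lanP_def coend_def)

lemma Rel_lanP: "Rel (lanP C F X x) =
  {((q, c, pow_act X m xs), (p, app (At (FAr F m) x) c, xs)) | m q p c xs.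
     m \<in> Hom (sM C) q p \<and> c \<in> FOb (FOb F q) x \<and> xs \<in> pow X p}"
  unfolding lanP_def coend_def by (fastforce simp: Hom_def)

lemma small_lanP: "small_pres TYPE('u) (lanP C F X x)"
proof -
  have "ess_small TYPE('u) (words \<times> (\<Union>p\<in>words. FOb (FOb F p) x) \<times> (\<Union>p\<in>words. pow X p))"
    by (intro ess_small_Times ess_small_words ess_small_pow small_ess_small small_F_union X x)
  then show ?thesis by (rule ess_small_subset) (auto simp: Gen_lanP)
qed

lemma lan_GenI: "p \<in> words \<Longrightarrow> c \<in> FOb (FOb F p) x \<Longrightarrow> xs \<in> pow X p \<Longrightarrow> (p, c, xs) \<in> Gen (lanP C F X x)"
  by (simp add: Gen_lanP)

lemma lan_rel:
  assumes "m \<in> Hom (sM C) q p" "c \<in> FOb (FOb F q) x" "xs \<in> pow X p"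
  shows "(cls (lanP C F X x) (q, c, pow_act X m xs) :: 'u)
    = cls (lanP C F X x) (p, app (At (FAr F m) x) c, xs)"
proof (rule cls_rel[OF small_lanP])
  show "((q, c, pow_act X m xs), p, app (At (FAr F m) x) c, xs) \<in> Rel (lanP C F X x)"
    unfolding Rel_lanP using assms by blast
  have "p \<in> words" "q \<in> words" using sM.Hom_Ob[OF assms(1)] by simp_all
  then show "(q, c, pow_act X m xs) \<in> Gen (lanP C F X x)"
    "(p, app (At (FAr F m) x) c, xs) \<in> Gen (lanP C F X x)"
    using lan_GenI pow_act_pow[OF X assms(1,3)] F_act_in[OF x assms(1,2)] assms by blast+
qed

lemma lan_lift:
  assumes "\<And>m q p c xs. m \<in> Hom (sM C) q p \<Longrightarrow> c \<in> FOb (FOb F q) x \<Longrightarrow> xs \<in> pow X p \<Longrightarrow>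
      k (q, c, pow_act X m xs) = k (p, app (At (FAr F m) x) c, xs)"
    and "(cls (lanP C F X x) t :: 'u) = cls (lanP C F X x) t'" "t \<in> Gen (lanP C F X x)"
      "t' \<in> Gen (lanP C F X x)"
  shows "k t = k t'"
proof (rule cls_lift[OF small_lanP _ assms(2-4)])
  fix b c assume "(b, c) \<in> Rel (lanP C F X x)"
  then show "k b = k c" unfolding Rel_lanP using assms(1) by blast
qed

lemma app_qmap_lan:
  assumes "\<And>m q p c xs. m \<in> Hom (sM C) q p \<Longrightarrow> c \<in> FOb (FOb F q) x \<Longrightarrow> xs \<in> pow X p \<Longrightarrow>
      (cls Q (h (q, c, pow_act X m xs)) :: 'u) = cls Q (h (p, app (At (FAr F m) x) c, xs))"
    and "t \<in> Gen (lanP C F X x)"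
  shows "app (qmap (lanP C F X x) Q h) (cls (lanP C F X x) t :: 'u) = cls Q (h t)"
proof (rule app_qmap[OF small_lanP _ assms(2)])
  fix b c assume "(b, c) \<in> Rel (lanP C F X x)"
  then show "(cls Q (h b) :: 'u) = cls Q (h c)" unfolding Rel_lanP using assms(1) by blast
qed

end

lemma lan_FOb: "X \<in> Ob (PSh C) \<Longrightarrow> x \<in> Ob C \<Longrightarrow> FOb (FOb (lan C F) X) x = quot (lanP C F X x)"
  by (simp add: lan_def lan_ob_def)

lemma lan_act:
  assumes X: "X \<in> Ob (PSh C)" and f: "f \<in> Hom C x y" and g: "p \<in> words" "c \<in> FOb (FOb F p) y" "xs \<in> pow X p"
  shows "app (FAr (FOb (lan C F) X) f) (cls (lanP C F X y) (p, c, xs))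
    = cls (lanP C F X x) (p, app (FAr (FOb F p) f) c, xs)"
proof -
  have o: "x \<in> Ob C" "y \<in> Ob C" using Hom_Ob[OF f] by simp_all
  have "FAr (FOb (lan C F) X) f = qmap (lanP C F X y) (lanP C F X x) (\<lambda>(p, c, xs). (p, app (FAr
    (FOb F p) f) c, xs))"
    using X HomD[OF f] by (simp add: lan_def lan_ob_def)
  also have "app \<dots> (cls (lanP C F X y) (p, c, xs)) = cls (lanP C F X x) (p, app (FAr (FOb F p) f) c, xs)"
  proof (rule trans[OF app_qmap_lan[OF X o(2) _ lan_GenI[OF X o(2) g]]])
    fix m q p c xs assume h: "m \<in> Hom (sM C) q p" "c \<in> FOb (FOb F q) y" "xs \<in> pow X p"
    have "q \<in> words" using sM.Hom_Ob[OF h(1)] by simp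
    then show "(cls (lanP C F X x) (case (q, c, pow_act X m xs) of (p, c, xs) \<Rightarrow> (p, app (FAr
      (FOb F p) f) c, xs)) :: 'u)
      = cls (lanP C F X x) (case (p, app (At (FAr F m) y) c, xs) of (p, c, xs) \<Rightarrow> (p, app (FAr
        (FOb F p) f) c, xs))"
      using lan_rel[OF X o(1) h(1) pshD(2)[OF F_psh f h(2)] h(3)] F_act_nat[OF f h(1,2)] by simp
  qed simp
  finally show ?thesis .
qed

lemma lan_map:
  assumes al: "\<alpha> \<in> Hom (PSh C) X Y" and x: "x \<in> Ob C" and g: "p \<in> words" "c \<in> FOb (FOb F p) x" "xs \<in> pow X p"
  shows "app (At (FAr (lan C F) \<alpha>) x) (cls (lanP C F X x) (p, c, xs))
    = cls (lanP C F Y x) (p, c, pow_map \<alpha> p xs)"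
proof -
  have XY: "X \<in> Ob (PSh C)" "Y \<in> Ob (PSh C)"
    using category.Hom_Ob[OF category_PSh al] category_axioms by auto
  have "At (FAr (lan C F) \<alpha>) x = qmap (lanP C F X x) (lanP C F Y x) (\<lambda>(p, c, xs). (p, c, pow_map \<alpha> p xs))"
    using HomD[OF al] x by (simp add: lan_def)
  also have "app \<dots> (cls (lanP C F X x) (p, c, xs)) = cls (lanP C F Y x) (p, c, pow_map \<alpha> p xs)"
  proof (rule trans[OF app_qmap_lan[OF XY(1) x _ lan_GenI[OF XY(1) x g]]])
    fix m q p c xs assume h: "m \<in> Hom (sM C) q p" "c \<in> FOb (FOb F q) x" "xs \<in> pow X p"
    have "p \<in> words" using sM.Hom_Ob[OF h(1)] by simp
    then show "(cls (lanP C F Y x) (case (q, c, pow_act X m xs) of (p, c, xs) \<Rightarrow> (p, c, pow_map \<alpha> p xs)) :: 'u)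
      = cls (lanP C F Y x) (case (p, app (At (FAr F m) x) c, xs) of (p, c, xs) \<Rightarrow> (p, c, pow_map \<alpha> p xs))"
      using lan_rel[OF XY(2) x h(1,2) pow_map_pow[OF al _ h(3)]] pow_map_act[OF al h(1,3) category_axioms]
        by simp
  qed simp
  finally show ?thesis .
qed

lemma endo_data_lan: "endo_data C (lan C F)"
  unfolding endo_data_def
proof (intro conjI ballI)
  show "FOb (lan C F) \<in> extensional (Ob (PSh C))" "FAr (lan C F) \<in> extensional (Ar (PSh C))"
    by (simp_all add: lan_def)
  fix X assume X: "X \<in> Ob (PSh C)"
  then have e: "FOb (lan C F) X = lan_ob C F X" by (simp add: lan_def)
  show "FOb (FOb (lan C F) X) \<in> extensional (Ob C)" "FAr (FOb (lan C F) X) \<in> extensional (Ar C)"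
    unfolding e by (simp_all add: lan_ob_def)
  fix f assume "f \<in> Ar C"
  then show "SDom (FAr (FOb (lan C F) X) f) = FOb (FOb (lan C F) X) (Cod C f)"
    "SCod (FAr (FOb (lan C F) X) f) = FOb (FOb (lan C F) X) (Dom C f)"
    "app (FAr (FOb (lan C F) X) f) \<in> extensional (FOb (FOb (lan C F) X) (Cod C f))"
    unfolding e by (simp_all add: lan_ob_def app_qmap_ext Dom_Ob Cod_Ob)
next
  fix \<alpha> assume a: "\<alpha> \<in> Ar (PSh C)"
  then have XY: "NDom \<alpha> \<in> Ob (PSh C)" "NCod \<alpha> \<in> Ob (PSh C)" by (simp_all add: PSh_def is_ntr_def)
  show "NDom (FAr (lan C F) \<alpha>) = FOb (lan C F) (NDom \<alpha>)" "NCod (FAr (lan C F) \<alpha>) = FOb (lan C F) (NCod \<alpha>)"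
    "At (FAr (lan C F) \<alpha>) \<in> extensional (Ob C)"
    using a XY by (simp_all add: lan_def)
  fix x assume x: "x \<in> Ob C"
  show "SDom (At (FAr (lan C F) \<alpha>) x) = FOb (FOb (lan C F) (NDom \<alpha>)) x"
    "SCod (At (FAr (lan C F) \<alpha>) x) = FOb (FOb (lan C F) (NCod \<alpha>)) x"
    "app (At (FAr (lan C F) \<alpha>) x) \<in> extensional (FOb (FOb (lan C F) (NDom \<alpha>)) x)"
    using x a XY by (simp_all add: lan_FOb) (simp_all add: lan_def app_qmap_ext)
qed

end

section \<open>Algebras for the symmetrization monad\<close>

lemma id_ftr_simps [simp]: "x \<in> Ob C \<Longrightarrow> FOb (id_ftr C) x = x" "f \<in> Ar C \<Longrightarrow> FAr (id_ftr C) f = f"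
  by (simp_all add: id_ftr_def)

lemma map_id_ftr: "p \<in> lists (Ob C) \<Longrightarrow> map (FOb (id_ftr C)) p = p"
  "v \<in> lists (Ar C) \<Longrightarrow> map (FAr (id_ftr C)) v = v"
  by (auto intro!: map_idI)

lemma id_functor: assumes "category C" shows "is_functor C C (id_ftr C)"
proof -
  interpret category C by fact
  show ?thesis
    by (rule is_functorI)
      (auto simp: id_ftr_def HomD(1) HomD(1)[OF Comp_Hom] HomD(1)[OF Ide_Hom] dest: Hom_Ob)
qed

lemma comp_ftr_id_right: "is_functor C D F \<Longrightarrow> comp_ftr C F (id_ftr C) = F"
  by (rule functor_eqI[where C = C]) (auto simp: comp_ftr_def id_ftr_def compose_def is_functorD(1,2))

lemma comp_ftr_id_left: "is_functor C D F \<Longrightarrow> comp_ftr C (id_ftr D) F = F"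
  by (rule functor_eqI[where C = C])
    (auto simp: comp_ftr_def compose_def is_functorD(1-3) HomD(1)[OF is_functorD(4)[OF _ Ar_Hom]])

lemma gbase_id: "gbase C (id_ftr C) = id_ftr (gcat C)"
  by (rule functor_eqI[where C = "gcat C"]) (auto simp: gbase_def id_ftr_def intro!: map_idI)

lemma Gph_simps [simp]: "Ob Gph = {(C, A). C \<in> small_cats \<and> is_functor (gcat C) Set_cat A}"
  "Dom Gph = Src" "Cod Gph = Tgt"
  by (simp_all add: Gph_def Let_def)

lemma Gph_Hom_iff: "k \<in> Hom Gph (C, A) (D, B) \<longleftrightarrow>
    (C, A) \<in> Ob Gph \<and> (D, B) \<in> Ob Gph \<and> Src k = (C, A) \<and> Tgt k = (D, B) \<and> is_functor C D (Base k) \<and>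
    Over k \<in> Hom (fun_cat (gcat C) Set_cat) A (comp_ftr (gcat C) B (gbase C (Base k)))"
proof -
  have "k \<in> Ar Gph \<longleftrightarrow> (\<exists>C A D B u n. k = \<lparr>Src = (C, A), Tgt = (D, B), Base = u, Over = n\<rparr> \<and>
     (C, A) \<in> Ob Gph \<and> (D, B) \<in> Ob Gph \<and> is_functor C D u \<and>
     n \<in> Hom (fun_cat (gcat C) Set_cat) A (comp_ftr (gcat C) B (gbase C u)))"
    by (auto simp: Gph_def Let_def)
  then show ?thesis unfolding Hom_def[of Gph] by (cases k) auto
qed

lemma farr_eqI: "Src k = Src l \<Longrightarrow> Tgt k = Tgt l \<Longrightarrow> Base k = Base l \<Longrightarrow> Over k = Over l \<Longrightarrow>
  k = (l :: ('x, 'u, 'n) farr)"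
  by simp

text \<open>
  Over the identity functor, the equation between two composites in the total category comes down to an
  equation between functions on each set \<open>FOb G (x, p)\<close>.
\<close>

lemma Gph_Comp_id:
  assumes "Src k = (C, G)" "Base k = id_ftr C" "Base h = id_ftr C" "Tgt h = (C, A)" "category C"
    and "is_functor (gcat C) Set_cat A"
  shows "Comp Gph h k = \<lparr>Src = (C, G), Tgt = (C, A), Base = id_ftr C,
    Over = \<lparr>NDom = G, NCod = A, At = (\<lambda>z\<in>Ob (gcat C). Comp Set_cat (At (Over h) z) (At (Over k) z))\<rparr>\<rparr>"
proof -
  have "comp_ftr C (id_ftr C) (id_ftr C) = id_ftr C"
    by (rule comp_ftr_id_right[OF id_functor[OF assms(5)]])
  then show ?thesis using assms comp_ftr_id_right[OF assms(6)]
    by (simp add: Gph_def Let_def gbase_id cong: restrict_cong del: gcat_simps)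
qed

lemma app_Comp_SDom: "a \<in> SDom f \<Longrightarrow> app (Comp Set_cat g f) a = app g (app f a)"
  by (simp add: Set_Comp compose_def)

context graph
begin

definition alg_arr :: "'u gmap \<Rightarrow> 'u garr" where
  "alg_arr \<phi> = \<lparr>Src = (C, Sym C A), Tgt = (C, A), Base = id_ftr C, Over = \<phi>\<rparr>"

lemma Gph_Ob: "(C, A) \<in> Ob Gph" "(C, Sym C A) \<in> Ob Gph"
  using A_functor Sym_functor by (simp_all add: small_cats_iff small_category_axioms)

text \<open>
  Arrows of \<open>Gph\<close> are equal when their components are, and these are compared element by element.
\<close>

lemma unit_law_iff:
  assumes phi: "\<phi> \<in> Hom (fun_cat (gcat C) Set_cat) (Sym C A) A"
  shows "Comp Gph (alg_arr \<phi>) (Sym_unit (C, A)) = Ide Gph (C, A) \<longleftrightarrow>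
    (\<forall>x\<in>Ob C. \<forall>p\<in>words. \<forall>a\<in>FOb A (x, p). app (At \<phi> (x, p)) (cls (symP C A x p) (p, a, Ide (sM C) p)) = a)"
  (is "?L = ?R \<longleftrightarrow> ?law")
proof -
  let ?c = "\<lambda>z. Comp Set_cat (At \<phi> z) (At (Over (Sym_unit (C, A))) z)"
  have L: "?L = \<lparr>Src = (C, A), Tgt = (C, A), Base = id_ftr C, Over = \<lparr>NDom = A, NCod = A, At
    = restrict ?c (Ob (gcat C))\<rparr>\<rparr>"
    by (subst Gph_Comp_id[where C = C and G = A and A = A])
      (simp_all add: Sym_unit_def alg_arr_def category_axioms A_functor del: gcat_simps)
  have R: "?R = \<lparr>Src = (C, A), Tgt = (C, A), Base = id_ftr C,
      Over = \<lparr>NDom = A, NCod = A, At = (\<lambda>z\<in>Ob (gcat C). Ide Set_cat (FOb A z))\<rparr>\<rparr>"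
    by (simp add: Gph_def Let_def del: gcat_simps)
  have "?L = ?R \<longleftrightarrow> (\<forall>z\<in>Ob (gcat C). ?c z = Ide Set_cat (FOb A z))"
    unfolding L R by (auto simp: fun_eq_iff restrict_def simp del: gcat_simps Set_cat_simps)
  also have "\<dots> \<longleftrightarrow> (\<forall>x\<in>Ob C. \<forall>p\<in>words. ?c (x, p) = Ide Set_cat (FOb A (x, p)))"
    unfolding gcat_simps(1) by blast
  also have "\<dots> \<longleftrightarrow> ?law"
  proof (intro ball_cong refl)
    fix x p assume x: "x \<in> Ob C" and p: "p \<in> words"
    have e: "At (Over (Sym_unit (C, A))) (x, p) = \<lparr>SDom = FOb A (x, p), SCod = quot (symP C A x p),
        app = (\<lambda>a\<in>FOb A (x, p). cls (symP C A x p) (p, a, Ide (sM C) p))\<rparr>" (is "_ = ?e")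
      using x p by (simp add: Sym_unit_def del: in_lists_conv_set)
    have eH: "?e \<in> Hom Set_cat (FOb A (x, p)) (FOb (Sym C A) (x, p))"
      using gph_small[OF x p] small_quot[OF small_symP[OF x]] sym_GenI[OF _ sM.Ide_Hom] p
      by (auto simp: Set_Hom_iff x intro!: cls_in_quot simp del: in_lists_conv_set sM_simps(2))
    have "At \<phi> (x, p) \<in> Hom Set_cat (FOb (Sym C A) (x, p)) (FOb A (x, p))"
      using phi x p by (simp add: ntr_Hom_iff)
    note H = Set_Comp_Hom[OF eH this] Set_Ide_Hom[OF gph_small[OF x p]]
    have "?c (x, p) = Ide Set_cat (FOb A (x, p)) \<longleftrightarrow> (\<forall>a\<in>FOb A (x, p). app (?c (x, p)) a = a)"
      unfolding e using Set_eqI[OF H] by auto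
    then show "?c (x, p) = Ide Set_cat (FOb A (x, p)) \<longleftrightarrow>
        (\<forall>a\<in>FOb A (x, p). app (At \<phi> (x, p)) (cls (symP C A x p) (p, a, Ide (sM C) p)) = a)"
      by (simp add: e app_Comp_SDom)
  qed
  finally show ?thesis .
qed

lemma phi_in:
  assumes "\<phi> \<in> Hom (fun_cat (gcat C) Set_cat) (Sym C A) A" "x \<in> Ob C" "p \<in> words" "s \<in> FOb (Sym C A) (x, p)"
  shows "app (At \<phi> (x, p)) s \<in> FOb A (x, p)"
  using set_ntrD(1)[OF assms(1), of "(x, p)" s] assms by simp

lemma phi_nat:
  assumes "\<phi> \<in> Hom (fun_cat (gcat C) Set_cat) (Sym C A) A" "f \<in> Hom C x y" "v \<in> Hom (M C) q p"
    "s \<in> FOb (Sym C A) (y, q)"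
  shows "app (At \<phi> (x, p)) (app (FAr (Sym C A) (f, v)) s) = app (FAr A (f, v)) (app (At \<phi> (y, q)) s)"
  using set_ntrD(2)[OF assms(1), of "(f, v)" "(y, q)"
    "(x, p)" s] assms Hom_Ob[OF assms(2)] M.Hom_Ob[OF assms(3)]
  by (simp add: gcat_Hom_iff)

text \<open>
  The multiplication is defined through a representative of the inner class. Composing with \<open>n\<close> on the
  left preserves the relations, so any representative gives the same result.
\<close>

lemma app_Sym_mult:
  assumes x: "x \<in> Ob C" and a: "a \<in> FOb A (x, q)" and m: "m \<in> Hom (sM C) q r" and n: "n \<in> Hom (sM C) r p"
  shows "app (At (Over (Sym_mult (C, A))) (x, p))
      (cls (symP C (Sym C A) x p) (r, cls (symP C A x r) (q, a, m), n))
    = cls (symP C A x p) (q, a, Comp (sM C) n m)"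
proof -
  interpret S: graph C "Sym C A" by (rule graph_Sym)
  let ?h = "\<lambda>(q', s :: 'u, m'). let (q, a, m) = rep (symP C A x q') s in (q, a, Comp (sM C) m' m)"
  have well: "(cls (symP C A x p) (q, a, Comp (sM C) n m) :: 'u)
    = cls (symP C A x p) (q', a', Comp (sM C) n m')"
    if e: "(cls (symP C A x r) (q, a, m) :: 'u) = cls (symP C A x r) (q', a', m')"
      and h: "a \<in> FOb A (x, q)" "m \<in> Hom (sM C) q r" "a' \<in> FOb A (x, q')" "m' \<in> Hom (sM C) q' r"
        "n \<in> Hom (sM C) r p" for q a m q' a' m' n r
  proof -
    let ?k = "\<lambda>(q, a, m). cls (symP C A x p) (q, a, Comp (sM C) n m) :: 'u"
    have "?k (q, a, m) = ?k (q', a', m')"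
    proof (rule sym_lift[OF x _ e sym_GenI[OF h(1,2)] sym_GenI[OF h(3,4)]])
      fix v t t' b l assume g: "v \<in> Hom (M C) t t'" "b \<in> FOb A (x, t)" "l \<in> Hom (sM C) t' r"
      show "?k (t, b, Comp (sM C) l (incl v)) = ?k (t', ract C A x v b, l)"
        using sym_rel[OF x g(1,2) sM.Comp_Hom[OF g(3) h(5)]] sM.Comp_assoc[OF incl_Hom[OF g(1)] g(3) h(5)]
          by simp
    qed
    then show ?thesis by simp
  qed
  have h: "(cls (symP C A x p) (?h (r, cls (symP C A x r) (q, a, m), n)) :: 'u)
    = cls (symP C A x p) (q, a, Comp (sM C) n m)"
    if g: "a \<in> FOb A (x, q)" "m \<in> Hom (sM C) q r" "n \<in> Hom (sM C) r p" for q a m n r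
  proof -
    have "(cls (symP C A x r) (q, a, m) :: 'u) \<in> quot (symP C A x r)"
      by (rule cls_in_quot[OF sym_GenI[OF g(1,2)]])
    then obtain q' a' m' where i: "a' \<in> FOb A (x, q')" "m' \<in> Hom (sM C) q' r"
      "(cls (symP C A x r) (q, a, m) :: 'u) = cls (symP C A x r) (q', a', m')"
      "rep (symP C A x r) (cls (symP C A x r) (q, a, m) :: 'u) = (q', a', m')"
      by (rule rep_symE)
    then show ?thesis using well[OF i(3) g(1,2) i(1,2) g(3)] by simp
  qed
  have o: "p \<in> words" "r \<in> words" using sM.Hom_Ob[OF n] by simp_all
  have s: "cls (symP C A x r) (q, a, m) \<in> FOb (Sym C A) (x, r)"
    using cls_in_quot[OF sym_GenI[OF a m]] Sym_FOb[OF x o(2)] by simp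
  have "At (Over (Sym_mult (C, A))) (x, p) = qmap (symP C (Sym C A) x p) (symP C A x p) ?h"
    using x o by (simp add: Sym_mult_def)
  also have "app \<dots> (cls (symP C (Sym C A) x p) (r, cls (symP C A x r) (q, a, m), n))
    = cls (symP C A x p) (q, a, Comp (sM C) n m)"
  proof (rule trans[OF S.app_qmap_sym[OF x _ s n]])
    fix v t t' s l assume g: "v \<in> Hom (M C) t t'" "s \<in> FOb (Sym C A) (x, t)" "l \<in> Hom (sM C) t' p"
    have t: "t \<in> words" using M.Hom_Ob(1)[OF g(1)] by simp
    obtain q a m where i: "a \<in> FOb A (x, q)" "m \<in> Hom (sM C) q t" "s = cls (symP C A x t) (q, a, m)"
      using symE[OF g(2)[unfolded Sym_FOb[OF x t]]] .
    show "(cls (symP C A x p) (?h (t, s, Comp (sM C) l (incl v))) :: 'u)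
      = cls (symP C A x p) (?h (t', ract C (Sym C A) x v s, l))"
      unfolding i(3) ract_Sym[OF x g(1) i(1,2)] h[OF i(1,2) sM.Comp_Hom[OF incl_Hom[OF g(1)] g(3)]]
        h[OF i(1) sM.Comp_Hom[OF i(2) incl_Hom[OF g(1)]] g(3)]
        sM.Comp_assoc[OF i(2) incl_Hom[OF g(1)] g(3)] ..
  qed (rule h[OF a m n])
  finally show ?thesis .
qed

lemma app_Sym_arr:
  assumes phi: "\<phi> \<in> Hom (fun_cat (gcat C) Set_cat) (Sym C A) A"
    and x: "x \<in> Ob C" and s: "s \<in> FOb (Sym C A) (x, r)" and n: "n \<in> Hom (sM C) r p"
  shows "app (At (Over (Sym_arr (alg_arr \<phi>))) (x, p)) (cls (symP C (Sym C A) x p) (r, s, n))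
    = cls (symP C A x p) (r, app (At \<phi> (x, r)) s, n)"
proof -
  interpret S: graph C "Sym C A" by (rule graph_Sym)
  let ?h = "\<lambda>(q, a, (\<sigma>, v)). (map (FOb (id_ftr C)) q, app (At \<phi> (x, q)) a, (\<sigma>, map (FAr (id_ftr C)) v))"
  have h: "?h (r, s, n) = (r, app (At \<phi> (x, r)) s, n)" if "n \<in> Hom (sM C) r p" for r s n
  proof -
    have "r \<in> words" using sM.Hom_Ob(1)[OF that] by simp
    moreover obtain \<sigma> v where "n = (\<sigma>, v)" by (metis surj_pair)
    moreover have "v \<in> lists (Ar C)" using that \<open>n = _\<close> by (simp add: Hom_def sM_def)
    ultimately show ?thesis by (simp add: map_id_ftr del: in_lists_conv_set)
  qed
  have o: "p \<in> words" "r \<in> words" using sM.Hom_Ob[OF n] by simp_all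
  have "At (Over (Sym_arr (alg_arr \<phi>))) (x, p) = qmap (symP C (Sym C A) x p) (symP C A x p) ?h"
    using x o by (simp add: Sym_arr_def Let_def alg_arr_def map_id_ftr del: in_lists_conv_set)
  also have "app \<dots> (cls (symP C (Sym C A) x p) (r, s, n)) = cls (symP C A x p) (r, app (At \<phi> (x, r)) s, n)"
  proof (rule trans[OF S.app_qmap_sym[OF x _ s n]])
    fix v t t' s l assume g: "v \<in> Hom (M C) t t'" "s \<in> FOb (Sym C A) (x, t)" "l \<in> Hom (sM C) t' p"
    have t: "t \<in> words" using M.Hom_Ob(1)[OF g(1)] by simp
    have "app (At \<phi> (x, t')) (ract C (Sym C A) x v s) = ract C A x v (app (At \<phi> (x, t)) s)"
      unfolding ract_def by (rule phi_nat[OF phi Ide_Hom[OF x] g(1,2)])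
    then show "(cls (symP C A x p) (?h (t, s, Comp (sM C) l (incl v))) :: 'u)
      = cls (symP C A x p) (?h (t', ract C (Sym C A) x v s, l))"
      unfolding h[OF sM.Comp_Hom[OF incl_Hom[OF g(1)] g(3)]] h[OF g(3)]
      using sym_rel[OF x g(1) phi_in[OF phi x t g(2)] g(3)] by simp
  qed (simp only: h[OF n])
  finally show ?thesis .
qed

text \<open>
  Both composites are determined by their values at the classes \<open>[[a, m], n]\<close>, which generate the
  twofold symmetrization.
\<close>

lemma mult_law_iff:
  assumes phi: "\<phi> \<in> Hom (fun_cat (gcat C) Set_cat) (Sym C A) A"
  shows "Comp Gph (alg_arr \<phi>) (Sym_mult (C, A)) = Comp Gph (alg_arr \<phi>) (Sym_arr (alg_arr \<phi>)) \<longleftrightarrow>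
    (\<forall>x\<in>Ob C. \<forall>q r p a m n. a \<in> FOb A (x, q) \<longrightarrow> m \<in> Hom (sM C) q r \<longrightarrow> n \<in> Hom (sM C) r p \<longrightarrow>
      app (At \<phi> (x, p)) (cls (symP C A x p) (q, a, Comp (sM C) n m)) =
      app (At \<phi> (x, p)) (cls (symP C A x p) (r, app (At \<phi> (x, r)) (cls (symP C A x r) (q, a, m)), n)))"
  (is "?L = ?R \<longleftrightarrow> ?law")
proof -
  interpret S: graph C "Sym C A" by (rule graph_Sym)
  let ?c = "\<lambda>k z. Comp Set_cat (At \<phi> z) (At (Over k) z)"
  let ?mu = "Sym_mult (C, A)" and ?S = "Sym_arr (alg_arr \<phi>)"
  have LR: "?L = \<lparr>Src = (C, Sym C (Sym C A)), Tgt = (C, A), Base = id_ftr C,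
        Over = \<lparr>NDom = Sym C (Sym C A), NCod = A, At = restrict (?c ?mu) (Ob (gcat C))\<rparr>\<rparr>"
      "?R = \<lparr>Src = (C, Sym C (Sym C A)), Tgt = (C, A), Base = id_ftr C,
        Over = \<lparr>NDom = Sym C (Sym C A), NCod = A, At = restrict (?c ?S) (Ob (gcat C))\<rparr>\<rparr>"
    by (subst Gph_Comp_id[where C = C and G = "Sym C (Sym C A)" and A = A],
      simp_all add: Sym_mult_def Sym_arr_def Let_def alg_arr_def category_axioms A_functor del: gcat_simps)+
  have "?L = ?R \<longleftrightarrow> (\<forall>z\<in>Ob (gcat C). ?c ?mu z = ?c ?S z)"
    unfolding LR by (auto simp: fun_eq_iff restrict_def simp del: gcat_simps)
  also have "\<dots> \<longleftrightarrow> (\<forall>x\<in>Ob C. \<forall>p\<in>words. ?c ?mu (x, p) = ?c ?S (x, p))"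
    unfolding gcat_simps(1) by blast
  also have "\<dots> \<longleftrightarrow> (\<forall>x\<in>Ob C. \<forall>p\<in>words. \<forall>q r a m n. a \<in> FOb A (x, q) \<longrightarrow> m \<in> Hom (sM C) q r \<longrightarrow> n \<in> Hom (sM C) r p \<longrightarrow>
      app (At \<phi> (x, p)) (cls (symP C A x p) (q, a, Comp (sM C) n m)) =
      app (At \<phi> (x, p)) (cls (symP C A x p) (r, app (At \<phi> (x, r)) (cls (symP C A x r) (q, a, m)), n)))"
  proof (intro ball_cong refl)
    fix x p assume x: "x \<in> Ob C" and p: "p \<in> words"
    let ?Q = "quot (symP C (Sym C A) x p) :: 'u set"
    have D: "SDom (At (Over ?mu) (x, p)) = ?Q" "SDom (At (Over ?S) (x, p)) = ?Q"
      using x p by (simp_all add: Sym_mult_def Sym_arr_def Let_def alg_arr_def)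
    have ph: "At \<phi> (x, p) \<in> Hom Set_cat (FOb (Sym C A) (x, p)) (FOb A (x, p))"
      using phi x p by (simp add: ntr_Hom_iff)
    have "?c ?mu (x, p) = ?c ?S (x, p) \<longleftrightarrow> (\<forall>s\<in>?Q. app (At \<phi> (x, p)) (app (At (Over ?mu) (x, p)) s) =
        app (At \<phi> (x, p)) (app (At (Over ?S) (x, p)) s))"
      unfolding Set_Comp by (auto simp: D compose_def fun_eq_iff)
    also have "\<dots> \<longleftrightarrow> (\<forall>q r a m n. a \<in> FOb A (x, q) \<longrightarrow> m \<in> Hom (sM C) q r \<longrightarrow> n \<in> Hom (sM C) r p \<longrightarrow>
      app (At \<phi> (x, p)) (cls (symP C A x p) (q, a, Comp (sM C) n m)) =
      app (At \<phi> (x, p)) (cls (symP C A x p) (r, app (At \<phi> (x, r)) (cls (symP C A x r) (q, a, m)), n)))"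
      (is "?l \<longleftrightarrow> ?r")
    proof
      assume l: ?l
      show ?r
      proof (intro allI impI)
        fix q r a m n assume g: "a \<in> FOb A (x, q)" "m \<in> Hom (sM C) q r" "n \<in> Hom (sM C) r p"
        have r: "r \<in> words" using sM.Hom_Ob(1)[OF g(3)] by simp
        have s: "cls (symP C A x r) (q, a, m) \<in> FOb (Sym C A) (x, r)"
          using cls_in_quot[OF sym_GenI[OF g(1,2)]] Sym_FOb[OF x r] by simp
        have i: "cls (symP C (Sym C A) x p) (r, cls (symP C A x r) (q, a, m), n) \<in> ?Q"
          by (rule cls_in_quot[OF S.sym_GenI[OF s g(3)]])
        show "app (At \<phi> (x, p)) (cls (symP C A x p) (q, a, Comp (sM C) n m)) =
          app (At \<phi> (x, p)) (cls (symP C A x p) (r, app (At \<phi> (x, r)) (cls (symP C A x r) (q, a, m)), n))"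
          using bspec[OF l i] app_Sym_mult[OF x g] app_Sym_arr[OF phi x s g(3)] by simp
      qed
    next
      assume r: ?r
      show ?l
      proof
        fix z assume "z \<in> ?Q"
        then obtain t s n where z: "s \<in> FOb (Sym C A) (x, t)" "n \<in> Hom (sM C) t p"
          "z = cls (symP C (Sym C A) x p) (t, s, n)"
          by (rule S.symE)
        have t: "t \<in> words" using sM.Hom_Ob(1)[OF z(2)] by simp
        obtain q a m where i: "a \<in> FOb A (x, q)" "m \<in> Hom (sM C) q t" "s = cls (symP C A x t) (q, a, m)"
          using symE[OF z(1)[unfolded Sym_FOb[OF x t]]] .
        show "app (At \<phi> (x, p)) (app (At (Over ?mu) (x, p)) z)
          = app (At \<phi> (x, p)) (app (At (Over ?S) (x, p)) z)"
          unfolding z(3) app_Sym_arr[OF phi x z(1,2)] unfolding i(3) app_Sym_mult[OF x i(1,2) z(2)]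
          using r i(1,2) z(2) by blast
      qed
    qed
    finally show "?c ?mu (x, p) = ?c ?S (x, p) \<longleftrightarrow> ?r" .
  qed
  also have "\<dots> \<longleftrightarrow> ?law"
  proof -
    have "p \<in> words" if "n \<in> Hom (sM C) r p" for n r p using sM.Hom_Ob(2)[OF that] by simp
    then show ?thesis by blast
  qed
  finally show ?thesis .
qed

lemma alg_arr_Hom: "alg_arr \<phi> \<in> Hom Gph (C, Sym C A) (C, A) \<longleftrightarrow> \<phi> \<in> Hom (fun_cat (gcat C) Set_cat) (Sym C A) A"
  using Gph_Ob comp_ftr_id_right[OF A_functor] id_functor[OF category_axioms]
  by (simp add: Gph_Hom_iff alg_arr_def gbase_id)

end

lemma GphS_Ob_iff: "((C, A), h) \<in> Ob GphS \<longleftrightarrow> (C, A) \<in> Ob Gph \<and> h \<in> Hom Gph (C, Sym C A) (C, A) \<and>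
    Comp Gph h (Sym_unit (C, A)) = Ide Gph (C, A) \<and> Comp Gph h (Sym_mult (C, A)) = Comp Gph h (Sym_arr h)"
  unfolding GphS_def em_cat_def Let_def Sym_ftr_def
  by (auto simp del: Gph_simps(1) dest: HomD(1))

text \<open>
  The unit law forces the structure map to lie over the identity functor; naturality and the
  two laws say that \<open>a \<mapsto> [a, m]\<close> followed by the structure map is a functorial action of the arrows \<open>m\<close>.
\<close>

lemma algebra_sym_action:
  assumes "((C, A), h) \<in> Ob GphS"
  shows "sym_action C A (Over h)
    (\<lambda>x m a. app (At (Over h) (x, Cod (sM C) m)) (cls (symP C A x (Cod (sM C) m)) (Dom (sM C) m, a, m)))"
proof -
  have h: "(C, A) \<in> Ob Gph" "h \<in> Hom Gph (C, Sym C A) (C, A)" "Comp Gph h (Sym_unit (C, A)) = Ide Gph (C, A)"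
    "Comp Gph h (Sym_mult (C, A)) = Comp Gph h (Sym_arr h)"
    using assms by (simp_all only: GphS_Ob_iff)
  interpret graph C A
    using h(1) by (simp add: small_cats_iff graph_def graph_axioms_def)
  have u: "is_functor C C (Base h)" using h(2) by (simp add: Gph_Hom_iff)
  have "Base (Comp Gph h (Sym_unit (C, A))) = comp_ftr C (Base h) (id_ftr C)"
    using h(2) by (simp add: Gph_def Let_def Sym_unit_def split_beta)
  moreover have "Base (Ide Gph (C, A)) = id_ftr C" by (simp add: Gph_def Let_def)
  ultimately have b: "Base h = id_ftr C" using h(3) comp_ftr_id_right[OF u] by simp
  define \<phi> where "\<phi> = Over h"
  have hphi: "h = alg_arr \<phi>" using h(2) b by (intro farr_eqI) (simp_all add: alg_arr_def Gph_Hom_iff \<phi>_def)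
  have phi: "\<phi> \<in> Hom (fun_cat (gcat C) Set_cat) (Sym C A) A" using h(2) alg_arr_Hom unfolding hphi by simp
  have unit: "app (At \<phi> (x, p)) (cls (symP C A x p) (p, a, Ide (sM C) p)) = a"
    if "x \<in> Ob C" "p \<in> words" "a \<in> FOb A (x, p)" for x p a
    using h(3) that unfolding hphi unit_law_iff[OF phi] by blast
  have mult: "app (At \<phi> (x, p)) (cls (symP C A x p) (q, a, Comp (sM C) n m)) =
      app (At \<phi> (x, p)) (cls (symP C A x p) (r, app (At \<phi> (x, r)) (cls (symP C A x r) (q, a, m)), n))"
    if "x \<in> Ob C" "a \<in> FOb A (x, q)" "m \<in> Hom (sM C) q r" "n \<in> Hom (sM C) r p" for x q r p a m n
    using h(4) that unfolding hphi mult_law_iff[OF phi] by blast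
  define act where "act = (\<lambda>x m a. app (At \<phi> (x, Cod (sM C) m)) (cls (symP C A x (Cod (sM C) m)) (Dom
    (sM C) m, a, m)))"
  have act: "act x m a = app (At \<phi> (x, p)) (cls (symP C A x p) (q, a, m))" if "m \<in> Hom (sM C) q p"
    for x m a q p
    using HomD[OF that] by (simp add: act_def)
  have s: "cls (symP C A x p) (q, a, m) \<in> FOb (Sym C A) (x, p)"
    if "x \<in> Ob C" "a \<in> FOb A (x, q)" "m \<in> Hom (sM C) q p" for x q p a m
    using cls_in_quot[OF sym_GenI[OF that(2,3)]] Sym_FOb[OF that(1)] sM.Hom_Ob(2)[OF that(3)] by simp
  have "sym_action C A \<phi> act"
  proof
    fix x m q p a assume g: "x \<in> Ob C" "m \<in> Hom (sM C) q p" "a \<in> FOb A (x, q)"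
    have p: "p \<in> words" using sM.Hom_Ob(2)[OF g(2)] by simp
    show "act x m a \<in> FOb A (x, p)" unfolding act[OF g(2)] by (rule phi_in[OF phi g(1) p s[OF g(1,3,2)]])
    show "app (At \<phi> (x, p)) (cls (symP C A x p) (q, a, m)) = act x m a" unfolding act[OF g(2)] ..
    fix n r assume n: "n \<in> Hom (sM C) p r"
    show "act x (Comp (sM C) n m) a = act x n (act x m a)"
      unfolding act[OF sM.Comp_Hom[OF g(2) n]] act[OF g(2)] act[OF n] by (rule mult[OF g(1,3,2) n])
  next
    fix x p a assume g: "x \<in> Ob C" "p \<in> words" "a \<in> FOb A (x, p)"
    then show "act x (Ide (sM C) p) a = a" using unit[OF g] act[OF sM.Ide_Hom[of p]] by simp
  next
    fix x v q p a assume g: "x \<in> Ob C" "v \<in> Hom (M C) q p" "a \<in> FOb A (x, q)"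
    have p: "p \<in> words" using M.Hom_Ob(2)[OF g(2)] by simp
    \<comment> \<open>\<open>[a, v] = [v \<cdot> a, 1]\<close>, and the unit law evaluates the right-hand side.\<close>
    have "(cls (symP C A x p) (q, a, incl v) :: 'a) = cls (symP C A x p) (p, ract C A x v a, Ide (sM C) p)"
      using sym_rel[OF g sM.Ide_Hom[of p]] sM.Comp_Ide_left[OF incl_Hom[OF g(2)]] p by simp
    then show "act x (incl v) a = ract C A x v a"
      unfolding act[OF incl_Hom[OF g(2)]] using unit[OF g(1) p ract_in[OF g]] by simp
  next
    fix f x y m q p a assume g: "f \<in> Hom C x y" "m \<in> Hom (sM C) q p" "a \<in> FOb A (y, q)"
    have p: "p \<in> words" using sM.Hom_Ob(2)[OF g(2)] by simp
    show "lact C A f p (act y m a) = act x m (lact C A f q a)"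
      using phi_nat[OF phi g(1) word_Ide[OF p] s[OF Hom_Ob(2)[OF g(1)] g(3,2)]]
        app_Sym[OF g(1) word_Ide[OF p] g(3,2)] sM.Comp_Ide_left[OF g(2)]
      unfolding act[OF g(2)] lact_def incl_Ide by simp
  qed
  then show ?thesis unfolding \<phi>_def act_def .
qed

lemma (in sym_action) algebra:
  assumes "\<phi> \<in> Hom (fun_cat (gcat C) Set_cat) (Sym C A) A"
  shows "((C, A), alg_arr \<phi>) \<in> Ob GphS"
  unfolding GphS_Ob_iff alg_arr_Hom unit_law_iff[OF assms] mult_law_iff[OF assms]
proof (intro conjI ballI allI impI Gph_Ob assms)
  fix x p a assume g: "x \<in> Ob C" "p \<in> words" "a \<in> FOb A (x, p)"
  then show "app (At \<phi> (x, p)) (cls (symP C A x p) (p, a, Ide (sM C) p)) = a"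
    using phi_act[OF g(1) sM.Ide_Hom[of p] g(3)] act_Ide[OF g] by simp
next
  fix x q r p a m n assume g: "x \<in> Ob C" "a \<in> FOb A (x, q)" "m \<in> Hom (sM C) q r" "n \<in> Hom (sM C) r p"
  show "app (At \<phi> (x, p)) (cls (symP C A x p) (q, a, Comp (sM C) n m)) =
      app (At \<phi> (x, p)) (cls (symP C A x p) (r, app (At \<phi> (x, r)) (cls (symP C A x r) (q, a, m)), n))"
    unfolding phi_act[OF g(1,3,2)] phi_act[OF g(1,4) act_in[OF g(1,3,2)]]
      phi_act[OF g(1) sM.Comp_Hom[OF g(3,4)] g(2)] by (rule act_Comp[OF g(1,3,4,2)])
qed

section \<open>Endofunctors over varying categories\<close>

lemma EndDFib_simps [simp]:
  "Ob EndDFib = {(C, P). C \<in> small_cats \<and> is_functor (PSh C) (PSh C) P}"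
  "Dom EndDFib = Src" "Cod EndDFib = Tgt"
  by (simp_all add: EndDFib_def Let_def)

lemma EndDFib_Hom_iff: "k \<in> Hom EndDFib (C, P) (D, P') \<longleftrightarrow>
    (C, P) \<in> Ob EndDFib \<and> (D, P') \<in> Ob EndDFib \<and> Src k = (C, P) \<and> Tgt k = (D, P') \<and> is_functor C D (Base k) \<and>
    Over k \<in> Hom (fun_cat (PSh D) (PSh C)) (comp_ftr (PSh D) P (reindex C D (Base k))) (comp_ftr (PSh D)
      (reindex C D (Base k)) P')"
proof -
  have "k \<in> Ar EndDFib \<longleftrightarrow> (\<exists>C P D P' u \<alpha>. k = \<lparr>Src = (C, P), Tgt = (D, P'), Base = u, Over = \<alpha>\<rparr> \<and>
     (C, P) \<in> Ob EndDFib \<and> (D, P') \<in> Ob EndDFib \<and> is_functor C D u \<and>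
     \<alpha> \<in> Hom (fun_cat (PSh D) (PSh C)) (comp_ftr (PSh D) P (reindex C D u)) (comp_ftr (PSh D)
       (reindex C D u) P'))"
    by (auto simp: EndDFib_def Let_def)
  then show ?thesis unfolding Hom_def[of EndDFib] by (cases k) auto
qed

lemma EndDFib_Comp:
  assumes "Src a = (C, P)" "Tgt a = (D, P')" "Tgt b = (E, P'')"
  shows "Comp EndDFib b a = \<lparr>Src = (C, P), Tgt = (E, P''), Base = comp_ftr C (Base b) (Base a),
    Over = \<lparr>NDom = comp_ftr (PSh E) P (reindex C E (comp_ftr C (Base b) (Base a))),
            NCod = comp_ftr (PSh E) (reindex C E (comp_ftr C (Base b) (Base a))) P'',
            At = (\<lambda>X\<in>Ob (PSh E). Comp (PSh C) (FAr (reindex C D (Base a)) (At (Over b) X))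
                                       (At (Over a) (FOb (reindex D E (Base b)) X)))\<rparr>\<rparr>"
  using assms by (simp add: EndDFib_def Let_def del: PSh_simps)

lemma EndDFib_Ide: "Ide EndDFib (C, P) = \<lparr>Src = (C, P), Tgt = (C, P), Base = id_ftr C,
    Over = Ide (fun_cat (PSh C) (PSh C)) P\<rparr>"
  by (simp add: EndDFib_def Let_def)

lemma reindex_FOb: "X \<in> Ob (PSh D) \<Longrightarrow> FOb (reindex C D u) X = comp_ftr (op_cat C) X u"
  by (simp add: reindex_def)

lemma reindex_At: "\<alpha> \<in> Hom (PSh D) X Y \<Longrightarrow> x \<in> Ob C \<Longrightarrow> At (FAr (reindex C D u) \<alpha>) x = At \<alpha> (FOb u x)"
  by (simp add: reindex_def Hom_def reindex_map_def)

lemma comp_ftr_psh [simp]: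
  "x \<in> Ob C \<Longrightarrow> FOb (comp_ftr (op_cat C) X u) x = FOb X (FOb u x)"
  "f \<in> Ar C \<Longrightarrow> FAr (comp_ftr (op_cat C) X u) f = FAr X (FAr u f)"
  by (simp_all add: comp_ftr_def compose_def)

lemma reindex_psh:
  assumes "category C" "is_functor C D u" "X \<in> Ob (PSh D)"
  shows "comp_ftr (op_cat C) X u \<in> Ob (PSh C)"
proof -
  interpret category C by fact
  interpret op: category "op_cat C" by (rule category_op_cat) fact
  have X: "is_functor (op_cat D) Set_cat X" using assms(3) by simp
  note u = is_functorD[OF assms(2)]
  have "is_functor (op_cat C) Set_cat (comp_ftr (op_cat C) X u)"
  proof (rule set_functorI[OF _ _ _ _ _ _ op.category_axioms])
    show "FOb (comp_ftr (op_cat C) X u) \<in> extensional (Ob (op_cat C))"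
      "FAr (comp_ftr (op_cat C) X u) \<in> extensional (Ar (op_cat C))" by (simp_all add: comp_ftr_def)
    show "small (FOb (comp_ftr (op_cat C) X u) x)" if "x \<in> Ob (op_cat C)" for x
      using that pshD(1)[OF X u(3)] by simp
    show "FAr (comp_ftr (op_cat C) X u) f \<in> Hom Set_cat (FOb (comp_ftr (op_cat C) X u) x) (FOb (comp_ftr
      (op_cat C) X u) y)"
      if "f \<in> Hom (op_cat C) x y" for f x y
      using that op.Hom_Ob[OF that] is_functorD(4)[OF X, of "FAr u f" "FOb u x" "FOb u y"] u(4)[of f y x]
      by (simp add: HomD(1)[of f C y x])
    show "app (FAr (comp_ftr (op_cat C) X u) (Ide (op_cat C) x)) a = a"
      if "x \<in> Ob (op_cat C)" "a \<in> FOb (comp_ftr (op_cat C) X u) x" for x a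
      using that pshD(3)[OF X u(3), of x a] HomD(1)[OF Ide_Hom, of x] u(5)[of x] by simp
    show "app (FAr (comp_ftr (op_cat C) X u) (Comp (op_cat C) g f)) a
      = app (FAr (comp_ftr (op_cat C) X u) g) (app (FAr (comp_ftr (op_cat C) X u) f) a)"
      if f: "f \<in> Hom (op_cat C) x y" and g: "g \<in> Hom (op_cat C) y z"
        and a: "a \<in> FOb (comp_ftr (op_cat C) X u) x"
      for f g x y z a
    proof -
      have h: "f \<in> Hom C y x" "g \<in> Hom C z y" "x \<in> Ob C" using f g op.Hom_Ob[OF f] by simp_all
      show ?thesis
        using pshD(4)[OF X u(4)[OF h(1)] u(4)[OF h(2)], of a] a h u(6)[OF h(2,1)]
          HomD(1)[OF h(1)] HomD(1)[OF h(2)] HomD(1)[OF Comp_Hom[OF h(2,1)]] by simp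
    qed
  qed
  then show ?thesis by simp
qed

lemma reindex_map_Hom:
  assumes "category C" "category D" "is_functor C D u" "\<alpha> \<in> Hom (PSh D) X Y"
  shows "FAr (reindex C D u) \<alpha> \<in> Hom (PSh C) (comp_ftr (op_cat C) X u) (comp_ftr (op_cat C) Y u)"
proof -
  interpret category C by fact
  have XY: "X \<in> Ob (PSh D)" "Y \<in> Ob (PSh D)" "\<alpha> \<in> Ar (PSh D)" "NDom \<alpha> = X" "NCod \<alpha> = Y"
    using category.Hom_Ob[OF category_PSh assms(4)] HomD[OF assms(4)] assms(2) by auto
  note u = is_functorD[OF assms(3)]
  have F: "is_functor (op_cat C) Set_cat (comp_ftr (op_cat C) X u)"
    "is_functor (op_cat C) Set_cat (comp_ftr (op_cat C) Y u)"
    using reindex_psh[OF assms(1,3)] XY by (simp_all only: PSh_simps mem_Collect_eq)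
  show ?thesis unfolding PSh_Hom
  proof (rule set_ntrI[OF F _ _ _ _ _ category_op_cat[OF assms(1)]])
    show "NDom (FAr (reindex C D u) \<alpha>) = comp_ftr (op_cat C) X u"
      "NCod (FAr (reindex C D u) \<alpha>) = comp_ftr (op_cat C) Y u"
      "At (FAr (reindex C D u) \<alpha>) \<in> extensional (Ob (op_cat C))"
      using XY by (simp_all add: reindex_def reindex_map_def)
    show "At (FAr (reindex C D u) \<alpha>) x \<in> Hom Set_cat (FOb (comp_ftr (op_cat C) X u) x) (FOb (comp_ftr
      (op_cat C) Y u) x)"
      if "x \<in> Ob (op_cat C)" for x
      using that assms(4) u(3) by (simp add: reindex_At[OF assms(4)] PSh_Hom ntr_Hom_iff)
    show "app (At (FAr (reindex C D u) \<alpha>) y) (app (FAr (comp_ftr (op_cat C) X u) f) a)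
      = app (FAr (comp_ftr (op_cat C) Y u) f) (app (At (FAr (reindex C D u) \<alpha>) x) a)"
      if f: "f \<in> Hom (op_cat C) x y" and a: "a \<in> FOb (comp_ftr (op_cat C) X u) x" for f x y a
    proof -
      have h: "f \<in> Hom C y x" "x \<in> Ob C" "y \<in> Ob C" using f Hom_Ob[of f y x] by simp_all
      show ?thesis
        using psh_ntrD(2)[OF assms(4) u(4)[OF h(1)] u(3)[OF h(2)], of a] a h HomD(1)[OF h(1)]
        by (simp add: reindex_At[OF assms(4)])
    qed
  qed
qed

text \<open>
  Reindexing along an identity is strictly the identity, as presheaves and their maps are extensional.
\<close>

lemma reindex_id: assumes "category C" shows "reindex C C (id_ftr C) = id_ftr (PSh C)"
proof (rule functor_eqI[where C = "PSh C"])
  have X: "comp_ftr (op_cat C) X (id_ftr C) = X" if "is_functor (op_cat C) Set_cat X" for X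
    using comp_ftr_id_right[OF that] by (simp add: id_ftr_def)
  then show "FOb (reindex C C (id_ftr C)) X = FOb (id_ftr (PSh C)) X" if "X \<in> Ob (PSh C)" for X
    using that by (simp add: reindex_def)
  show "FAr (reindex C C (id_ftr C)) \<alpha> = FAr (id_ftr (PSh C)) \<alpha>" if a: "\<alpha> \<in> Ar (PSh C)" for \<alpha>
  proof -
    note h = Ar_Hom[OF a]
    have XY: "is_functor (op_cat C) Set_cat (Dom (PSh C) \<alpha>)" "is_functor (op_cat C) Set_cat (Cod (PSh C) \<alpha>)"
      using category.Hom_Ob[OF category_PSh[OF assms] h] by simp_all
    have "FAr (reindex C C (id_ftr C)) \<alpha> = \<alpha>"
      by (rule psh_map_eqI[OF reindex_map_Hom[OF assms assms id_functor[OF assms] h, unfolded X[OF XY(1)]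
        X[OF XY(2)]] h])
        (simp add: reindex_At[OF h])
    then show ?thesis using a by simp
  qed
qed (simp_all add: reindex_def id_ftr_def)

section \<open>Comparison of the two quotients\<close>

lemma quotients_bij:
  assumes "g ` G = A" "h ` G = B" "\<And>t t'. t \<in> G \<Longrightarrow> t' \<in> G \<Longrightarrow> g t = g t' \<longleftrightarrow> h t = h t'"
  shows "bij_betw (\<lambda>z. h (inv_into G g z)) A B" and "t \<in> G \<Longrightarrow> h (inv_into G g (g t)) = h t"
proof -
  have i: "inv_into G g (g t) \<in> G" "g (inv_into G g (g t)) = g t" if "t \<in> G" for t
    using that by (auto intro: inv_into_into f_inv_into_f)
  show e: "h (inv_into G g (g t)) = h t" if "t \<in> G" for t
    using i[OF that] that assms(3) by blast
  show "bij_betw (\<lambda>z. h (inv_into G g z)) A B"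
    unfolding bij_betw_def
  proof
    show "inj_on (\<lambda>z. h (inv_into G g z)) A"
      using e assms(3) by (auto simp: inj_on_def assms(1)[symmetric])
    show "(\<lambda>z. h (inv_into G g z)) ` A = B"
      unfolding assms(1,2)[symmetric] image_image using e by (intro image_cong) auto
  qed
qed

definition inverse_functors :: "'u scat \<Rightarrow> 'u scat \<Rightarrow> 'u sftr \<Rightarrow> 'u sftr \<Rightarrow> bool" where
  "inverse_functors C D u v \<longleftrightarrow> is_functor C D u \<and> is_functor D C v \<and>
     (\<forall>x\<in>Ob D. FOb u (FOb v x) = x) \<and> (\<forall>f\<in>Ar D. FAr u (FAr v f) = f) \<and>
     (\<forall>x\<in>Ob C. FOb v (FOb u x) = x) \<and> (\<forall>f\<in>Ar C. FAr v (FAr u f) = f)"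

text \<open>
  The same action in two forms: on a graph over \<open>C\<close>, and as a functor on \<open>sM D\<close>, where \<open>D\<close> is isomorphic
  to \<open>C\<close>. With \<open>u\<close> and \<open>v\<close> identities this relates a functor on \<open>sM C\<close> to its graph; the general form
  serves for isomorphisms of endofunctors over different base categories.
\<close>

locale species_of_action = sym_action C A \<phi> act + D: species D F
  for C :: "'u::set_universe scat" and A \<phi> act and D :: "'u scat" and F +
  fixes u v :: "'u sftr"
  assumes inverse: "inverse_functors C D u v"
    and F_FOb: "\<And>p x. p \<in> lists (Ob D) \<Longrightarrow> x \<in> Ob D \<Longrightarrow> FOb (FOb F p) x = FOb A (FOb v x, map (FOb v) p)"
    and F_lact: "\<And>p f x y a. p \<in> lists (Ob D) \<Longrightarrow> f \<in> Hom D x y \<Longrightarrow> a \<in> FOb A (FOb v y, map (FOb v) p) \<Longrightarrow>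
      app (FAr (FOb F p) f) a = lact C A (FAr v f) (map (FOb v) p) a"
    and F_act: "\<And>m q p x a. m \<in> Hom (sM D) q p \<Longrightarrow> x \<in> Ob D \<Longrightarrow> a \<in> FOb A (FOb v x, map (FOb v) q) \<Longrightarrow>
      app (At (FAr F m) x) a = act (FOb v x) (sM_map v m) a"
begin

lemma u: "is_functor C D u" and v: "is_functor D C v"
  and uv: "x \<in> Ob D \<Longrightarrow> FOb u (FOb v x) = x" "f \<in> Ar D \<Longrightarrow> FAr u (FAr v f) = f"
  and vu: "y \<in> Ob C \<Longrightarrow> FOb v (FOb u y) = y" "g \<in> Ar C \<Longrightarrow> FAr v (FAr u g) = g"
  using inverse by (simp_all add: inverse_functors_def)

abbreviation "pull X \<equiv> comp_ftr (op_cat C) X u"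

definition pull_gen :: "'u list \<times> 'u \<times> 'u list \<Rightarrow> 'u list \<times> 'u \<times> 'u list" where
  "pull_gen = (\<lambda>(p, a, xs). (map (FOb v) p, a, xs))"

lemma v_words: "p \<in> lists (Ob D) \<Longrightarrow> map (FOb v) p \<in> words"
  using is_functorD(3)[OF v] by auto

lemma map_uv: "p \<in> lists (Ob D) \<Longrightarrow> map (FOb u) (map (FOb v) p) = p"
  and map_vu: "p \<in> words \<Longrightarrow> map (FOb v) (map (FOb u) p) = p"
  by (auto intro!: map_idI simp: uv vu)

lemma sM_map_uv: "m \<in> Hom (sM D) q p \<Longrightarrow> sM_map u (sM_map v m) = m"
  and sM_map_vu: "n \<in> Hom (sM C) r s \<Longrightarrow> sM_map v (sM_map u n) = n"
  by (auto simp: sM_map_def Hom_def sM_def uv vu intro!: map_idI split: prod.splits)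

lemma pull_psh: "X \<in> Ob (PSh D) \<Longrightarrow> pull X \<in> Ob (PSh C)"
  by (rule reindex_psh[OF category_axioms u])

lemma pow_pull: "p \<in> words \<Longrightarrow> pow (pull X) p = pow X (map (FOb u) p)"
  by (auto simp: pow_iff Ob_M_iff)

lemma pow_act_pull: "m \<in> Hom (sM C) q p \<Longrightarrow> pow_act (pull X) m xs = pow_act X (sM_map u m) xs"
proof -
  assume m: "m \<in> Hom (sM C) q p"
  obtain \<sigma> w where e: "m = (\<sigma>, w)" by (metis surj_pair)
  then have "w \<in> lists (Ar C)" using m by (simp add: Hom_def sM_def)
  then show ?thesis by (auto simp: e pow_act_def sM_map_def list_eq_iff_nth_eq Ob_M_iff)
qed

context fixes X x assumes X: "X \<in> Ob (PSh D)" and x: "x \<in> Ob D"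
begin

lemma vx: "FOb v x \<in> Ob C" using is_functorD(3)[OF v x] .

text \<open>
  As \<open>u\<close> is inverse to \<open>v\<close>, the power of \<open>u\<^sup>*X\<close> at \<open>v p\<close> is the power of \<open>X\<close> at \<open>p\<close>; so the generators
  correspond by applying \<open>v\<close> to the sequence alone.
\<close>

lemma Gen_pull: "Gen (starP C A (pull X) (FOb v x)) = pull_gen ` Gen (lanP D F X x)"
proof (intro equalityI subsetI)
  fix t assume "t \<in> Gen (starP C A (pull X) (FOb v x))"
  then obtain p a xs where t: "t = (p, a, xs)" "p \<in> words" "a \<in> FOb A (FOb v x, p)" "xs \<in> pow (pull X) p"
    by (auto simp: Gen_starP[OF pull_psh[OF X]] simp del: in_lists_conv_set)
  have up: "map (FOb u) p \<in> lists (Ob D)" using t(2) is_functorD(3)[OF u] by auto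
  then have "(map (FOb u) p, a, xs) \<in> Gen (lanP D F X x)"
    using t F_FOb[OF up x] map_vu[OF t(2)] pow_pull[OF t(2)] by (intro D.lan_GenI[OF X x up]) simp_all
  moreover have "t = pull_gen (map (FOb u) p, a, xs)" unfolding t(1) pull_gen_def prod.case map_vu[OF t(2)] ..
  ultimately show "t \<in> pull_gen ` Gen (lanP D F X x)" by blast
next
  fix t assume "t \<in> pull_gen ` Gen (lanP D F X x)"
  then obtain p a xs where t: "t = (map (FOb v) p, a, xs)" "p \<in> lists (Ob D)" "a \<in> FOb (FOb F p) x"
    "xs \<in> pow X p"
    by (auto simp: D.Gen_lanP[OF X x] pull_gen_def simp del: in_lists_conv_set)
  show "t \<in> Gen (starP C A (pull X) (FOb v x))"
    unfolding t(1) using F_FOb[OF t(2) x] t(3,4) map_uv[OF t(2)]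
    by (intro star_GenI[OF pull_psh[OF X] v_words[OF t(2)]])
      (simp_all only: pow_pull[OF v_words[OF t(2)]])
qed

lemma rdd_cls_surj: "(rdd_cls (pull X) (FOb v x) \<circ> pull_gen) ` Gen (lanP D F X x)
  = quot (rddP C A \<phi> (pull X) (FOb v x))"
  unfolding rdd_surj[OF pull_psh[OF X] vx] Gen_pull by (simp add: image_comp)

text \<open>
  The heart of the comparison. The relation of the Kan extension for \<open>m\<close> is carried to the one in
  \<open>rdd_rel\<close> for \<open>v m\<close>; conversely each \<open>m\<close> over \<open>C\<close> is \<open>v (u m)\<close>, so the class in the Kan extension, as a
  function of the generator, respects the relations of the coequalizer and \<open>rdd_lift\<close> applies.
\<close>

lemma cls_lan_iff:
  assumes t: "t \<in> Gen (lanP D F X x)" "t' \<in> Gen (lanP D F X x)"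
  shows "(rdd_cls (pull X) (FOb v x) \<circ> pull_gen) t = (rdd_cls (pull X) (FOb v x) \<circ> pull_gen) t'
    \<longleftrightarrow> (cls (lanP D F X x) t :: 'u) = cls (lanP D F X x) t'"
proof
  assume e: "(cls (lanP D F X x) t :: 'u) = cls (lanP D F X x) t'"
  show "(rdd_cls (pull X) (FOb v x) \<circ> pull_gen) t = (rdd_cls (pull X) (FOb v x) \<circ> pull_gen) t'"
  proof (rule D.lan_lift[OF X x _ e t])
    fix m q p c xs assume h: "m \<in> Hom (sM D) q p" "c \<in> FOb (FOb F q) x" "xs \<in> pow X p"
    have w: "p \<in> lists (Ob D)" "q \<in> lists (Ob D)" using D.sM.Hom_Ob[OF h(1)] by simp_all
    have m: "sM_map v m \<in> Hom (sM C) (map (FOb v) q) (map (FOb v) p)" by (rule sM_map_Hom[OF v h(1)])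
    have c: "c \<in> FOb A (FOb v x, map (FOb v) q)" using h(2) F_FOb[OF w(2) x] by simp
    have xs: "xs \<in> pow (pull X) (map (FOb v) p)" unfolding pow_pull[OF v_words[OF w(1)]] map_uv[OF w(1)]
      by (rule h(3))
    show "(rdd_cls (pull X) (FOb v x) \<circ> pull_gen) (q, c, pow_act X m xs) =
      (rdd_cls (pull X) (FOb v x) \<circ> pull_gen) (p, app (At (FAr F m) x) c, xs)"
      using rdd_rel[OF pull_psh[OF X] vx m c xs] pow_act_pull[OF m] sM_map_uv[OF h(1)] F_act[OF h(1) x c]
      by (simp add: pull_gen_def)
  qed
next
  assume e: "(rdd_cls (pull X) (FOb v x) \<circ> pull_gen) t = (rdd_cls (pull X) (FOb v x) \<circ> pull_gen) t'"
  let ?k = "\<lambda>(p, a, xs). cls (lanP D F X x) (map (FOb u) p, a, xs) :: 'u"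
  have k: "?k (pull_gen t) = cls (lanP D F X x) t" if g: "t \<in> Gen (lanP D F X x)" for t
  proof -
    obtain p a xs where t: "t = (p, a, xs)" "p \<in> lists (Ob D)"
      using g by (auto simp: D.Gen_lanP[OF X x] simp del: in_lists_conv_set)
    show ?thesis unfolding t(1) pull_gen_def prod.case map_uv[OF t(2)] ..
  qed
  have g: "pull_gen t \<in> Gen (starP C A (pull X) (FOb v x))" "pull_gen t' \<in> Gen (starP C A (pull X) (FOb v x))"
    unfolding Gen_pull using t by blast+
  have "?k (pull_gen t) = ?k (pull_gen t')"
  proof (rule rdd_lift[OF pull_psh[OF X] vx _ _ g])
    fix m q p a xs assume h: "m \<in> Hom (sM C) q p" "a \<in> FOb A (FOb v x, q)" "xs \<in> pow (pull X) p"
    have w: "p \<in> words" "q \<in> words" using sM.Hom_Ob[OF h(1)] by simp_all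
    have uq: "map (FOb u) q \<in> lists (Ob D)" using w(2) is_functorD(3)[OF u] by auto
    note m = sM_map_Hom[OF u h(1)]
    have a: "a \<in> FOb A (FOb v x, map (FOb v) (map (FOb u) q))" unfolding map_vu[OF w(2)] by (rule h(2))
    have a': "a \<in> FOb (FOb F (map (FOb u) q)) x" unfolding F_FOb[OF uq x] by (rule a)
    show "?k (q, a, pow_act (pull X) m xs) = ?k (p, act (FOb v x) m a, xs)"
      using D.lan_rel[OF X x m a' h(3)[unfolded pow_pull[OF w(1)]]] pow_act_pull[OF h(1)]
        F_act[OF m x a] sM_map_vu[OF h(1)] by simp
  qed (use e in simp)
  then show "(cls (lanP D F X x) t :: 'u) = cls (lanP D F X x) t'" using k t by simp
qed

lemma pull_genI:
  assumes "p \<in> lists (Ob D)" "c \<in> FOb (FOb F p) x" "xs \<in> pow X p"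
  shows "map (FOb v) p \<in> words" "c \<in> FOb A (FOb v x, map (FOb v) p)" "xs \<in> pow (pull X) (map (FOb v) p)"
  using assms v_words[OF assms(1)] F_FOb[OF assms(1) x] pow_pull[OF v_words[OF assms(1)]] map_uv[OF assms(1)]
  by simp_all

end

lemma rdd_cls_act:
  assumes X: "X \<in> Ob (PSh D)" and f: "f \<in> Hom D x y"
    and t: "p \<in> lists (Ob D)" "c \<in> FOb (FOb F p) y" "xs \<in> pow X p"
  shows "app (FAr (FOb (rdd C A \<phi>) (pull X)) (FAr v f)) (rdd_cls (pull X) (FOb v y) (pull_gen (p, c, xs)))
    = rdd_cls (pull X) (FOb v x) (pull_gen (p, app (FAr (FOb F p) f) c, xs))"
  using rdd_act[OF pull_psh[OF X] is_functorD(4)[OF v f] pull_genI[OF X D.Hom_Ob(2)[OF f] t]]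
    F_lact[OF t(1) f pull_genI(2)[OF X D.Hom_Ob(2)[OF f] t]] by (simp add: pull_gen_def)

lemma pow_map_pull:
  assumes "\<alpha> \<in> Hom (PSh D) X Y" "p \<in> lists (Ob D)" "xs \<in> pow X p"
  shows "pow_map (FAr (reindex C D u) \<alpha>) (map (FOb v) p) xs = pow_map \<alpha> p xs"
  using assms(2,3) is_functorD(3)[OF v]
  by (auto simp: pow_map_def list_eq_iff_nth_eq pow_iff reindex_At[OF assms(1)] uv Ob_M_iff
      simp del: in_lists_conv_set)

lemma rdd_cls_map:
  assumes al: "\<alpha> \<in> Hom (PSh D) X Y" and x: "x \<in> Ob D"
    and t: "p \<in> lists (Ob D)" "c \<in> FOb (FOb F p) x" "xs \<in> pow X p"
  shows "app (At (FAr (rdd C A \<phi>) (FAr (reindex C D u) \<alpha>)) (FOb v x)) (rdd_cls (pull X) (FOb v x)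
    (pull_gen (p, c, xs)))
    = rdd_cls (pull Y) (FOb v x) (pull_gen (p, c, pow_map \<alpha> p xs))"
proof -
  have X: "X \<in> Ob (PSh D)" using category.Hom_Ob[OF category_PSh[OF D.category_axioms] al] by simp
  show ?thesis
    using rdd_map[OF reindex_map_Hom[OF category_axioms D.category_axioms u al] vx[OF X x]
      pull_genI[OF X x t]]
      pow_map_pull[OF al t(1,3)] by (simp add: pull_gen_def)
qed

definition comparison :: "'u psh \<Rightarrow> 'u \<Rightarrow> 'u \<Rightarrow> 'u" where
  "comparison X x z =
     rdd_cls (pull X) (FOb v x) (pull_gen (inv_into (Gen (lanP D F X x)) (cls (lanP D F X x)) z))"

lemma comparison_bij:
  assumes "X \<in> Ob (PSh D)" "x \<in> Ob D"
  shows "bij_betw (comparison X x) (FOb (FOb (lan D F) X) x) (FOb (FOb (rdd C A \<phi>) (pull X)) (FOb v x))"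
    and "t \<in> Gen (lanP D F X x) \<Longrightarrow>
      comparison X x (cls (lanP D F X x) t) = rdd_cls (pull X) (FOb v x) (pull_gen t)"
  unfolding D.lan_FOb[OF assms] rdd_FOb[OF pull_psh[OF assms(1)] vx[OF assms]] comparison_def
  using quotients_bij[OF quot_def[symmetric] rdd_cls_surj[OF assms] cls_lan_iff[OF assms, symmetric]]
  by (simp_all add: comp_def)

lemma lanE:
  assumes "X \<in> Ob (PSh D)" "x \<in> Ob D" "z \<in> FOb (FOb (lan D F) X) x"
  obtains p c xs where "p \<in> lists (Ob D)" "c \<in> FOb (FOb F p) x" "xs \<in> pow X p"
    "z = cls (lanP D F X x) (p, c, xs)"
  using assms(3) unfolding D.lan_FOb[OF assms(1,2)]
  by (elim quotE) (auto simp: D.Gen_lanP[OF assms(1,2)] simp del: in_lists_conv_set)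

lemma comparison_act:
  assumes X: "X \<in> Ob (PSh D)" and f: "f \<in> Hom D x y" and z: "z \<in> FOb (FOb (lan D F) X) y"
  shows "app (FAr (FOb (lan D F) X) f) z \<in> FOb (FOb (lan D F) X) x"
    and "comparison X x (app (FAr (FOb (lan D F) X) f) z)
      = app (FAr (FOb (rdd C A \<phi>) (pull X)) (FAr v f)) (comparison X y z)"
proof -
  note x = D.Hom_Ob(1)[OF f] and y = D.Hom_Ob(2)[OF f]
  obtain p c xs where t: "p \<in> lists (Ob D)" "c \<in> FOb (FOb F p) y" "xs \<in> pow X p"
    and z: "z = cls (lanP D F X y) (p, c, xs)" by (rule lanE[OF X y z])
  note g = D.lan_GenI[OF X x t(1) pshD(2)[OF D.F_psh[OF t(1)] f t(2)] t(3)]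
  show "app (FAr (FOb (lan D F) X) f) z \<in> FOb (FOb (lan D F) X) x"
    unfolding z D.lan_act[OF X f t] D.lan_FOb[OF X x] by (rule cls_in_quot[OF g])
  show "comparison X x (app (FAr (FOb (lan D F) X) f) z)
      = app (FAr (FOb (rdd C A \<phi>) (pull X)) (FAr v f)) (comparison X y z)"
    unfolding z D.lan_act[OF X f t] comparison_bij(2)[OF X x g] comparison_bij(2)[OF X y D.lan_GenI[OF X y t]]
    by (rule rdd_cls_act[OF X f t, symmetric])
qed

lemma comparison_map:
  assumes al: "\<alpha> \<in> Hom (PSh D) X Y" and x: "x \<in> Ob D" and z: "z \<in> FOb (FOb (lan D F) X) x"
  shows "app (At (FAr (lan D F) \<alpha>) x) z \<in> FOb (FOb (lan D F) Y) x"
    and "comparison Y x (app (At (FAr (lan D F) \<alpha>) x) z)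
      = app (At (FAr (rdd C A \<phi>) (FAr (reindex C D u) \<alpha>)) (FOb v x)) (comparison X x z)"
proof -
  have X: "X \<in> Ob (PSh D)" and Y: "Y \<in> Ob (PSh D)"
    using category.Hom_Ob[OF category_PSh[OF D.category_axioms] al] by simp_all
  obtain p c xs where t: "p \<in> lists (Ob D)" "c \<in> FOb (FOb F p) x" "xs \<in> pow X p"
    and z: "z = cls (lanP D F X x) (p, c, xs)" by (rule lanE[OF X x z])
  note g = D.lan_GenI[OF Y x t(1,2) pow_map_pow[OF al t(1,3)]]
  show "app (At (FAr (lan D F) \<alpha>) x) z \<in> FOb (FOb (lan D F) Y) x"
    unfolding z D.lan_map[OF al x t] D.lan_FOb[OF Y x] by (rule cls_in_quot[OF g])
  show "comparison Y x (app (At (FAr (lan D F) \<alpha>) x) z)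
      = app (At (FAr (rdd C A \<phi>) (FAr (reindex C D u) \<alpha>)) (FOb v x)) (comparison X x z)"
    unfolding z D.lan_map[OF al x t] comparison_bij(2)[OF Y x g]
      comparison_bij(2)[OF X x D.lan_GenI[OF X x t]]
    by (rule rdd_cls_map[OF al x t, symmetric])
qed

end

section \<open>Algebras are represented by analytic endofunctors\<close>

text \<open>
  The functor on \<open>sM D\<close> given by an action over \<open>C\<close>, read through \<open>v\<close>.
\<close>

definition species_of :: "'u scat \<Rightarrow> 'u gph \<Rightarrow> ('u \<Rightarrow> 'u smarr \<Rightarrow> 'u \<Rightarrow> 'u) \<Rightarrow> 'u scat \<Rightarrow> 'u sftr \<Rightarrow> 'u smftr" where
  "species_of C A act D v =
     (let F = \<lambda>p. \<lparr>FOb = (\<lambda>x\<in>Ob D. FOb A (FOb v x, map (FOb v) p)),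
                   FAr = (\<lambda>f\<in>Ar D. sarr_of (FOb A (FOb v (Cod D f), map (FOb v) p)) (FOb A (FOb v
                     (Dom D f), map (FOb v) p))
                           (lact C A (FAr v f) (map (FOb v) p)))\<rparr>
      in \<lparr>FOb = restrict F (lists (Ob D)),
          FAr = (\<lambda>m\<in>Ar (sM D). \<lparr>NDom = F (Dom (sM D) m), NCod = F (Cod (sM D) m),
            At = (\<lambda>x\<in>Ob D. sarr_of (FOb A (FOb v x, map (FOb v) (Dom (sM D) m)))
                    (FOb A (FOb v x, map (FOb v) (Cod (sM D) m))) (act (FOb v x) (sM_map v m)))\<rparr>)\<rparr>)"

lemma sarr_of_Hom: "small A \<Longrightarrow> small B \<Longrightarrow> (\<And>a. a \<in> A \<Longrightarrow> k a \<in> B) \<Longrightarrow> sarr_of A B k \<in> Hom Set_cat A B"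
  by (simp add: Set_Hom_iff sarr_of_def)

context sym_action
begin

context fixes D :: "'u scat" and v assumes D: "small_category D" and v: "is_functor D C v"
begin

interpretation D: small_category D by (rule D)
interpretation sMD: category "sM D" by (rule category_sM[OF D.category_axioms])

abbreviation "F \<equiv> species_of C A act D v"

lemma v_word: "p \<in> lists (Ob D) \<Longrightarrow> map (FOb v) p \<in> words"
  using is_functorD(3)[OF v] by auto

lemma species_of_FOb: "p \<in> lists (Ob D) \<Longrightarrow> x \<in> Ob D \<Longrightarrow> FOb (FOb F p) x = FOb A (FOb v x, map (FOb v) p)"
  by (simp add: species_of_def)

lemma species_of_FAr:
  assumes "p \<in> lists (Ob D)" "f \<in> Hom D x y"
  shows "FAr (FOb F p) f = sarr_of (FOb (FOb F p) y) (FOb (FOb F p) x) (lact C A (FAr v f) (map (FOb v) p))"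
  using assms HomD[OF assms(2)] D.Hom_Ob[OF assms(2)] by (simp add: species_of_def)

lemma species_of_At:
  assumes "m \<in> Hom (sM D) q p" "x \<in> Ob D"
  shows "At (FAr F m) x = sarr_of (FOb (FOb F q) x) (FOb (FOb F p) x) (act (FOb v x) (sM_map v m))"
  using assms(2) HomD[OF assms(1)] sMD.Hom_Ob[OF assms(1)] by (simp add: species_of_def)

lemma species_of_psh:
  assumes p: "p \<in> lists (Ob D)" shows "is_functor (op_cat D) Set_cat (FOb F p)"
proof (rule set_functorI[OF _ _ _ _ _ _ category_op_cat[OF D.category_axioms]])
  note v' = is_functorD[OF v] and P = v_word[OF p] and S = species_of_FOb[OF p]
  show "FOb (FOb F p) \<in> extensional (Ob (op_cat D))" "FAr (FOb F p) \<in> extensional (Ar (op_cat D))"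
    using p by (simp_all add: species_of_def)
  show sm: "small (FOb (FOb F p) x)" if "x \<in> Ob (op_cat D)" for x
    using that gph_small[OF v'(3) P, of x] by (simp add: S)
  show "FAr (FOb F p) f \<in> Hom Set_cat (FOb (FOb F p) x) (FOb (FOb F p) y)" if f: "f \<in> Hom (op_cat D) x y"
    for f x y
  proof -
    have h: "f \<in> Hom D y x" "x \<in> Ob D" "y \<in> Ob D" using f D.Hom_Ob[of f y x] by simp_all
    show ?thesis unfolding species_of_FAr[OF p h(1)]
      using lact_in[OF v'(4)[OF h(1)] P] h sm by (intro sarr_of_Hom) (simp_all add: S)
  qed
  show "app (FAr (FOb F p) (Ide (op_cat D) x)) a = a" if "x \<in> Ob (op_cat D)" "a \<in> FOb (FOb F p) x" for x a
    using that species_of_FAr[OF p D.Ide_Hom, of x] lact_Ide[OF v'(3) P, of x a] v'(5)[of x] S[of x] by simp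
  show "app (FAr (FOb F p) (Comp (op_cat D) g f)) a = app (FAr (FOb F p) g) (app (FAr (FOb F p) f) a)"
    if f: "f \<in> Hom (op_cat D) x y" and g: "g \<in> Hom (op_cat D) y z" and a: "a \<in> FOb (FOb F p) x"
      for f g x y z a
  proof -
    have h: "f \<in> Hom D y x" "g \<in> Hom D z y" "x \<in> Ob D" "y \<in> Ob D" using f g D.Hom_Ob[of f y x] by simp_all
    have "a \<in> FOb A (FOb v x, map (FOb v) p)" using a S[OF h(3)] by simp
    then show ?thesis
      using lact_Comp[OF v'(4)[OF h(2)] v'(4)[OF h(1)] P] lact_in[OF v'(4)[OF h(1)] P] v'(6)[OF h(2,1)]
        S[OF h(3)] S[OF h(4)]
      by (simp add: species_of_FAr[OF p h(1)] species_of_FAr[OF p h(2)]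
        species_of_FAr[OF p D.Comp_Hom[OF h(2,1)]])
  qed
qed

lemma species_of_map:
  assumes m: "m \<in> Hom (sM D) q p" shows "FAr F m \<in> Hom (PSh D) (FOb F q) (FOb F p)"
proof -
  note v' = is_functorD[OF v] and M = sM_map_Hom[OF v m]
  have w: "q \<in> lists (Ob D)" "p \<in> lists (Ob D)" using sMD.Hom_Ob[OF m] by simp_all
  have in_p: "act (FOb v x) (sM_map v m) a \<in> FOb (FOb F p) x" if "x \<in> Ob D" "a \<in> FOb (FOb F q) x" for x a
    using act_in[OF v'(3)[OF that(1)] M] that species_of_FOb[OF w(1)] species_of_FOb[OF w(2)] by simp
  show ?thesis unfolding PSh_Hom
  proof (rule set_ntrI[OF species_of_psh[OF w(1)]
    species_of_psh[OF w(2)] _ _ _ _ _ category_op_cat[OF D.category_axioms]])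
    show "NDom (FAr F m) = FOb F q" "NCod (FAr F m) = FOb F p" "At (FAr F m) \<in> extensional (Ob (op_cat D))"
      using HomD[OF m] w by (simp_all add: species_of_def)
    show "At (FAr F m) x \<in> Hom Set_cat (FOb (FOb F q) x) (FOb (FOb F p) x)" if "x \<in> Ob (op_cat D)" for x
      using that in_p pshD(1)[OF species_of_psh[OF w(1)]] pshD(1)[OF species_of_psh[OF w(2)]]
      by (simp add: species_of_At[OF m] sarr_of_Hom)
    show "app (At (FAr F m) y) (app (FAr (FOb F q) f) a) = app (FAr (FOb F p) f) (app (At (FAr F m) x) a)"
      if f: "f \<in> Hom (op_cat D) x y" and a: "a \<in> FOb (FOb F q) x" for f x y a
    proof -
      have h: "f \<in> Hom D y x" "x \<in> Ob D" "y \<in> Ob D" using f D.Hom_Ob[of f y x] by simp_all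
      have a': "a \<in> FOb A (FOb v x, map (FOb v) q)" using a species_of_FOb[OF w(1) h(2)] by simp
      have "app (FAr (FOb F q) f) a \<in> FOb (FOb F q) y"
        using pshD(2)[OF species_of_psh[OF w(1)] h(1) a] .
      then show ?thesis using act_lact[OF v'(4)[OF h(1)] M a'] a in_p[OF h(2) a]
        by (simp add: species_of_At[OF m h(2)] species_of_At[OF m h(3)] species_of_FAr[OF w(1) h(1)]
          species_of_FAr[OF w(2) h(1)])
    qed
  qed
qed

lemma species_of_functor: "is_functor (sM D) (PSh D) F"
proof (rule is_functorI)
  note v' = is_functorD[OF v]
  show "FOb F \<in> extensional (Ob (sM D))" "FAr F \<in> extensional (Ar (sM D))"
    by (simp_all add: species_of_def Let_def)
  show "FOb F p \<in> Ob (PSh D)" if "p \<in> Ob (sM D)" for p using species_of_psh that by simp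
  interpret P: category "PSh D" by (rule category_PSh[OF D.category_axioms])
  show "FAr F (Ide (sM D) p) = Ide (PSh D) (FOb F p)" if p: "p \<in> Ob (sM D)" for p
  proof (rule psh_map_eqI[OF species_of_map[OF sMD.Ide_Hom[OF p]] P.Ide_Hom])
    have p': "p \<in> lists (Ob D)" using p by simp
    show "FOb F p \<in> Ob (PSh D)" using species_of_psh[OF p'] by simp
    fix x a assume x: "x \<in> Ob D" and a: "a \<in> FOb (FOb F p) x"
    have a': "a \<in> FOb A (FOb v x, map (FOb v) p)" using a species_of_FOb[OF p' x] by simp
    show "app (At (FAr F (Ide (sM D) p)) x) a = app (At (Ide (PSh D) (FOb F p)) x) a"
      unfolding species_of_At[OF sMD.Ide_Hom[OF p] x] app_sarr_of[OF a] sM_map_Ide[OF v p']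
        act_Ide[OF v'(3)[OF x] v_word[OF p'] a'] PSh_Ide_At[OF x a] ..
  qed
  show "FAr F (Comp (sM D) n m) = Comp (PSh D) (FAr F n) (FAr F m)"
    if m: "m \<in> Hom (sM D) q p" and n: "n \<in> Hom (sM D) p r" for m n q p r
  proof (rule psh_map_eqI[OF species_of_map[OF sMD.Comp_Hom[OF m n]] P.Comp_Hom[OF species_of_map[OF m]
    species_of_map[OF n]]])
    fix x a assume x: "x \<in> Ob D" and a: "a \<in> FOb (FOb F q) x"
    have q: "q \<in> lists (Ob D)" using sMD.Hom_Ob[OF m] by simp
    have a': "a \<in> FOb A (FOb v x, map (FOb v) q)" using a species_of_FOb[OF q x] by simp
    have "app (At (FAr F m) x) a \<in> FOb (FOb F p) x" by (rule psh_ntrD(1)[OF species_of_map[OF m] x a])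
    then have b: "act (FOb v x) (sM_map v m) a \<in> FOb (FOb F p) x"
      unfolding species_of_At[OF m x] app_sarr_of[OF a] .
    show "app (At (FAr F (Comp (sM D) n m)) x) a = app (At (Comp (PSh D) (FAr F n) (FAr F m)) x) a"
      unfolding PSh_Comp_At[OF species_of_map[OF m] x a] species_of_At[OF sMD.Comp_Hom[OF m n] x]
        species_of_At[OF m x]
        species_of_At[OF n x] app_sarr_of[OF a] app_sarr_of[OF b] sM_map_Comp[OF v m n]
      by (rule act_Comp[OF v'(3)[OF x] sM_map_Hom[OF v m] sM_map_Hom[OF v n] a'])
  qed
qed (rule species_of_map)

lemma species_of_action_species_of:
  assumes "inverse_functors C D u v"
  shows "species_of_action C A \<phi> act D F u v"
proof (unfold_locales, rule species_of_functor, rule assms)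
  show "FOb (FOb F p) x = FOb A (FOb v x, map (FOb v) p)" if "p \<in> lists (Ob D)" "x \<in> Ob D" for p x
    using that by (rule species_of_FOb)
  show "app (FAr (FOb F p) f) a = lact C A (FAr v f) (map (FOb v) p) a"
    if "p \<in> lists (Ob D)" "f \<in> Hom D x y" "a \<in> FOb A (FOb v y, map (FOb v) p)" for p f x y a
    using that species_of_FAr[OF that(1,2)] species_of_FOb[OF that(1) D.Hom_Ob(2)[OF that(2)]] by simp
  show "app (At (FAr F m) x) a = act (FOb v x) (sM_map v m) a"
    if "m \<in> Hom (sM D) q p" "x \<in> Ob D" "a \<in> FOb A (FOb v x, map (FOb v) q)" for m q p x a
    using that species_of_At[OF that(1,2)] species_of_FOb[of q x] sMD.Hom_Ob(1)[OF that(1)] by simp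
qed

end

end

text \<open>
  An isomorphism from \<open>R\<close> to \<open>P\<close> over \<open>u\<close> has components \<open>R(u\<^sup>*X)(c) \<rightarrow> P(X)(u c)\<close>. Taking \<open>c = v x\<close> makes the
  targets exactly the sets \<open>P(X)(x)\<close>.
\<close>

definition base_change_bijections ::
    "'u::set_universe scat \<Rightarrow> 'u scat \<Rightarrow> 'u pend \<Rightarrow> 'u pend \<Rightarrow> 'u sftr \<Rightarrow> 'u sftr \<Rightarrow>
      ('u psh \<Rightarrow> 'u \<Rightarrow> 'u \<Rightarrow> 'u) \<Rightarrow> bool" where
  "base_change_bijections C D R P u v T \<longleftrightarrow>
    (\<forall>X\<in>Ob (PSh D). \<forall>x\<in>Ob D.
      bij_betw (T X x) (FOb (FOb R (comp_ftr (op_cat C) X u)) (FOb v x)) (FOb (FOb P X) x)) \<and>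
    (\<forall>X f x y z. X \<in> Ob (PSh D) \<longrightarrow> f \<in> Hom D x y \<longrightarrow> z \<in> FOb (FOb R (comp_ftr (op_cat C) X u)) (FOb v y) \<longrightarrow>
      T X x (app (FAr (FOb R (comp_ftr (op_cat C) X u)) (FAr v f)) z) = app (FAr (FOb P X) f) (T X y z)) \<and>
    (\<forall>\<alpha> X Y x z. \<alpha> \<in> Hom (PSh D) X Y \<longrightarrow> x \<in> Ob D \<longrightarrow> z \<in> FOb (FOb R (comp_ftr (op_cat C) X u)) (FOb v x) \<longrightarrow>
      T Y x (app (At (FAr R (FAr (reindex C D u) \<alpha>)) (FOb v x)) z) = app (At (FAr P \<alpha>) x) (T X x z))"

text \<open>
  The two composites lie over identity functors, so the base functors are mutually inverse. Then
  \<open>v\<^sup>*u\<^sup>*X = X\<close>, and the inverse of the component at \<open>X\<close> is the component of the inverse arrow at \<open>u\<^sup>*X\<close>.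
\<close>

lemma EndDFib_iso_bijections:
  assumes "isomorphic EndDFib (C, R) (D, P)"
  shows "\<exists>u v T. inverse_functors C D u v \<and> base_change_bijections C D R P u v T"
proof -
  obtain a b where a: "a \<in> Hom EndDFib (C, R) (D, P)" and b: "b \<in> Hom EndDFib (D, P) (C, R)"
    and ba: "Comp EndDFib b a = Ide EndDFib (C, R)" and ab: "Comp EndDFib a b = Ide EndDFib (D, P)"
    using assms unfolding isomorphic_def by blast
  note a' = a[unfolded EndDFib_Hom_iff] and b' = b[unfolded EndDFib_Hom_iff]
  define u v where "u = Base a" and "v = Base b"
  have u: "is_functor C D u" and v: "is_functor D C v" using a' b' by (simp_all add: u_def v_def)
  have sC: "small_category C" and sD: "small_category D" and R: "is_functor (PSh C) (PSh C) R"
    and P: "is_functor (PSh D) (PSh D) P"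
    using a' by (simp_all add: small_cats_iff)
  interpret C: small_category C by (rule sC)
  interpret D: small_category D by (rule sD)
  have al: "Over a \<in> Hom (fun_cat (PSh D) (PSh C)) (comp_ftr (PSh D) R (reindex C D u)) (comp_ftr (PSh D)
    (reindex C D u) P)"
    and be: "Over b \<in> Hom (fun_cat (PSh C) (PSh D)) (comp_ftr (PSh C) P (reindex D C v)) (comp_ftr (PSh C)
      (reindex D C v) R)"
    using a' b' unfolding u_def v_def by blast+
  have ba': "comp_ftr C v u = id_ftr C" and
    ba_At: "\<And>Y. Y \<in> Ob (PSh C) \<Longrightarrow>
      Comp (PSh C) (FAr (reindex C D u) (At (Over b) Y)) (At (Over a) (FOb (reindex D C v) Y))
      = Ide (PSh C) (FOb R Y)"
    using ba a' b' EndDFib_Comp[of a C R D P b C R]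
      by (auto simp: EndDFib_Ide u_def v_def fun_eq_iff restrict_def simp del: PSh_simps dest!: fun_cong
      split: if_splits)
  have ab': "comp_ftr D u v = id_ftr D" and
    ab_At: "\<And>X. X \<in> Ob (PSh D) \<Longrightarrow>
      Comp (PSh D) (FAr (reindex D C v) (At (Over a) X)) (At (Over b) (FOb (reindex C D u) X))
      = Ide (PSh D) (FOb P X)"
    using ab a' b' EndDFib_Comp[of b D P C R a D P]
      by (auto simp: EndDFib_Ide u_def v_def fun_eq_iff restrict_def simp del: PSh_simps dest!: fun_cong
      split: if_splits)
  have vu: "FOb v (FOb u x) = x" if "x \<in> Ob C" for x
    using that arg_cong[OF ba', of "\<lambda>F. FOb F x"] by (simp add: comp_ftr_def compose_def)
  have vu': "FAr v (FAr u f) = f" if "f \<in> Ar C" for f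
    using that arg_cong[OF ba', of "\<lambda>F. FAr F f"] by (simp add: comp_ftr_def compose_def)
  have uv: "FOb u (FOb v x) = x" if "x \<in> Ob D" for x
    using that arg_cong[OF ab', of "\<lambda>F. FOb F x"] by (simp add: comp_ftr_def compose_def)
  have uv': "FAr u (FAr v f) = f" if "f \<in> Ar D" for f
    using that arg_cong[OF ab', of "\<lambda>F. FAr F f"] by (simp add: comp_ftr_def compose_def)
  have uX: "FOb (reindex C D u) X = comp_ftr (op_cat C) X u" "comp_ftr (op_cat C) X u \<in> Ob (PSh C)"
      "FOb (reindex D C v) (comp_ftr (op_cat C) X u) = X" if X: "X \<in> Ob (PSh D)" for X
  proof -
    show i: "comp_ftr (op_cat C) X u \<in> Ob (PSh C)" by (rule reindex_psh[OF C.category_axioms u X])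
    show "FOb (reindex C D u) X = comp_ftr (op_cat C) X u" by (rule reindex_FOb[OF X])
    have X': "is_functor (op_cat D) Set_cat X" using X by simp
    have "comp_ftr (op_cat D) (comp_ftr (op_cat C) X u) v = X"
    proof (rule functor_eqI[where C = D])
      show "FOb (comp_ftr (op_cat D) (comp_ftr (op_cat C) X u) v) x = FOb X x" if "x \<in> Ob D" for x
        using that is_functorD(3)[OF v] uv by simp
      show "FAr (comp_ftr (op_cat D) (comp_ftr (op_cat C) X u) v) f = FAr X f" if "f \<in> Ar D" for f
        using that HomD(1)[OF is_functorD(4)[OF v Ar_Hom]] uv' by simp
    qed (use is_functorD(1,2)[OF X'] in \<open>simp_all add: comp_ftr_def\<close>)
    then show "FOb (reindex D C v) (comp_ftr (op_cat C) X u) = X" using reindex_FOb[OF i] by simp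
  qed
  have comp_at: "FOb (comp_ftr K G H) X = FOb G (FOb H X)" if "X \<in> Ob K" for K G H X
    using that by (simp add: comp_ftr_def compose_def)
  have PX: "FOb P X \<in> Ob (PSh D)" if "X \<in> Ob (PSh D)" for X using is_functorD(3)[OF P that] .
  have alX: "At (Over a) X \<in> Hom (PSh C) (FOb R (comp_ftr (op_cat C) X u)) (comp_ftr (op_cat C) (FOb P X) u)"
    if X: "X \<in> Ob (PSh D)" for X
  proof -
    have "At (Over a) X \<in> Hom (PSh C) (FOb (comp_ftr (PSh D) R (reindex C D u)) X) (FOb (comp_ftr (PSh D)
      (reindex C D u) P) X)"
      using al X unfolding ntr_Hom_iff by blast
    then show ?thesis unfolding comp_at[OF X] uX(1)[OF X] reindex_FOb[OF PX[OF X]] .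
  qed
  have beX: "At (Over b) (comp_ftr (op_cat C) X u) \<in> Hom (PSh D) (FOb P X) (comp_ftr (op_cat D) (FOb R
    (comp_ftr (op_cat C) X u)) v)"
    if X: "X \<in> Ob (PSh D)" for X
  proof -
    have "At (Over b) (comp_ftr (op_cat C) X u) \<in> Hom (PSh D) (FOb (comp_ftr (PSh C) P (reindex D C v))
      (comp_ftr (op_cat C) X u))
        (FOb (comp_ftr (PSh C) (reindex D C v) R) (comp_ftr (op_cat C) X u))"
      using be uX(2)[OF X] unfolding ntr_Hom_iff by blast
    then show ?thesis unfolding comp_at[OF uX(2)[OF X]] uX(3)[OF X]
      reindex_FOb[OF is_functorD(3)[OF R uX(2)[OF X]]] .
  qed
  define T where "T X x = app (At (At (Over a) X) (FOb v x))" for X x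
  have vx: "FOb v x \<in> Ob C" if "x \<in> Ob D" for x using is_functorD(3)[OF v that] .
  have T_in: "T X x z \<in> FOb (FOb P X) x"
    if "X \<in> Ob (PSh D)" "x \<in> Ob D" "z \<in> FOb (FOb R (comp_ftr (op_cat C) X u)) (FOb v x)" for X x z
    using psh_ntrD(1)[OF alX[OF that(1)] vx[OF that(2)] that(3)] uv[OF that(2)] vx[OF that(2)]
      by (simp add: T_def)
  have bij: "bij_betw (T X x) (FOb (FOb R (comp_ftr (op_cat C) X u)) (FOb v x)) (FOb (FOb P X) x)"
    if X: "X \<in> Ob (PSh D)" and x: "x \<in> Ob D" for X x
  proof (rule bij_betw_byWitness[where f' = "app (At (At (Over b) (comp_ftr (op_cat C) X u)) x)"])
    show "\<forall>z\<in>FOb (FOb R (comp_ftr (op_cat C) X u)) (FOb v x). app (At (At (Over b) (comp_ftr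
      (op_cat C) X u)) x) (T X x z) = z"
    proof
      fix z assume z: "z \<in> FOb (FOb R (comp_ftr (op_cat C) X u)) (FOb v x)"
      have "app (At (FAr (reindex C D u) (At (Over b) (comp_ftr (op_cat C) X u))) (FOb v x)) (T X x z) = z"
        using arg_cong[OF ba_At[OF uX(2)[OF X]], of "\<lambda>n. app (At n (FOb v x)) z"]
        unfolding uX(3)[OF X] PSh_Comp_At[OF alX[OF X] vx[OF x] z] PSh_Ide_At[OF vx[OF x] z] T_def .
      then show "app (At (At (Over b) (comp_ftr (op_cat C) X u)) x) (T X x z) = z"
        by (simp add: reindex_At[OF beX[OF X] vx[OF x]] uv[OF x])
    qed
    show "\<forall>z\<in>FOb (FOb P X) x. T X x (app (At (At (Over b) (comp_ftr (op_cat C) X u)) x) z) = z"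
    proof
      fix z assume z: "z \<in> FOb (FOb P X) x"
      have "app (At (FAr (reindex D C v) (At (Over a) X)) x) (app (At (At (Over b) (comp_ftr
        (op_cat C) X u)) x) z) = z"
        using arg_cong[OF ab_At[OF X], of "\<lambda>n. app (At n x) z"]
        unfolding uX(1)[OF X] PSh_Comp_At[OF beX[OF X] x z] PSh_Ide_At[OF x z] .
      then show "T X x (app (At (At (Over b) (comp_ftr (op_cat C) X u)) x) z) = z"
        by (simp add: reindex_At[OF alX[OF X] x] T_def)
    qed
    show "T X x ` FOb (FOb R (comp_ftr (op_cat C) X u)) (FOb v x) \<subseteq> FOb (FOb P X) x"
      using T_in[OF X x] by blast
    show "app (At (At (Over b) (comp_ftr (op_cat C) X u)) x) ` FOb (FOb P X) x \<subseteq> FOb (FOb R (comp_ftr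
      (op_cat C) X u)) (FOb v x)"
      using psh_ntrD(1)[OF beX[OF X] x] x by auto
  qed
  have act: "T X x (app (FAr (FOb R (comp_ftr (op_cat C) X u)) (FAr v f)) z)
    = app (FAr (FOb P X) f) (T X y z)"
    if X: "X \<in> Ob (PSh D)" and f: "f \<in> Hom D x y"
      and z: "z \<in> FOb (FOb R (comp_ftr (op_cat C) X u)) (FOb v y)" for X f x y z
    using psh_ntrD(2)[OF alX[OF X] is_functorD(4)[OF v f] vx[OF D.Hom_Ob(2)[OF f]] z]
      HomD(1)[OF is_functorD(4)[OF v f]] uv'[OF HomD(1)[OF f]] by (simp add: T_def)
  have nat: "T Y x (app (At (FAr R (FAr (reindex C D u) \<alpha>)) (FOb v x)) z) = app (At (FAr P \<alpha>) x) (T X x z)"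
    if m: "\<alpha> \<in> Hom (PSh D) X Y" and x: "x \<in> Ob D"
      and z: "z \<in> FOb (FOb R (comp_ftr (op_cat C) X u)) (FOb v x)" for \<alpha> X Y x z
  proof -
    have XY: "X \<in> Ob (PSh D)" "Y \<in> Ob (PSh D)"
      using category.Hom_Ob[OF category_PSh[OF D.category_axioms] m] by simp_all
    have "Comp (PSh C) (At (Over a) Y) (FAr (comp_ftr (PSh D) R (reindex C D u)) \<alpha>)
      = Comp (PSh C) (FAr (comp_ftr (PSh D) (reindex C D u) P) \<alpha>) (At (Over a) X)"
      using al m unfolding ntr_Hom_iff by blast
    then have e: "Comp (PSh C) (At (Over a) Y) (FAr R (FAr (reindex C D u) \<alpha>))
      = Comp (PSh C) (FAr (reindex C D u) (FAr P \<alpha>)) (At (Over a) X)"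
      using HomD(1)[OF m] by (simp add: comp_ftr_def compose_def)
    note Ra = is_functorD(4)[OF R reindex_map_Hom[OF C.category_axioms D.category_axioms u m]]
    note Pa = is_functorD(4)[OF P m]
    show ?thesis
      using arg_cong[OF e, of "\<lambda>n. app (At n (FOb v x)) z"]
      unfolding PSh_Comp_At[OF Ra vx[OF x] z] PSh_Comp_At[OF alX[OF XY(1)] vx[OF x] z]
        reindex_At[OF Pa vx[OF x]] uv[OF x] T_def .
  qed
  have "inverse_functors C D u v" using u v uv uv' vu vu' by (simp add: inverse_functors_def)
  moreover have "base_change_bijections C D R P u v T"
    unfolding base_change_bijections_def using bij act nat by blast
  ultimately show ?thesis by blast
qed

text \<open>
  The comparison bijections followed by those of the given isomorphism go from the Kan extension to
  \<open>P\<close>, which is known to be a functor; transport yields that the Kan extension is one too.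
\<close>

theorem representation_analytic:
  assumes "((C, A), h) \<in> Ob GphS" "isomorphic EndDFib (C, rdd C A (Over h)) (D, P)"
    and "(D, P) \<in> Ob EndDFib"
  shows "analytic D P"
proof -
  define \<phi> where "\<phi> = Over h"
  obtain act where act: "sym_action C A \<phi> act" using algebra_sym_action[OF assms(1)] unfolding \<phi>_def by blast
  interpret sym_action C A \<phi> act by (rule act)
  obtain u v T where inv: "inverse_functors C D u v" and T: "base_change_bijections C D (rdd C A \<phi>) P u v T"
    using EndDFib_iso_bijections[OF assms(2)[folded \<phi>_def]] by blast
  have sD: "small_category D" and P: "is_functor (PSh D) (PSh D) P" using assms(3)
    by (simp_all add: small_cats_iff)
  interpret species_of_action C A \<phi> act D "species_of C A act D v" u v
    by (rule species_of_action_species_of[OF sD _ inv]) (use inv in \<open>simp add: inverse_functors_def\<close>)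
  let ?F = "species_of C A act D v"
  have "isomorphic (fun_cat (PSh D) (PSh D)) P (lan D ?F)"
  proof (rule transport_endofunctor_back[OF D.category_axioms P D.endo_data_lan,
        where k = "\<lambda>X x. T X x \<circ> comparison X x"])
    fix X x assume X: "X \<in> Ob (PSh D)" "x \<in> Ob D"
    show "small (FOb (FOb (lan D ?F) X) x)"
      unfolding D.lan_FOb[OF X] by (rule small_quot[OF D.small_lanP[OF X]])
    have "bij_betw (T X x) (FOb (FOb (rdd C A \<phi>) (pull X)) (FOb v x)) (FOb (FOb P X) x)"
      using T X unfolding base_change_bijections_def by blast
    then show "bij_betw (T X x \<circ> comparison X x) (FOb (FOb (lan D ?F) X) x) (FOb (FOb P X) x)"
      by (rule bij_betw_trans[OF comparison_bij(1)[OF X]])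
  next
    fix X f x y w assume h: "X \<in> Ob (PSh D)" "f \<in> Hom D x y" "w \<in> FOb (FOb (lan D ?F) X) y"
    have "comparison X y w \<in> FOb (FOb (rdd C A \<phi>) (pull X)) (FOb v y)"
      using bij_betwE[OF comparison_bij(1)[OF h(1) D.Hom_Ob(2)[OF h(2)]]] h(3) by blast
    then have "T X x (app (FAr (FOb (rdd C A \<phi>) (pull X)) (FAr v f)) (comparison X y w))
        = app (FAr (FOb P X) f) (T X y (comparison X y w))"
      using T h(1,2) unfolding base_change_bijections_def by blast
    then show "app (FAr (FOb (lan D ?F) X) f) w \<in> FOb (FOb (lan D ?F) X) x \<and>
        (T X x \<circ> comparison X x) (app (FAr (FOb (lan D ?F) X) f) w)
          = app (FAr (FOb P X) f) ((T X y \<circ> comparison X y) w)"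
      using comparison_act[OF h] by simp
  next
    fix X Y \<alpha> x w assume h: "\<alpha> \<in> Hom (PSh D) X Y" "x \<in> Ob D" "w \<in> FOb (FOb (lan D ?F) X) x"
    have "X \<in> Ob (PSh D)" using category.Hom_Ob[OF category_PSh[OF D.category_axioms] h(1)] by simp
    then have "comparison X x w \<in> FOb (FOb (rdd C A \<phi>) (pull X)) (FOb v x)"
      using bij_betwE[OF comparison_bij(1)[OF _ h(2)]] h(3) by blast
    then have "T Y x (app (At (FAr (rdd C A \<phi>) (FAr (reindex C D u) \<alpha>)) (FOb v x)) (comparison X x w))
        = app (At (FAr P \<alpha>) x) (T X x (comparison X x w))"
      using T h(1,2) unfolding base_change_bijections_def by blast
    then show "app (At (FAr (lan D ?F) \<alpha>) x) w \<in> FOb (FOb (lan D ?F) Y) x \<and>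
        (T Y x \<circ> comparison Y x) (app (At (FAr (lan D ?F) \<alpha>) x) w)
          = app (At (FAr P \<alpha>) x) ((T X x \<circ> comparison X x) w)"
      using comparison_map[OF h] by simp
  qed
  then show ?thesis unfolding analytic_def using D.F_functor by blast
qed

section \<open>Analytic endofunctors are represented by algebras\<close>

context species
begin

text \<open>
  Restriction of \<open>F\<close> to \<open>M C\<close>, with the presheaf argument made explicit.
\<close>

definition gph_of :: "'u gph" where
  "gph_of = \<lparr>FOb = (\<lambda>(x, p)\<in>Ob (gcat C). FOb (FOb F p) x),
     FAr = (\<lambda>(f, v)\<in>Ar (gcat C).
       sarr_of (FOb (FOb F (Dom (M C) v)) (Cod C f)) (FOb (FOb F (Cod (M C) v)) (Dom C f))
         (\<lambda>a. app (At (FAr F (incl v)) (Dom C f)) (app (FAr (FOb F (Dom (M C) v)) f) a)))\<rparr>"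

lemma gph_of_FOb: "x \<in> Ob C \<Longrightarrow> p \<in> words \<Longrightarrow> FOb gph_of (x, p) = FOb (FOb F p) x"
  by (simp add: gph_of_def)

lemma gph_of_FAr:
  assumes "f \<in> Hom C x y" "v \<in> Hom (M C) q p"
  shows "FAr gph_of (f, v) = sarr_of (FOb (FOb F q) y) (FOb (FOb F p) x)
    (\<lambda>a. app (At (FAr F (incl v)) x) (app (FAr (FOb F q) f) a))"
  using HomD[OF assms(1)] HomD[OF assms(2)] by (auto simp: gph_of_def)

lemma word_Ide: "p \<in> words \<Longrightarrow> Ide (M C) p \<in> Hom (M C) p p"
  using M.Ide_Hom[of p] by simp

lemma gph_of_functor: "is_functor (gcat C) Set_cat gph_of"
proof (rule set_functorI[OF _ _ _ _ _ _ category_gcat])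
  show "FOb gph_of \<in> extensional (Ob (gcat C))" "FAr gph_of \<in> extensional (Ar (gcat C))"
    by (simp_all add: gph_of_def)
  show "small (FOb gph_of z)" if "z \<in> Ob (gcat C)" for z
    using that pshD(1)[OF F_psh] gph_of_FOb[of "fst z" "snd z"] by (cases z) simp
  show "FAr gph_of k \<in> Hom Set_cat (FOb gph_of z) (FOb gph_of z')" if k: "k \<in> Hom (gcat C) z z'" for k z z'
  proof -
    obtain f v y p x p' where e: "k = (f, v)" "z = (y, p)" "z' = (x, p')" by (metis surj_pair)
    then have h: "f \<in> Hom C x y" "v \<in> Hom (M C) p p'" using k by (simp_all add: gcat_Hom_iff)
    have o: "x \<in> Ob C" "y \<in> Ob C" "p \<in> words" "p' \<in> words" using Hom_Ob[OF h(1)] M.Hom_Ob[OF h(2)] by simp_all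
    show ?thesis unfolding e gph_of_FAr[OF h] gph_of_FOb[OF o(2,3)] gph_of_FOb[OF o(1,4)]
      by (intro sarr_of_Hom pshD(1)[OF F_psh] o F_act_in[OF o(1) incl_Hom[OF h(2)]]
        pshD(2)[OF F_psh[OF o(3)] h(1)])
  qed
  show "app (FAr gph_of (Ide (gcat C) z)) a = a" if z: "z \<in> Ob (gcat C)" and a: "a \<in> FOb gph_of z" for z a
  proof -
    obtain x p where e: "z = (x, p)" and o: "x \<in> Ob C" "p \<in> words" using z by auto
    have a': "a \<in> FOb (FOb F p) x" using a gph_of_FOb[OF o] by (simp add: e)
    show ?thesis unfolding e gcat_simps(3) gph_of_FAr[OF Ide_Hom[OF o(1)] word_Ide[OF o(2)]]
      app_sarr_of[OF a']
        incl_Ide pshD(3)[OF F_psh[OF o(2)] o(1) a'] F_act_Ide[OF o a'] ..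
  qed
  show "app (FAr gph_of (Comp (gcat C) l k)) a = app (FAr gph_of l) (app (FAr gph_of k) a)"
    if k: "k \<in> Hom (gcat C) z z'" and l: "l \<in> Hom (gcat C) z' z''" and a: "a \<in> FOb gph_of z"
      for k l z z' z'' a
  proof -
    obtain f v y p x p' where e: "k = (f, v)" "z = (y, p)" "z' = (x, p')" by (metis surj_pair)
    obtain g w x' p'' where e': "l = (g, w)" "z'' = (x', p'')" by (metis surj_pair)
    have h: "f \<in> Hom C x y" "v \<in> Hom (M C) p p'" "g \<in> Hom C x' x" "w \<in> Hom (M C) p' p''"
      using k l e e' by (simp_all add: gcat_Hom_iff)
    have o: "x \<in> Ob C" "y \<in> Ob C" "x' \<in> Ob C" "p \<in> words" "p' \<in> words"
      using Hom_Ob[OF h(1)] Hom_Ob[OF h(3)] M.Hom_Ob[OF h(2)] by simp_all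
    have a': "a \<in> FOb (FOb F p) y" using a gph_of_FOb[OF o(2,4)] by (simp add: e)
    note fa = pshD(2)[OF F_psh[OF o(4)] h(1) a']
    note vfa = F_act_in[OF o(1) incl_Hom[OF h(2)] fa] and gfa = pshD(2)[OF F_psh[OF o(4)] h(3) fa]
    show ?thesis
      unfolding e e' gcat_simps(4) gph_of_FAr[OF Comp_Hom[OF h(3,1)] M.Comp_Hom[OF h(2,4)]]
        gph_of_FAr[OF h(1,2)] gph_of_FAr[OF h(3,4)] app_sarr_of[OF a'] app_sarr_of[OF vfa]
        incl_Comp F_act_nat[OF h(3) incl_Hom[OF h(2)] fa] pshD(4)[OF F_psh[OF o(4)] h(1,3) a']
        F_act_Comp[OF o(3) incl_Hom[OF h(2)] incl_Hom[OF h(4)] gfa] ..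
  qed
qed unfold_locales

sublocale G: graph C gph_of
  by unfold_locales (rule gph_of_functor)

lemma lact_gph_of:
  assumes "f \<in> Hom C x y" "p \<in> words" "a \<in> FOb (FOb F p) y"
  shows "lact C gph_of f p a = app (FAr (FOb F p) f) a"
  unfolding lact_def gph_of_FAr[OF assms(1) word_Ide[OF assms(2)]] app_sarr_of[OF assms(3)] incl_Ide
  by (rule F_act_Ide[OF Hom_Ob(1)[OF assms(1)] assms(2) pshD(2)[OF F_psh[OF assms(2)] assms(1,3)]])

lemma ract_gph_of:
  assumes "x \<in> Ob C" "v \<in> Hom (M C) q p" "a \<in> FOb (FOb F q) x"
  shows "ract C gph_of x v a = app (At (FAr F (incl v)) x) a"
proof -
  have q: "q \<in> words" using M.Hom_Ob(1)[OF assms(2)] by simp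
  show ?thesis unfolding ract_def gph_of_FAr[OF Ide_Hom[OF assms(1)] assms(2)] app_sarr_of[OF assms(3)]
      pshD(3)[OF F_psh[OF q] assms(1,3)] ..
qed

text \<open>
  The structure map \<open>[a, m] \<mapsto> F(m)(a)\<close>, evaluated at a representative.
\<close>

definition alg_of :: "'u gmap" where
  "alg_of = \<lparr>NDom = Sym C gph_of, NCod = gph_of,
     At = (\<lambda>(x, p)\<in>Ob (gcat C). sarr_of (quot (symP C gph_of x p)) (FOb (FOb F p) x)
            (\<lambda>s. let (q, a, m) = rep (symP C gph_of x p) s in app (At (FAr F m) x) a))\<rparr>"

lemma app_alg_of:
  assumes x: "x \<in> Ob C" and m: "m \<in> Hom (sM C) q p" and a: "a \<in> FOb gph_of (x, q)"
  shows "app (At alg_of (x, p)) (cls (symP C gph_of x p) (q, a, m)) = app (At (FAr F m) x) a"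
proof -
  have p: "p \<in> words" using sM.Hom_Ob(2)[OF m] by simp
  have s: "(cls (symP C gph_of x p) (q, a, m) :: 'u) \<in> quot (symP C gph_of x p)"
    by (rule cls_in_quot[OF G.sym_GenI[OF a m]])
  then obtain q' a' m' where r: "a' \<in> FOb gph_of (x, q')" "m' \<in> Hom (sM C) q' p"
      "(cls (symP C gph_of x p) (q, a, m) :: 'u) = cls (symP C gph_of x p) (q', a', m')"
      "rep (symP C gph_of x p) (cls (symP C gph_of x p) (q, a, m) :: 'u) = (q', a', m')"
    by (rule G.rep_symE)
  let ?k = "\<lambda>(q, a, m). app (At (FAr F m) x) a"
  have "?k (q', a', m') = ?k (q, a, m)"
  proof (rule G.sym_lift[OF x _ r(3)[symmetric] G.sym_GenI[OF r(1,2)] G.sym_GenI[OF a m]])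
    fix v t t' b n assume h: "v \<in> Hom (M C) t t'" "b \<in> FOb gph_of (x, t)" "n \<in> Hom (sM C) t' p"
    have t: "t \<in> words" using M.Hom_Ob(1)[OF h(1)] by simp
    note b = h(2)[unfolded gph_of_FOb[OF x t]]
    show "?k (t, b, Comp (sM C) n (incl v)) = ?k (t', ract C gph_of x v b, n)"
      using ract_gph_of[OF x h(1) b] F_act_Comp[OF x incl_Hom[OF h(1)] h(3) b] by simp
  qed
  moreover have "At alg_of (x, p) = sarr_of (quot (symP C gph_of x p)) (FOb (FOb F p) x)
            (\<lambda>s. let (q, a, m) = rep (symP C gph_of x p) s in app (At (FAr F m) x) a)"
    using x p by (simp add: alg_of_def)
  ultimately show ?thesis using s r(4) by simp
qed

sublocale G: sym_action C gph_of alg_of "\<lambda>x m a. app (At (FAr F m) x) a"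
proof
  fix x m q p a assume g: "x \<in> Ob C" "m \<in> Hom (sM C) q p" "a \<in> FOb gph_of (x, q)"
  have w: "p \<in> words" "q \<in> words" using sM.Hom_Ob[OF g(2)] by simp_all
  note a = g(3)[unfolded gph_of_FOb[OF g(1) w(2)]]
  show "app (At (FAr F m) x) a \<in> FOb gph_of (x, p)"
    unfolding gph_of_FOb[OF g(1) w(1)] by (rule F_act_in[OF g(1,2) a])
  show "app (At alg_of (x, p)) (cls (symP C gph_of x p) (q, a, m)) = app (At (FAr F m) x) a"
    by (rule app_alg_of[OF g])
  fix n r assume n: "n \<in> Hom (sM C) p r"
  show "app (At (FAr F (Comp (sM C) n m)) x) a = app (At (FAr F n) x) (app (At (FAr F m) x) a)"
    by (rule F_act_Comp[OF g(1,2) n a])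
next
  fix x p a assume g: "x \<in> Ob C" "p \<in> words" "a \<in> FOb gph_of (x, p)"
  show "app (At (FAr F (Ide (sM C) p)) x) a = a"
    by (rule F_act_Ide[OF g(1,2) g(3)[unfolded gph_of_FOb[OF g(1,2)]]])
next
  fix x v q p a assume g: "x \<in> Ob C" "v \<in> Hom (M C) q p" "a \<in> FOb gph_of (x, q)"
  have q: "q \<in> words" using M.Hom_Ob(1)[OF g(2)] by simp
  show "app (At (FAr F (incl v)) x) a = ract C gph_of x v a"
    by (rule ract_gph_of[OF g(1,2) g(3)[unfolded gph_of_FOb[OF g(1) q]], symmetric])
next
  fix f x y m q p a assume g: "f \<in> Hom C x y" "m \<in> Hom (sM C) q p" "a \<in> FOb gph_of (y, q)"
  have w: "p \<in> words" "q \<in> words" using sM.Hom_Ob[OF g(2)] by simp_all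
  note y = Hom_Ob(2)[OF g(1)]
  note a = g(3)[unfolded gph_of_FOb[OF y w(2)]]
  show "lact C gph_of f p (app (At (FAr F m) y) a) = app (At (FAr F m) x) (lact C gph_of f q a)"
    unfolding lact_gph_of[OF g(1) w(1) F_act_in[OF y g(2) a]] lact_gph_of[OF g(1) w(2) a]
    by (rule F_act_nat[OF g(1,2) a])
qed

lemma alg_of_Hom: "alg_of \<in> Hom (fun_cat (gcat C) Set_cat) (Sym C gph_of) gph_of"
proof (rule set_ntrI[OF G.Sym_functor gph_of_functor _ _ _ _ _ category_gcat])
  show "NDom alg_of = Sym C gph_of" "NCod alg_of = gph_of" "At alg_of \<in> extensional (Ob (gcat C))"
    by (simp_all add: alg_of_def)
  show "At alg_of z \<in> Hom Set_cat (FOb (Sym C gph_of) z) (FOb gph_of z)" if z: "z \<in> Ob (gcat C)" for z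
  proof -
    obtain x p where e: "z = (x, p)" and o: "x \<in> Ob C" "p \<in> words" using z by auto
    have A: "At alg_of (x, p) = sarr_of (quot (symP C gph_of x p)) (FOb (FOb F p) x)
            (\<lambda>s. let (q, a, m) = rep (symP C gph_of x p) s in app (At (FAr F m) x) a)"
      using o by (simp add: alg_of_def)
    show ?thesis unfolding e A gph_of_FOb[OF o] G.Sym_FOb[OF o]
    proof (rule sarr_of_Hom[OF small_quot[OF G.small_symP[OF o(1)]] pshD(1)[OF F_psh[OF o(2)] o(1)]])
      fix s assume "s \<in> quot (symP C gph_of x p)"
      then obtain q a m where r: "a \<in> FOb gph_of (x, q)" "m \<in> Hom (sM C) q p"
        "rep (symP C gph_of x p) s = (q, a, m)"
        by (rule G.rep_symE)
      have "q \<in> words" using sM.Hom_Ob(1)[OF r(2)] by simp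
      then have "a \<in> FOb (FOb F q) x" using r(1) gph_of_FOb[OF o(1)] by simp
      then show "(let (q, a, m) = rep (symP C gph_of x p) s in app (At (FAr F m) x) a) \<in> FOb (FOb F p) x"
        using r F_act_in[OF o(1) r(2)] by simp
    qed
  qed
  show "app (At alg_of z') (app (FAr (Sym C gph_of) k) s) = app (FAr gph_of k) (app (At alg_of z) s)"
    if k: "k \<in> Hom (gcat C) z z'" and s: "s \<in> FOb (Sym C gph_of) z" for k z z' s
  proof -
    obtain f v y p x p' where e: "k = (f, v)" "z = (y, p)" "z' = (x, p')" by (metis surj_pair)
    then have h: "f \<in> Hom C x y" "v \<in> Hom (M C) p p'" using k by (simp_all add: gcat_Hom_iff)
    have o: "x \<in> Ob C" "y \<in> Ob C" "p \<in> words" using Hom_Ob[OF h(1)] M.Hom_Ob[OF h(2)] by simp_all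
    obtain q a m where r: "a \<in> FOb gph_of (y, q)" "m \<in> Hom (sM C) q p" "s = cls (symP C gph_of y p) (q, a, m)"
      using G.symE[OF s[unfolded e G.Sym_FOb[OF o(2,3)]]] .
    have q: "q \<in> words" using sM.Hom_Ob(1)[OF r(2)] by simp
    note a = r(1)[unfolded gph_of_FOb[OF o(2) q]]
    show ?thesis
      unfolding e r(3) G.app_Sym[OF h r(1,2)] app_alg_of[OF o(2) r(2,1)] lact_gph_of[OF h(1) q a]
        app_alg_of[OF o(1) sM.Comp_Hom[OF r(2) incl_Hom[OF h(2)]]
          G.lact_in[OF h(1) q r(1), unfolded lact_gph_of[OF h(1) q a]]]
        gph_of_FAr[OF h] app_sarr_of[OF F_act_in[OF o(2) r(2) a]] F_act_nat[OF h(1) r(2) a]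
      by (rule F_act_Comp[OF o(1) r(2) incl_Hom[OF h(2)] pshD(2)[OF F_psh[OF q] h(1) a]])
  qed
qed unfold_locales

lemma sM_map_id: "m \<in> Hom (sM C) q p \<Longrightarrow> sM_map (id_ftr C) m = m"
  by (auto simp: sM_map_def Hom_def sM_def map_id_ftr(2) split: prod.splits simp del: in_lists_conv_set)

lemma species_of_action_gph_of:
  "species_of_action C gph_of alg_of (\<lambda>x m a. app (At (FAr F m) x) a) C F (id_ftr C) (id_ftr C)"
proof (unfold_locales)
  show "inverse_functors C C (id_ftr C) (id_ftr C)"
    using id_functor[OF category_axioms] by (simp add: inverse_functors_def)
  show "FOb (FOb F p) x = FOb gph_of (FOb (id_ftr C) x, map (FOb (id_ftr C)) p)" if "p \<in> words" "x \<in> Ob C"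
    for p x
    using that gph_of_FOb[OF that(2,1)] by (simp add: map_id_ftr(1) del: in_lists_conv_set)
  show "app (FAr (FOb F p) f) a = lact C gph_of (FAr (id_ftr C) f) (map (FOb (id_ftr C)) p) a"
    if "p \<in> words" "f \<in> Hom C x y" "a \<in> FOb gph_of (FOb (id_ftr C) y, map (FOb (id_ftr C)) p)" for p f x y a
    using that lact_gph_of[OF that(2,1)] gph_of_FOb[OF Hom_Ob(2)[OF that(2)] that(1)] HomD(1)[OF that(2)]
      Hom_Ob(2)[OF that(2)]
    by (simp add: map_id_ftr(1) del: in_lists_conv_set)
  show "app (At (FAr F m) x) a = app (At (FAr F (sM_map (id_ftr C) m)) (FOb (id_ftr C) x)) a"
    if "m \<in> Hom (sM C) q p" "x \<in> Ob C" for m q p x a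
    using that sM_map_id[OF that(1)] by simp
qed

text \<open>
  Here the Kan extension is the known functor, and functoriality is transported to the coequalizer.
\<close>

lemma rdd_iso_lan:
  assumes L: "is_functor (PSh C) (PSh C) (lan C F)"
  shows "is_functor (PSh C) (PSh C) (rdd C gph_of alg_of)"
    and "isomorphic (fun_cat (PSh C) (PSh C)) (lan C F) (rdd C gph_of alg_of)"
proof -
  interpret I: species_of_action C gph_of alg_of "\<lambda>x m a. app (At (FAr F m) x) a" C F "id_ftr C" "id_ftr C"
    by (rule species_of_action_gph_of)
  let ?R = "rdd C gph_of alg_of"
  have pull: "I.pull X = X" if "X \<in> Ob (PSh C)" for X
    using reindex_FOb[OF that, of C "id_ftr C"] that unfolding reindex_id[OF category_axioms] by simp
  have bij: "bij_betw (I.comparison X x) (FOb (FOb (lan C F) X) x) (FOb (FOb ?R X) x)"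
    if "X \<in> Ob (PSh C)" "x \<in> Ob C" for X x
    using I.comparison_bij(1)[OF that] that(2) unfolding pull[OF that(1)] by simp
  have sm: "small (FOb (FOb ?R X) x)" if "X \<in> Ob (PSh C)" "x \<in> Ob C" for X x
    unfolding G.rdd_FOb[OF that] by (rule small_quot[OF G.small_rddP[OF that]])
  have act: "app (FAr (FOb ?R X) f) (I.comparison X y z) = I.comparison X x (app (FAr (FOb (lan C F) X) f) z)"
    if h: "X \<in> Ob (PSh C)" "f \<in> Hom C x y" "z \<in> FOb (FOb (lan C F) X) y" for X f x y z
    using I.comparison_act(2)[OF h] HomD(1)[OF h(2)] unfolding pull[OF h(1)] by simp
  have nat: "app (At (FAr ?R \<alpha>) x) (I.comparison X x z) = I.comparison Y x (app (At (FAr (lan C F) \<alpha>) x) z)"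
    if h: "\<alpha> \<in> Hom (PSh C) X Y" "x \<in> Ob C" "z \<in> FOb (FOb (lan C F) X) x" for X Y \<alpha> x z
    using I.comparison_map(2)[OF h] HomD(1)[OF h(1)] h(2) unfolding reindex_id[OF category_axioms] by simp
  note T = transport_endofunctor[OF category_axioms L G.endo_data_rdd bij sm act nat]
  show "is_functor (PSh C) (PSh C) ?R" "isomorphic (fun_cat (PSh C) (PSh C)) (lan C F) ?R"
    by (rule T; assumption)+
qed

end

lemma (in category) isomorphic_trans:
  assumes "isomorphic C x y" "isomorphic C y z" shows "isomorphic C x z"
proof -
  obtain f g where f: "f \<in> Hom C x y" "g \<in> Hom C y x" "Comp C g f = Ide C x" "Comp C f g = Ide C y"
    using assms(1) unfolding isomorphic_def by blast
  obtain h k where h: "h \<in> Hom C y z" "k \<in> Hom C z y" "Comp C k h = Ide C y" "Comp C h k = Ide C z"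
    using assms(2) unfolding isomorphic_def by blast
  have "Comp C (Comp C g k) (Comp C h f) = Ide C x"
    using Comp_assoc[OF Comp_Hom[OF f(1) h(1)] h(2) f(2)] Comp_assoc[OF f(1) h(1,2)]
      Comp_Ide_left[OF f(1)] f(3) h(3) by simp
  moreover have "Comp C (Comp C h f) (Comp C g k) = Ide C z"
    using Comp_assoc[OF Comp_Hom[OF h(2) f(2)] f(1) h(1)] Comp_assoc[OF h(2) f(2,1)]
      Comp_Ide_left[OF h(2)] f(4) h(4) by simp
  ultimately show ?thesis unfolding isomorphic_def using Comp_Hom[OF f(1) h(1)] Comp_Hom[OF h(2) f(2)]
    by blast
qed

lemma isomorphic_sym: "isomorphic C x y \<Longrightarrow> isomorphic C y x"
  unfolding isomorphic_def by blast

lemma EndDFib_iso_over_id: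
  assumes "small_category C" "isomorphic (fun_cat (PSh C) (PSh C)) R P"
  shows "isomorphic EndDFib (C, R) (C, P)"
proof -
  interpret small_category C by fact
  obtain f g where f: "f \<in> Hom (fun_cat (PSh C) (PSh C)) R P" and g: "g \<in> Hom (fun_cat (PSh C) (PSh C)) P R"
    and gf: "Comp (fun_cat (PSh C) (PSh C)) g f = Ide (fun_cat (PSh C) (PSh C)) R"
    and fg: "Comp (fun_cat (PSh C) (PSh C)) f g = Ide (fun_cat (PSh C) (PSh C)) P"
    using assms(2) unfolding isomorphic_def by blast
  have F: "is_functor (PSh C) (PSh C) R" "is_functor (PSh C) (PSh C) P" using f
    by (simp_all only: ntr_Hom_iff)
  define arr where "arr R P n = \<lparr>Src = (C, R), Tgt = (C, P), Base = id_ftr C, Over = n\<rparr>"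
    for R P :: "'a pend" and n :: "'a pendmap"
  have Hom: "arr R P n \<in> Hom EndDFib (C, R) (C, P)"
    if "n \<in> Hom (fun_cat (PSh C) (PSh C)) R P" "is_functor (PSh C) (PSh C) R"
      "is_functor (PSh C) (PSh C) P" for R P n
    using that id_functor[OF category_axioms] assms(1)
    by (simp add: EndDFib_Hom_iff arr_def reindex_id[OF category_axioms]
      comp_ftr_id_left comp_ftr_id_right small_cats_iff
        del: PSh_simps)
  have comp: "Comp EndDFib (arr P R m) (arr R P n) = Ide EndDFib (C, R)"
    if n: "n \<in> Hom (fun_cat (PSh C) (PSh C)) R P" and m: "m \<in> Hom (fun_cat (PSh C) (PSh C)) P R"
      and mn: "Comp (fun_cat (PSh C) (PSh C)) m n = Ide (fun_cat (PSh C) (PSh C)) R" for R P m n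
  proof -
    have F: "is_functor (PSh C) (PSh C) R" using n by (simp only: ntr_Hom_iff)
    have "(\<lambda>X\<in>Ob (PSh C). Comp (PSh C) (FAr (id_ftr (PSh C)) (At m X)) (At n (FOb (id_ftr (PSh C)) X)))
      = (\<lambda>X\<in>Ob (PSh C). Comp (PSh C) (At m X) (At n X))"
    proof (rule restrict_ext)
      fix X assume X: "X \<in> Ob (PSh C)"
      have "At m X \<in> Ar (PSh C)" using m X unfolding ntr_Hom_iff by (blast dest: HomD(1))
      then show "Comp (PSh C) (FAr (id_ftr (PSh C)) (At m X)) (At n (FOb (id_ftr (PSh C)) X))
        = Comp (PSh C) (At m X) (At n X)"
        using X by simp
    qed
    moreover have "\<lparr>NDom = R, NCod = R, At = (\<lambda>X\<in>Ob (PSh C). Comp (PSh C) (At m X) (At n X))\<rparr>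
      = Ide (fun_cat (PSh C) (PSh C)) R"
      using mn HomD(2)[OF n] HomD(3)[OF m] by (simp del: PSh_simps)
    ultimately show ?thesis
      using comp_ftr_id_right[OF id_functor[OF category_axioms]] comp_ftr_id_left[OF F]
        comp_ftr_id_right[OF F]
      by (simp add: EndDFib_Comp[of _ C R C P _ C R] arr_def EndDFib_Ide reindex_id[OF category_axioms]
        del: PSh_simps fun_cat_simps)
  qed
  show ?thesis unfolding isomorphic_def
    using Hom[OF f F] Hom[OF g F(2,1)] comp[OF f g gf] comp[OF g f fg] by blast
qed

text \<open>
  The algebra built from \<open>F\<close> represents \<open>P\<close> over the identity of \<open>C\<close>.
\<close>

theorem analytic_represented:
  assumes "(C, P) \<in> Ob EndDFib" "analytic C P"
  shows "\<exists>A h. ((C, A), h) \<in> Ob GphS \<and> isomorphic EndDFib (C, rdd C A (Over h)) (C, P)"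
proof -
  have C: "small_category C" and P: "is_functor (PSh C) (PSh C) P" using assms(1)
    by (simp_all add: small_cats_iff)
  obtain F where F: "is_functor (sM C) (PSh C) F" and iso: "isomorphic (fun_cat (PSh C) (PSh C)) P (lan C F)"
    using assms(2) unfolding analytic_def by blast
  interpret species C F using C F by (simp add: species_def species_axioms_def)
  \<comment> \<open>Isomorphism in the functor category presupposes that both sides are functors.\<close>
  have L: "is_functor (PSh C) (PSh C) (lan C F)" using iso by (auto simp only: isomorphic_def ntr_Hom_iff)
  interpret E: category "fun_cat (PSh C) (PSh C)"
    by (intro category_fun_cat category_PSh category_axioms)
  have "isomorphic (fun_cat (PSh C) (PSh C)) (rdd C gph_of alg_of) P"
    by (rule isomorphic_sym[OF E.isomorphic_trans[OF iso rdd_iso_lan(2)[OF L]]])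
  then have "isomorphic EndDFib (C, rdd C gph_of (Over (G.alg_arr alg_of))) (C, P)"
    unfolding G.alg_arr_def by (simp add: EndDFib_iso_over_id[OF C])
  then show ?thesis using G.algebra[OF alg_of_Hom] by blast
qed

theorem proposition5p5:
  "ess_image (GphS :: ('u::set_universe alg, 'u algarr) cat) EndDFib rddot
     = {(C, P) \<in> Ob EndDFib. analytic C P}"
proof -
  have FOb: "FOb rddot ((C, A), h) = (C, rdd C A (Over h))" if "((C, A), h) \<in> Ob GphS"
    for C :: "'u scat" and A h
    using that by (simp add: rddot_def)
  show ?thesis
  proof (intro equalityI subsetI)
    fix y :: "'u edob" assume "y \<in> ess_image GphS EndDFib rddot"
    then obtain x :: "'u alg" where y: "y \<in> Ob EndDFib" "x \<in> Ob GphS" "isomorphic EndDFib (FOb rddot x) y"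
      unfolding ess_image_def by blast
    obtain C A h D P where e: "x = ((C, A), h)" "y = (D, P)" by (metis surj_pair)
    show "y \<in> {(C, P) \<in> Ob EndDFib. analytic C P}"
      using y representation_analytic[of C A h D P] FOb[of C A h] unfolding e by simp
  next
    fix y :: "'u edob" assume "y \<in> {(C, P) \<in> Ob EndDFib. analytic C P}"
    then obtain C P where y: "y = (C, P)" "(C, P) \<in> Ob EndDFib" "analytic C P" by blast
    obtain A h where "((C, A), h) \<in> Ob GphS" "isomorphic EndDFib (C, rdd C A (Over h)) (C, P)"
      using analytic_represented[OF y(2,3)] by blast
    then show "y \<in> ess_image GphS EndDFib rddot"
      unfolding ess_image_def y(1) using y(2) FOb by (intro CollectI conjI bexI[of _ "((C, A), h)"]) simp_all
  qed
qed

end
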